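(* Let $A \in \mathbb{R}^{n \times d}$ and $b \in \mathbb{R}^n$, fix $p \in [1,\infty)$ with $p \ne 2$, and fix a constant $\gamma > 0$. The $\ell_p$-regression problem $\min_{x \in \mathbb{R}^d}\|Ax-b\|_p$ can be solved deterministically in the streaming and distributed summary models with a $(d+1)^{O(1/\gamma)} = \mathrm{poly}(d)$ relative error approximation factor, i.e. the output $\hat x$ satisfies $\|A\hat x - b\|_p \le (d+1)^{O(1/\gamma)} \min_{x}\|Ax-b\|_p$. The update time is $\mathrm{poly}(n^{\gamma}(d+1))$, the storage is $O((1/\gamma)\, n^{\gamma}(d+1))$, and the query time is $\mathrm{poly}(n^{\gamma})$.
   Context: Streaming model: the rows of the input (here rows of $[A,b]$) arrive one by one and only a sublinear number of rows may be stored at any time. Distributed summary model: the input is partitioned into blocks of at most $n^\gamma$ rows held at leaves of a computation tree; each node computes a summary of its input, parents merge the summaries of their children and reduce them, until a single summary of bounded size remains at the root, from which the answer is computed. Update time is the time to compute a local summary; query time is the time to compute the answer from the final summary.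
   Formalization: The storage and query-time bounds are claimed only when d+1 ≤ n^γ (for n=d, γ=1/2 exact solvability already needs order d² words), and O(1/γ) is read as O(max(1,1/γ)), which differs only for γ>1. *)

theory Defs
  imports "Jordan_Normal_Form.Matrix"
begin

section \<open>The regression problem\<close>

definition lp_norm :: "real \<Rightarrow> real vec \<Rightarrow> real" where
  "lp_norm p v = (\<Sum>i<dim_vec v. \<bar>v $ i\<bar> powr p) powr (1 / p)"

definition lp_opt :: "real \<Rightarrow> real mat \<Rightarrow> real vec \<Rightarrow> real" where
  "lp_opt p A b = (INF x\<in>carrier_vec (dim_col A). lp_norm p (A *\<^sub>v x - b))"

definition lp_approx_solution :: "real \<Rightarrow> real \<Rightarrow> real mat \<Rightarrow> real vec \<Rightarrow> real vec \<Rightarrow> bool" where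
  "lp_approx_solution p \<alpha> A b x \<longleftrightarrow>
     x \<in> carrier_vec (dim_col A) \<and> lp_norm p (A *\<^sub>v x - b) \<le> \<alpha> * lp_opt p A b"


section \<open>A deterministic real RAM\<close>

text \<open>
  Programs work on two unbounded memories, one of naturals (indices, counters) and one of
  reals, both indirectly addressable, and on a read-only input: the dimensions \<open>n\<close> and \<open>d\<close> and a
  list of messages, each a list of reals. Every operation costs one time unit. The real
  operations are the field operations, comparison and powers of absolute values with a
  fixed exponent. There is no rounding from reals to naturals, so several reals cannot be packed
  into one word. A program is a fixed finite object, independent of the input and its size.
\<close>

datatype input = Input (rows_of: nat) (cols_of: nat) (msgs_of: "real list list")

datatype iexp =
    INat nat
  | IRows | ICols
  | IMsgs
  | IMsgLen iexp
  | IMem iexp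
  | IAdd iexp iexp | ISub iexp iexp | IMul iexp iexp

datatype rexp =
    RReal real
  | RNat iexp
  | RMsg iexp iexp
  | RMem iexp
  | RAdd rexp rexp | RSub rexp rexp | RMul rexp rexp | RDiv rexp rexp
  | RPow rexp real

datatype bexp =
    BLessI iexp iexp
  | BLessR rexp rexp
  | BNot bexp
  | BAnd bexp bexp

datatype com =
    Skip
  | AssignI iexp iexp
  | AssignR iexp rexp
  | Seq com com
  | If bexp com com
  | While bexp com

type_synonym store = "(nat \<Rightarrow> nat) \<times> (nat \<Rightarrow> real)"

definition store0 :: store where
  "store0 = (\<lambda>_. 0, \<lambda>_. 0)"

fun ival :: "input \<Rightarrow> store \<Rightarrow> iexp \<Rightarrow> nat" where
  "ival \<iota> s (INat c) = c"
| "ival \<iota> s IRows = rows_of \<iota>"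
| "ival \<iota> s ICols = cols_of \<iota>"
| "ival \<iota> s IMsgs = length (msgs_of \<iota>)"
| "ival \<iota> s (IMsgLen a) =
     (let i = ival \<iota> s a in if i < length (msgs_of \<iota>) then length (msgs_of \<iota> ! i) else 0)"
| "ival \<iota> s (IMem a) = fst s (ival \<iota> s a)"
| "ival \<iota> s (IAdd a b) = ival \<iota> s a + ival \<iota> s b"
| "ival \<iota> s (ISub a b) = ival \<iota> s a - ival \<iota> s b"
| "ival \<iota> s (IMul a b) = ival \<iota> s a * ival \<iota> s b"

fun rval :: "input \<Rightarrow> store \<Rightarrow> rexp \<Rightarrow> real" where
  "rval \<iota> s (RReal c) = c"
| "rval \<iota> s (RNat a) = real (ival \<iota> s a)"
| "rval \<iota> s (RMsg a b) =
     (let i = ival \<iota> s a; j = ival \<iota> s b in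
      if i < length (msgs_of \<iota>) \<and> j < length (msgs_of \<iota> ! i) then msgs_of \<iota> ! i ! j else 0)"
| "rval \<iota> s (RMem a) = snd s (ival \<iota> s a)"
| "rval \<iota> s (RAdd e f) = rval \<iota> s e + rval \<iota> s f"
| "rval \<iota> s (RSub e f) = rval \<iota> s e - rval \<iota> s f"
| "rval \<iota> s (RMul e f) = rval \<iota> s e * rval \<iota> s f"
| "rval \<iota> s (RDiv e f) = rval \<iota> s e / rval \<iota> s f"
| "rval \<iota> s (RPow e q) = \<bar>rval \<iota> s e\<bar> powr q"

fun bval :: "input \<Rightarrow> store \<Rightarrow> bexp \<Rightarrow> bool" where
  "bval \<iota> s (BLessI a b) \<longleftrightarrow> ival \<iota> s a < ival \<iota> s b"
| "bval \<iota> s (BLessR e f) \<longleftrightarrow> rval \<iota> s e < rval \<iota> s f"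
| "bval \<iota> s (BNot b) \<longleftrightarrow> \<not> bval \<iota> s b"
| "bval \<iota> s (BAnd b c) \<longleftrightarrow> bval \<iota> s b \<and> bval \<iota> s c"

fun icost :: "iexp \<Rightarrow> nat" where
  "icost (IMsgLen a) = 1 + icost a"
| "icost (IMem a) = 1 + icost a"
| "icost (IAdd a b) = 1 + icost a + icost b"
| "icost (ISub a b) = 1 + icost a + icost b"
| "icost (IMul a b) = 1 + icost a + icost b"
| "icost _ = 1"

fun rcost :: "rexp \<Rightarrow> nat" where
  "rcost (RReal c) = 1"
| "rcost (RNat a) = 1 + icost a"
| "rcost (RMsg a b) = 1 + icost a + icost b"
| "rcost (RMem a) = 1 + icost a"
| "rcost (RAdd e f) = 1 + rcost e + rcost f"
| "rcost (RSub e f) = 1 + rcost e + rcost f"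
| "rcost (RMul e f) = 1 + rcost e + rcost f"
| "rcost (RDiv e f) = 1 + rcost e + rcost f"
| "rcost (RPow e q) = 1 + rcost e"

fun bcost :: "bexp \<Rightarrow> nat" where
  "bcost (BLessI a b) = 1 + icost a + icost b"
| "bcost (BLessR e f) = 1 + rcost e + rcost f"
| "bcost (BNot b) = 1 + bcost b"
| "bcost (BAnd b c) = 1 + bcost b + bcost c"

text \<open>
  The span of an expression is the least \<open>m\<close> such that its evaluation accesses
  only cells with addresses below \<open>m\<close> (in either memory).
\<close>

fun ispan :: "input \<Rightarrow> store \<Rightarrow> iexp \<Rightarrow> nat" where
  "ispan \<iota> s (IMsgLen a) = ispan \<iota> s a"
| "ispan \<iota> s (IMem a) = max (ispan \<iota> s a) (Suc (ival \<iota> s a))"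
| "ispan \<iota> s (IAdd a b) = max (ispan \<iota> s a) (ispan \<iota> s b)"
| "ispan \<iota> s (ISub a b) = max (ispan \<iota> s a) (ispan \<iota> s b)"
| "ispan \<iota> s (IMul a b) = max (ispan \<iota> s a) (ispan \<iota> s b)"
| "ispan \<iota> s _ = 0"

fun rspan :: "input \<Rightarrow> store \<Rightarrow> rexp \<Rightarrow> nat" where
  "rspan \<iota> s (RReal c) = 0"
| "rspan \<iota> s (RNat a) = ispan \<iota> s a"
| "rspan \<iota> s (RMsg a b) = max (ispan \<iota> s a) (ispan \<iota> s b)"
| "rspan \<iota> s (RMem a) = max (ispan \<iota> s a) (Suc (ival \<iota> s a))"
| "rspan \<iota> s (RAdd e f) = max (rspan \<iota> s e) (rspan \<iota> s f)"
| "rspan \<iota> s (RSub e f) = max (rspan \<iota> s e) (rspan \<iota> s f)"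
| "rspan \<iota> s (RMul e f) = max (rspan \<iota> s e) (rspan \<iota> s f)"
| "rspan \<iota> s (RDiv e f) = max (rspan \<iota> s e) (rspan \<iota> s f)"
| "rspan \<iota> s (RPow e q) = rspan \<iota> s e"

fun bspan :: "input \<Rightarrow> store \<Rightarrow> bexp \<Rightarrow> nat" where
  "bspan \<iota> s (BLessI a b) = max (ispan \<iota> s a) (ispan \<iota> s b)"
| "bspan \<iota> s (BLessR e f) = max (rspan \<iota> s e) (rspan \<iota> s f)"
| "bspan \<iota> s (BNot b) = bspan \<iota> s b"
| "bspan \<iota> s (BAnd b c) = max (bspan \<iota> s b) (bspan \<iota> s c)"

text \<open>
  \<open>exec \<iota> c s t m s'\<close>: on input \<open>\<iota>\<close>, program \<open>c\<close> started in \<open>s\<close> halts in \<open>s'\<close> after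
  time \<open>t\<close>, all memory accesses being to addresses below \<open>m\<close>.
\<close>

inductive exec :: "input \<Rightarrow> com \<Rightarrow> store \<Rightarrow> nat \<Rightarrow> nat \<Rightarrow> store \<Rightarrow> bool" for \<iota> where
  Skip: "exec \<iota> Skip s 1 0 s"
| AssignI: "exec \<iota> (AssignI a e) s (1 + icost a + icost e)
     (max (Suc (ival \<iota> s a)) (max (ispan \<iota> s a) (ispan \<iota> s e)))
     ((fst s)(ival \<iota> s a := ival \<iota> s e), snd s)"
| AssignR: "exec \<iota> (AssignR a e) s (1 + icost a + rcost e)
     (max (Suc (ival \<iota> s a)) (max (ispan \<iota> s a) (rspan \<iota> s e)))
     (fst s, (snd s)(ival \<iota> s a := rval \<iota> s e))"
| Seq: "exec \<iota> c s t m s' \<Longrightarrow> exec \<iota> c' s' t' m' s'' \<Longrightarrow>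
     exec \<iota> (Seq c c') s (t + t') (max m m') s''"
| IfTrue: "bval \<iota> s b \<Longrightarrow> exec \<iota> c s t m s' \<Longrightarrow>
     exec \<iota> (If b c c') s (1 + bcost b + t) (max (bspan \<iota> s b) m) s'"
| IfFalse: "\<not> bval \<iota> s b \<Longrightarrow> exec \<iota> c' s t m s' \<Longrightarrow>
     exec \<iota> (If b c c') s (1 + bcost b + t) (max (bspan \<iota> s b) m) s'"
| WhileFalse: "\<not> bval \<iota> s b \<Longrightarrow>
     exec \<iota> (While b c) s (1 + bcost b) (bspan \<iota> s b) s"
| WhileTrue: "bval \<iota> s b \<Longrightarrow> exec \<iota> c s t m s' \<Longrightarrow> exec \<iota> (While b c) s' t' m' s'' \<Longrightarrow>
     exec \<iota> (While b c) s (1 + bcost b + t + t') (max (bspan \<iota> s b) (max m m')) s''"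

lemma exec_deterministic:
  assumes "exec \<iota> c s t m s'" and "exec \<iota> c s u k s''"
  shows "t = u \<and> m = k \<and> s' = s''"
  using assms
proof (induction arbitrary: u k s'' rule: exec.induct)
  case (Seq c s t m s' c' t' m' r)
  from Seq.prems show ?case
    by (cases rule: exec.cases) (use Seq.IH in blast)+
next
  case (WhileTrue s b c t m s' t' m' r)
  from WhileTrue.prems show ?case
    by (cases rule: exec.cases) (use WhileTrue.IH WhileTrue.hyps in blast)+
qed (erule exec.cases; blast)+

text \<open>
  Storage in words: the messages given to the program plus the cells of both
  memories up to the largest address used.
\<close>

definition words :: "input \<Rightarrow> nat \<Rightarrow> nat" where
  "words \<iota> m = sum_list (map length (msgs_of \<iota>)) + 2 * m"

definition solution_of :: "nat \<Rightarrow> store \<Rightarrow> real vec" where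
  "solution_of d s = vec d (snd s)"

text \<open>A program announces the length of the summary it sends in natural cell 0.\<close>

definition summary_of :: "store \<Rightarrow> real list" where
  "summary_of s = map (snd s) [0..<fst s 0]"

text \<open>Row \<open>i\<close> of the augmented matrix \<open>[A, b]\<close>.\<close>

definition aug_row :: "real mat \<Rightarrow> real vec \<Rightarrow> nat \<Rightarrow> real list" where
  "aug_row A b i = list_of_vec (row A i) @ [b $ i]"


section \<open>The streaming model\<close>

text \<open>
  The update program is run once per row, in order, and only the store survives from one row to
  the next; \<open>T\<close> bounds the time of every update and \<open>S\<close> the storage at all times.
\<close>

inductive stream :: "com \<Rightarrow> nat \<Rightarrow> nat \<Rightarrow> nat \<Rightarrow> nat \<Rightarrow> real list list \<Rightarrow> store \<Rightarrow> store \<Rightarrow> bool"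
  for upd n d T S where
  Nil: "stream upd n d T S [] s s"
| Cons: "exec (Input n d [r]) upd s t m s' \<Longrightarrow> t \<le> T \<Longrightarrow> words (Input n d [r]) m \<le> S \<Longrightarrow>
     stream upd n d T S rs s' s'' \<Longrightarrow> stream upd n d T S (r # rs) s s''"

definition streaming_computes ::
    "com \<Rightarrow> com \<Rightarrow> real mat \<Rightarrow> real vec \<Rightarrow> nat \<Rightarrow> nat \<Rightarrow> nat \<Rightarrow> real vec \<Rightarrow> bool" where
  "streaming_computes upd qry A b Tu S Tq x \<longleftrightarrow>
     (let n = dim_row A; d = dim_col A in
      \<exists>s t m s'. stream upd n d Tu S (map (aug_row A b) [0..<n]) store0 s \<and>
        exec (Input n d []) qry s t m s' \<and> t \<le> Tq \<and> words (Input n d []) m \<le> S \<and>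
        x = solution_of d s')"


section \<open>The distributed summary model\<close>

datatype 'a ctree = Leaf 'a | Node "'a ctree list"

fun leaves :: "'a ctree \<Rightarrow> 'a list" where
  "leaves (Leaf x) = [x]"
| "leaves (Node ts) = concat (map leaves ts)"

definition row_partition :: "nat \<Rightarrow> real \<Rightarrow> nat list list \<Rightarrow> bool" where
  "row_partition n \<beta> Bs \<longleftrightarrow>
     mset (concat Bs) = mset [0..<n] \<and> (\<forall>B\<in>set Bs. B \<noteq> [] \<and> real (length B) \<le> \<beta>)"

text \<open>
  The shape of the tree may depend on \<open>n\<close>, \<open>d\<close> and the number of blocks, but neither on the data
  nor on how the rows are distributed over the blocks.
\<close>

definition tree_plan :: "(nat \<Rightarrow> nat \<Rightarrow> nat \<Rightarrow> nat ctree) \<Rightarrow> bool" where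
  "tree_plan plan \<longleftrightarrow> (\<forall>n d l. 1 \<le> l \<longrightarrow> mset (leaves (plan n d l)) = mset [0..<l])"

text \<open>
  \<open>T\<close> bounds the time and \<open>S\<close> the storage of each single node. The only information that
  an inner node has about the data are the summaries sent by its children.
\<close>

inductive summarises ::
    "com \<Rightarrow> com \<Rightarrow> real mat \<Rightarrow> real vec \<Rightarrow> nat \<Rightarrow> nat \<Rightarrow> nat list ctree \<Rightarrow> real list \<Rightarrow> bool"
  for lf mrg A b T S where
  Leaf: "\<iota> = Input (dim_row A) (dim_col A) (map (aug_row A b) B) \<Longrightarrow>
     exec \<iota> lf store0 t m s \<Longrightarrow> t \<le> T \<Longrightarrow> words \<iota> m \<le> S \<Longrightarrow>
     summarises lf mrg A b T S (Leaf B) (summary_of s)"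
| Node: "list_all2 (summarises lf mrg A b T S) ts ms \<Longrightarrow>
     \<iota> = Input (dim_row A) (dim_col A) ms \<Longrightarrow>
     exec \<iota> mrg store0 t m s \<Longrightarrow> t \<le> T \<Longrightarrow> words \<iota> m \<le> S \<Longrightarrow>
     summarises lf mrg A b T S (Node ts) (summary_of s)"

definition distributed_computes ::
    "(nat \<Rightarrow> nat \<Rightarrow> nat \<Rightarrow> nat ctree) \<Rightarrow> com \<Rightarrow> com \<Rightarrow> com \<Rightarrow> real mat \<Rightarrow> real vec \<Rightarrow>
     nat list list \<Rightarrow> nat \<Rightarrow> nat \<Rightarrow> nat \<Rightarrow> real vec \<Rightarrow> bool" where
  "distributed_computes plan lf mrg qry A b Bs Tu S Tq x \<longleftrightarrow>
     (let n = dim_row A; d = dim_col A in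
      \<exists>w t m s. summarises lf mrg A b Tu S (map_ctree ((!) Bs) (plan n d (length Bs))) w \<and>
        exec (Input n d [w]) qry store0 t m s \<and> t \<le> Tq \<and> words (Input n d [w]) m \<le> S \<and>
        x = solution_of d s)"


section \<open>Resource bounds\<close>

text \<open>
  The \<open>O(1/\<gamma>)\<close> of the claim is \<open>C * max 1 (1/\<gamma>)\<close>: it is \<open>C/\<gamma>\<close> for \<open>\<gamma> \<le> 1\<close>,
  and for larger \<open>\<gamma>\<close> there is still at least one level of summaries.
\<close>

definition levels :: "real \<Rightarrow> real" where
  "levels \<gamma> = max 1 (1 / \<gamma>)"

text \<open>
  An output occupies \<open>d\<close> words, and a summary from which exact solvability of \<open>A x = b\<close> can be
  decided occupies of the order of \<open>d\<^sup>2\<close> words in general. Hence the storage and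
  query time bounds make sense only for \<open>d + 1 \<le> n powr \<gamma>\<close>. The other bounds carry no such proviso.
\<close>

definition resource_bounds ::
    "real \<Rightarrow> real \<Rightarrow> real \<Rightarrow> nat \<Rightarrow> nat \<Rightarrow> nat \<Rightarrow> nat \<Rightarrow> nat \<Rightarrow> bool" where
  "resource_bounds C K \<gamma> n d Tu S Tq \<longleftrightarrow>
     real Tu \<le> K * (real n powr \<gamma> * real (d + 1)) powr C \<and>
     (real (d + 1) \<le> real n powr \<gamma> \<longrightarrow>
        real S \<le> C * levels \<gamma> * real n powr \<gamma> * real (d + 1) \<and>
        real Tq \<le> K * (real n powr \<gamma>) powr C)"

end

theory Submission
  imports Defs
begin

text \<open>
  A block of forms \<open>F\<^sub>1, \<dots>, F\<^sub>m\<close> (a row \<open>r\<close> is the form \<open>x \<mapsto> (r \<bullet> x)\<^sup>2\<close>) is replaced by a single quadratic form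
  \<open>Q\<close> on \<open>\<real>\<^sup>d\<^sup>+\<^sup>1\<close> such that \<open>Q(x) powr (p/2)\<close> and \<open>\<Sum>\<^sub>j F\<^sub>j(x) powr (p/2)\<close> agree up to a factor \<open>poly(d + 1)\<close>,
  whatever \<open>m\<close> is. It suffices to find \<open>Q = \<Sum>\<^sub>j w\<^sub>j powr (1 - 2/p) F\<^sub>j\<close> for one-sided approximations \<open>w\<^sub>j\<close> of the
  \<open>\<ell>\<^sub>p\<close> Lewis weights: \<open>F\<^sub>j \<le> poly(d + 1) w\<^sub>j powr (2/p) Q\<close> and \<open>\<Sum>\<^sub>j w\<^sub>j \<le> poly(d + 1)\<close>. For \<open>p > 2\<close> the average of
  the forms met when leverage scores are iterated does this, because the traces telescope; for
  \<open>p < 2\<close> one starts with \<open>w = 1\<close> and halves weights while they remain overestimates. In both cases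
  the number of rounds depends on \<open>m\<close> only, and not on the conditioning of the data.

  Let \<open>L = \<lceil>2/\<gamma>\<rceil>\<close> and let \<open>B\<close> be about \<open>n powr (\<gamma>/2)\<close>, so that \<open>n < B ^ L\<close>. If \<open>d + 1 \<le> B\<close>, rows are merged in a
  \<open>B\<close>-ary counter with \<open>L\<close> levels, at the price of a factor \<open>poly(d + 1)\<close> per level. If \<open>d + 1 > B\<close>, then
  \<open>n < (d + 1) ^ L\<close>, and the \<open>\<ell>\<^sub>2\<close> form \<open>[A, b]\<^sup>T [A, b]\<close> is already good enough. The minimiser of the final
  form is read off its Gram--Schmidt basis.
\<close>

section \<open>Quadratic forms and Gram--Schmidt orthogonalisation\<close>

text \<open>Forms are merged rather than rows because this problem is closed under iteration: a row
  is a rank-one form, and the result of a merge is again a legal input. The obstacle is that the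
  loss of one merge must not depend on the number \<open>m\<close> of forms: with \<open>L\<close>
  fixed, factors \<open>poly(d + 1)\<close> multiply up to \<open>(d + 1)^O(L)\<close>, whereas a
  power of \<open>m\<close> would bring in \<open>n\<close>. The time bound has to hold for
  arbitrary reals, so the number of rounds must be fixed in advance by \<open>m\<close>; one-sided
  weights are what can be had under this restriction. No rank decision is taken either: degenerate
  directions are absorbed by \<open>x / 0 = 0\<close>.

  \<open>B\<close> is about \<open>n powr (\<gamma>/2)\<close> and not
  \<open>n powr \<gamma>\<close>, because a level has \<open>B\<close> slots of \<open>D * D\<close>
  words: for \<open>D \<le> B\<close> these are at most \<open>B * B * D\<close> words, of the order
  of \<open>n powr \<gamma> * D\<close>. For \<open>B < D\<close> only one form is kept, and its
  \<open>D * D\<close> words are within the storage bound by the proviso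
  \<open>d + 1 \<le> n powr \<gamma>\<close>. The query merges all slots once more, which is the
  \<open>+ 1\<close> in \<open>L + 1\<close> below. Minimising \<open>Q(x) powr (p/2)\<close> is
  least squares for \<open>Q\<close>, so no convex optimisation is needed.\<close>

type_synonym form = "nat \<Rightarrow> nat \<Rightarrow> real"
type_synonym mats = "nat \<Rightarrow> nat \<Rightarrow> nat \<Rightarrow> real"

text \<open>Vectors and forms are total functions of which only the entries below \<open>D\<close>
  count, so that a matrix in the memory of a program is a form as it stands.\<close>

definition bf :: "nat \<Rightarrow> form \<Rightarrow> (nat \<Rightarrow> real) \<Rightarrow> (nat \<Rightarrow> real) \<Rightarrow> real" where
  "bf D F x y = (\<Sum>a<D. \<Sum>b<D. x a * F a b * y b)"

definition qf :: "nat \<Rightarrow> form \<Rightarrow> (nat \<Rightarrow> real) \<Rightarrow> real" where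
  "qf D F x = bf D F x x"

definition psd :: "nat \<Rightarrow> form \<Rightarrow> bool" where
  "psd D F \<longleftrightarrow> (\<forall>a<D. \<forall>b<D. F a b = F b a) \<and> (\<forall>x. 0 \<le> qf D F x)"

lemma psd_nonneg: "psd D F \<Longrightarrow> 0 \<le> qf D F x"
  by (simp add: psd_def)

lemma bf_add_left: "bf D F (\<lambda>a. x a + y a) z = bf D F x z + bf D F y z"
  by (simp add: bf_def algebra_simps sum.distrib)

lemma bf_add_right: "bf D F z (\<lambda>a. x a + y a) = bf D F z x + bf D F z y"
  by (simp add: bf_def algebra_simps sum.distrib)

lemma bf_scale_left: "bf D F (\<lambda>a. c * x a) z = c * bf D F x z"
  by (simp add: bf_def algebra_simps sum_distrib_left)

lemma bf_scale_right: "bf D F z (\<lambda>a. c * x a) = c * bf D F z x"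
  by (simp add: bf_def algebra_simps sum_distrib_left)

lemma bf_sum_left: "finite K \<Longrightarrow> bf D F (\<lambda>a. \<Sum>k\<in>K. c k * x k a) z = (\<Sum>k\<in>K. c k * bf D F (x k) z)"
proof (induction K rule: finite_induct)
  case empty
  then show ?case by (simp add: bf_def)
next
  case (insert k K)
  then show ?case by (simp add: bf_add_left bf_scale_left)
qed

lemma bf_sum_right: "finite K \<Longrightarrow> bf D F z (\<lambda>a. \<Sum>k\<in>K. c k * x k a) = (\<Sum>k\<in>K. c k * bf D F z (x k))"
proof (induction K rule: finite_induct)
  case empty
  then show ?case by (simp add: bf_def)
next
  case (insert k K)
  then show ?case by (simp add: bf_add_right bf_scale_right)
qed

lemma bf_cong: "(\<And>a. a < D \<Longrightarrow> x a = x' a) \<Longrightarrow> (\<And>a. a < D \<Longrightarrow> y a = y' a) \<Longrightarrow>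
    (\<And>a b. a < D \<Longrightarrow> b < D \<Longrightarrow> F a b = F' a b) \<Longrightarrow> bf D F x y = bf D F' x' y'"
  unfolding bf_def by (intro sum.cong) auto

lemma qf_cong: "(\<And>a. a < D \<Longrightarrow> x a = x' a) \<Longrightarrow>
    (\<And>a b. a < D \<Longrightarrow> b < D \<Longrightarrow> F a b = F' a b) \<Longrightarrow> qf D F x = qf D F' x'"
  unfolding qf_def by (intro bf_cong) auto

lemma psd_cong: "(\<And>a b. a < D \<Longrightarrow> b < D \<Longrightarrow> F a b = F' a b) \<Longrightarrow> psd D F = psd D F'"
  unfolding psd_def using qf_cong[of D _ _ F F'] by simp

lemma bf_sym: "psd D F \<Longrightarrow> bf D F x y = bf D F y x"
  unfolding bf_def psd_def
  by (subst sum.swap) (auto intro!: sum.cong)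

lemma qf_sum_forms: "qf D (\<lambda>a b. \<Sum>j\<in>J. v j * F j a b) x = (\<Sum>j\<in>J. v j * qf D (F j) x)"
proof -
  have "qf D (\<lambda>a b. \<Sum>j\<in>J. v j * F j a b) x = (\<Sum>a<D. \<Sum>b<D. \<Sum>j\<in>J. v j * (x a * F j a b * x b))"
    by (simp add: qf_def bf_def sum_distrib_left sum_distrib_right mult_ac)
  also have "\<dots> = (\<Sum>a<D. \<Sum>j\<in>J. \<Sum>b<D. v j * (x a * F j a b * x b))"
    by (intro sum.cong refl sum.swap)
  also have "\<dots> = (\<Sum>j\<in>J. \<Sum>a<D. \<Sum>b<D. v j * (x a * F j a b * x b))"
    by (rule sum.swap)
  finally show ?thesis by (simp add: qf_def bf_def sum_distrib_left)
qed

lemma qf_add_form: "qf D (\<lambda>a b. F a b + F' a b) x = qf D F x + qf D F' x"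
  by (simp add: qf_def bf_def algebra_simps sum.distrib)

lemma qf_zero_form: "(\<And>a b. a < D \<Longrightarrow> b < D \<Longrightarrow> F a b = 0) \<Longrightarrow> qf D F x = 0"
  by (simp add: qf_def bf_def)

lemma psd_sum_forms:
  assumes "\<And>j. j \<in> J \<Longrightarrow> psd D (F j)" "\<And>j. j \<in> J \<Longrightarrow> 0 \<le> v j"
  shows "psd D (\<lambda>a b. \<Sum>j\<in>J. v j * F j a b)"
  using assms unfolding psd_def qf_sum_forms by (auto intro!: sum_nonneg sum.cong mult_nonneg_nonneg)

lemma psd_add_form: "psd D F \<Longrightarrow> psd D F' \<Longrightarrow> psd D (\<lambda>a b. F a b + F' a b)"
  by (simp add: psd_def qf_add_form)

lemma psd_zero_form: "(\<And>a b. a < D \<Longrightarrow> b < D \<Longrightarrow> F a b = 0) \<Longrightarrow> psd D F"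
  by (simp add: psd_def qf_zero_form)

lemma qf_rank1: "qf D (\<lambda>a b. r a * r b) x = (\<Sum>a<D. r a * x a)\<^sup>2"
  by (simp add: qf_def bf_def power2_eq_square sum_product mult_ac)

lemma psd_rank1: "psd D (\<lambda>a b. r a * r b)"
  by (simp add: psd_def qf_rank1 mult.commute)

text \<open>The usual discriminant argument for the nonnegative quadratic
  \<open>t \<mapsto> qf D F (x + t y)\<close>; the form may be degenerate, so the case of a
  vanishing leading coefficient has to be treated.\<close>

lemma psd_cauchy_schwarz:
  assumes "psd D F"
  shows "(bf D F x y)\<^sup>2 \<le> qf D F x * qf D F y"
proof -
  define p q r where "p = qf D F x" and "q = bf D F x y" and "r = qf D F y"
  have *: "0 \<le> p + 2 * t * q + t\<^sup>2 * r" for t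
  proof -
    have "0 \<le> qf D F (\<lambda>a. x a + t * y a)" using assms by (rule psd_nonneg)
    also have "\<dots> = p + 2 * t * q + t\<^sup>2 * r"
      unfolding p_def q_def r_def qf_def bf_add_left bf_add_right bf_scale_left bf_scale_right
      using bf_sym[OF assms, of y x] by (simp add: algebra_simps power2_eq_square)
    finally show ?thesis .
  qed
  have "0 \<le> p" "0 \<le> r" using assms by (simp_all add: p_def r_def psd_nonneg)
  show ?thesis
  proof (cases "r = 0")
    case True
    have "q = 0"
    proof (rule ccontr)
      assume "q \<noteq> 0"
      \<comment> \<open>With \<open>r = 0\<close> the quadratic is affine in \<open>t\<close> and
        takes the value \<open>-1\<close> here.\<close>
      with *[of "- (p + 1) / (2 * q)"] True show False by (simp add: field_simps)
    qed
    then show ?thesis using True by (simp add: p_def q_def r_def)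
  next
    case False
    with \<open>0 \<le> r\<close> have "r > 0" by simp
    with *[of "- q / r"] have "0 \<le> p - q\<^sup>2 / r" by (simp add: power2_eq_square field_simps)
    with \<open>r > 0\<close> show ?thesis by (simp add: p_def q_def r_def field_simps)
  qed
qed

lemma Cauchy_Schwarz_sum_real:
  fixes f g :: "'a \<Rightarrow> real"
  assumes "finite K"
  shows "(\<Sum>k\<in>K. f k * g k)\<^sup>2 \<le> (\<Sum>k\<in>K. (f k)\<^sup>2) * (\<Sum>k\<in>K. (g k)\<^sup>2)"
proof -
  have "2 * (\<Sum>k\<in>K. f k * g k)\<^sup>2 = (\<Sum>i\<in>K. \<Sum>j\<in>K. 2 * ((f i * g j) * (f j * g i)))"
    by (simp add: power2_eq_square sum_product sum_distrib_left mult_ac)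
  also have "\<dots> \<le> (\<Sum>i\<in>K. \<Sum>j\<in>K. (f i * g j)\<^sup>2 + (f j * g i)\<^sup>2)"
  proof (intro sum_mono)
    fix i j
    show "2 * ((f i * g j) * (f j * g i)) \<le> (f i * g j)\<^sup>2 + (f j * g i)\<^sup>2"
      using sum_squares_bound[of "f i * g j" "f j * g i"] by (simp add: mult.assoc)
  qed
  also have "\<dots> = (\<Sum>i\<in>K. \<Sum>j\<in>K. (f i)\<^sup>2 * (g j)\<^sup>2) + (\<Sum>i\<in>K. \<Sum>j\<in>K. (g i)\<^sup>2 * (f j)\<^sup>2)"
    by (simp add: sum.distrib power_mult_distrib mult_ac)
  also have "\<dots> = 2 * ((\<Sum>k\<in>K. (f k)\<^sup>2) * (\<Sum>k\<in>K. (g k)\<^sup>2))"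
    by (simp only: sum_product[symmetric]) (simp add: mult.commute)
  finally show ?thesis by simp
qed

text \<open>Triangle inequality for the seminorm \<open>sqrt (qf D F x)\<close>, squared;
  Cauchy-Schwarz bounds the cross terms.\<close>

lemma qf_sum_le:
  assumes "psd D F" "finite K"
  shows "qf D F (\<lambda>a. \<Sum>k\<in>K. c k * g k a) \<le> (\<Sum>k\<in>K. \<bar>c k\<bar> * sqrt (qf D F (g k)))\<^sup>2"
proof -
  have "qf D F (\<lambda>a. \<Sum>k\<in>K. c k * g k a) = (\<Sum>k\<in>K. \<Sum>l\<in>K. c k * (c l * bf D F (g k) (g l)))"
    by (simp add: qf_def bf_sum_left bf_sum_right assms sum_distrib_left)
  also have "\<dots> \<le> (\<Sum>k\<in>K. \<Sum>l\<in>K. (\<bar>c k\<bar> * sqrt (qf D F (g k))) * (\<bar>c l\<bar> * sqrt (qf D F (g l))))"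
  proof (intro sum_mono)
    fix k l
    have "\<bar>bf D F (g k) (g l)\<bar> \<le> sqrt (qf D F (g k)) * sqrt (qf D F (g l))"
      using real_sqrt_le_mono[OF psd_cauchy_schwarz[OF assms(1), of "g k" "g l"]]
      by (simp add: real_sqrt_mult)
    then have "\<bar>c k * (c l * bf D F (g k) (g l))\<bar>
        \<le> \<bar>c k\<bar> * (\<bar>c l\<bar> * (sqrt (qf D F (g k)) * sqrt (qf D F (g l))))"
      unfolding abs_mult by (intro mult_left_mono) auto
    then show "c k * (c l * bf D F (g k) (g l))
        \<le> (\<bar>c k\<bar> * sqrt (qf D F (g k))) * (\<bar>c l\<bar> * sqrt (qf D F (g l)))"
      by (simp add: mult_ac)
  qed
  also have "\<dots> = (\<Sum>k\<in>K. \<bar>c k\<bar> * sqrt (qf D F (g k)))\<^sup>2"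
    by (simp add: power2_eq_square sum_product)
  finally show ?thesis .
qed

text \<open>Row \<open>k\<close> of \<open>gsG\<close> is the \<open>k\<close>-th unit vector, orthogonalised against its predecessors with
  respect to the form \<open>Q\<close>. Nothing is subtracted along directions on which \<open>Q\<close> vanishes, since the
  quotient is then \<open>x / 0 = 0\<close>.\<close>

fun gsG :: "nat \<Rightarrow> form \<Rightarrow> nat \<Rightarrow> nat \<Rightarrow> real" where
  "gsG D Q k a = (if a = k then 1 else 0)
     - (\<Sum>j<k. (\<Sum>b<D. Q k b * gsG D Q j b) / (\<Sum>b<D. Q j b * gsG D Q j b) * gsG D Q j a)"

text \<open>The vector \<open>Q g\<close> for the basis vector \<open>g = gsG D Q j\<close>: its
  entry \<open>a\<close> is the inner product of \<open>g\<close> with the unit vector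
  \<open>a\<close>. The diagonal entry is also the squared length of \<open>g\<close> (see
  \<open>gs_orth\<close>), hence its role as the divisor in the projections.\<close>

definition gsH :: "nat \<Rightarrow> form \<Rightarrow> nat \<Rightarrow> nat \<Rightarrow> real" where
  "gsH D Q j a = (\<Sum>b<D. Q a b * gsG D Q j b)"

declare gsG.simps [simp del]

lemma gsG_eq: "gsG D Q k a = (if a = k then 1 else 0) - (\<Sum>j<k. gsH D Q j k / gsH D Q j j * gsG D Q j a)"
  by (subst gsG.simps) (simp add: gsH_def)

lemma gsG_upper: "k < a \<Longrightarrow> gsG D Q k a = 0"
  by (induction k rule: less_induct) (subst gsG_eq, simp)

lemma gsG_diag: "gsG D Q k k = 1"
  by (subst gsG_eq) (simp add: gsG_upper)

lemma bf_gsG: "bf D Q x (gsG D Q j) = (\<Sum>a<D. x a * gsH D Q j a)"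
  by (simp add: bf_def gsH_def sum_distrib_left mult_ac)

lemma bf_unit: "k < D \<Longrightarrow> bf D Q (\<lambda>a. if a = k then 1 else 0) (gsG D Q j) = gsH D Q j k"
proof -
  assume "k < D"
  have "(\<Sum>a<D. (if a = k then 1 else 0) * gsH D Q j a) = (\<Sum>a<D. if a = k then gsH D Q j a else 0)"
    by (intro sum.cong) auto
  then show ?thesis using \<open>k < D\<close> by (simp add: bf_gsG sum.delta)
qed

lemma gsG_fun: "gsG D Q k = (\<lambda>a. (if a = k then 1 else 0)
    + (\<Sum>j<k. (- (gsH D Q j k / gsH D Q j j)) * gsG D Q j a))"
  by (rule ext, subst gsG_eq) (simp add: sum_negf)

lemma bf_gsG_left: "k < D \<Longrightarrow>
   bf D Q (gsG D Q k) (gsG D Q i) = gsH D Q i k - (\<Sum>j<k. gsH D Q j k / gsH D Q j j * bf D Q (gsG D Q j) (gsG D Q i))"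
  apply (subst gsG_fun[of D Q k])
  apply (subst bf_add_left, subst bf_sum_left, simp)
  apply (simp add: bf_unit sum_negf)
  done

text \<open>Both claims are needed in one induction: the inner product with row \<open>i\<close>
  cancels only because the divisor \<open>gsH D Q i i\<close> is the squared length of row
  \<open>i\<close>.\<close>

lemma gs_orth:
  assumes "psd D Q" "k < D"
  shows "(\<forall>i<k. bf D Q (gsG D Q k) (gsG D Q i) = 0) \<and> qf D Q (gsG D Q k) = gsH D Q k k"
  using assms(2)
proof (induction k rule: less_induct)
  case (less k)
  have 1: "bf D Q (gsG D Q k) (gsG D Q i) = 0" if "i < k" for i
  proof -
    have o: "bf D Q (gsG D Q j) (gsG D Q i) = (if j = i then gsH D Q i i else 0)" if "j < k" for j
    proof (cases j i rule: linorder_cases)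
      case less
      then show ?thesis using less.IH[of i] \<open>i < k\<close> less.prems bf_sym[OF assms(1), of "gsG D Q i" "gsG D Q j"] by auto
    next
      case equal
      then show ?thesis using less.IH[of i] \<open>i < k\<close> less.prems by (simp add: qf_def)
    next
      case greater
      then show ?thesis using less.IH[of j] \<open>j < k\<close> less.prems by auto
    qed
    have "bf D Q (gsG D Q k) (gsG D Q i) = gsH D Q i k
        - (\<Sum>j<k. gsH D Q j k / gsH D Q j j * (if j = i then gsH D Q i i else 0))"
      unfolding bf_gsG_left[OF less.prems] using o by simp
    also have "(\<Sum>j<k. gsH D Q j k / gsH D Q j j * (if j = i then gsH D Q i i else 0))
        = (\<Sum>j<k. if j = i then gsH D Q j k / gsH D Q j j * gsH D Q i i else 0)"
      by (intro sum.cong) auto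
    also have "\<dots> = gsH D Q i k / gsH D Q i i * gsH D Q i i"
      using \<open>i < k\<close> by simp
    finally have e: "bf D Q (gsG D Q k) (gsG D Q i) = gsH D Q i k - gsH D Q i k / gsH D Q i i * gsH D Q i i" .
    show ?thesis
    proof (cases "gsH D Q i i = 0")
      case True
      \<comment> \<open>The quotient is \<open>0\<close> here and nothing was subtracted; but row
        \<open>i\<close> is a null vector, so by Cauchy-Schwarz everything is orthogonal to it
        already.\<close>
      then have "qf D Q (gsG D Q i) = 0" using less.IH[of i] \<open>i < k\<close> less.prems by simp
      then have "bf D Q (\<lambda>a. if a = k then 1 else 0) (gsG D Q i) = 0"
        using psd_cauchy_schwarz[OF assms(1), of "\<lambda>a. if a = k then 1 else 0" "gsG D Q i"] by simp
      then show ?thesis using e True bf_unit[OF less.prems] by simp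
    next
      case False
      then show ?thesis using e by simp
    qed
  qed
  have "qf D Q (gsG D Q k) = gsH D Q k k"
    unfolding qf_def bf_gsG_left[OF less.prems]
    using 1 bf_sym[OF assms(1)] by (simp add: sum.neutral)
  with 1 show ?case by simp
qed

lemma gs_orth_gen:
  assumes "psd D Q" "k < D" "i < D" "i \<noteq> k"
  shows "bf D Q (gsG D Q k) (gsG D Q i) = 0"
  using gs_orth[OF assms(1), of k] gs_orth[OF assms(1), of i] assms
    bf_sym[OF assms(1), of "gsG D Q k" "gsG D Q i"]
  by (cases i k rule: linorder_cases) auto

text \<open>The rows of \<open>gsG\<close> are unit lower triangular: the coefficient of row
  \<open>n\<close> is coordinate \<open>n\<close> of \<open>x\<close>, and the remainder has one
  coordinate less.\<close>

lemma gs_decompose: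
  "\<exists>c. (\<forall>a\<le>n. x a = (\<Sum>k\<le>n. c k * gsG D Q k a)) \<and> c n = x n"
proof (induction n arbitrary: x)
  case 0
  have "x 0 = (\<Sum>k\<le>0. x 0 * gsG D Q k 0)" by (simp add: gsG_diag)
  then show ?case by (intro exI[of _ "\<lambda>_. x 0"]) simp
next
  case (Suc n)
  obtain c where c: "\<forall>a\<le>n. x a - x (Suc n) * gsG D Q (Suc n) a = (\<Sum>k\<le>n. c k * gsG D Q k a)"
    using Suc[of "\<lambda>a. x a - x (Suc n) * gsG D Q (Suc n) a"] by blast
  let ?c = "c(Suc n := x (Suc n))"
  have "x a = (\<Sum>k\<le>Suc n. ?c k * gsG D Q k a)" if "a \<le> Suc n" for a
  proof (cases "a = Suc n")
    case True
    then show ?thesis by (simp add: gsG_diag gsG_upper)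
  next
    case False
    with that have "a \<le> n" by simp
    with c have "x a - x (Suc n) * gsG D Q (Suc n) a = (\<Sum>k\<le>n. c k * gsG D Q k a)" by blast
    moreover have "(\<Sum>k\<le>n. ?c k * gsG D Q k a) = (\<Sum>k\<le>n. c k * gsG D Q k a)"
      by (intro sum.cong) auto
    ultimately show ?thesis by simp
  qed
  then have "\<forall>a\<le>Suc n. x a = (\<Sum>k\<le>Suc n. ?c k * gsG D Q k a)" by blast
  moreover have "?c (Suc n) = x (Suc n)" by simp
  ultimately show ?case by blast
qed

lemma gs_basis:
  assumes "0 < D"
  obtains c where "\<And>a. a < D \<Longrightarrow> x a = (\<Sum>k<D. c k * gsG D Q k a)" "c (D - 1) = x (D - 1)"
proof -
  obtain c where c: "\<forall>a\<le>D-1. x a = (\<Sum>k\<le>D-1. c k * gsG D Q k a)" "c (D - 1) = x (D - 1)"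
    using gs_decompose[of "D - 1" x D Q] by blast
  have e: "{..D-1} = {..<D}" using assms by auto
  show thesis
  proof (rule that)
    fix a assume "a < D"
    then have "a \<le> D - 1" by simp
    with c(1) show "x a = (\<Sum>k<D. c k * gsG D Q k a)" unfolding e by blast
  qed (rule c(2))
qed

lemma qf_gs_combination:
  assumes "psd D Q"
  shows "qf D Q (\<lambda>a. \<Sum>k<D. c k * gsG D Q k a) = (\<Sum>k<D. (c k)\<^sup>2 * gsH D Q k k)"
proof -
  have "qf D Q (\<lambda>a. \<Sum>k<D. c k * gsG D Q k a)
      = (\<Sum>k<D. \<Sum>l<D. c k * (c l * bf D Q (gsG D Q k) (gsG D Q l)))"
    by (simp add: qf_def bf_sum_left bf_sum_right sum_distrib_left)
  also have "\<dots> = (\<Sum>k<D. \<Sum>l<D. if l = k then (c k)\<^sup>2 * gsH D Q k k else 0)"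
    using gs_orth_gen[OF assms] gs_orth[OF assms]
    by (intro sum.cong) (auto simp: qf_def power2_eq_square)
  finally show ?thesis by simp
qed

text \<open>In the orthogonal basis \<open>Q\<close> is a weighted sum of squares of the
  coefficients, and the last coefficient is forced to be \<open>1\<close>; dropping the others gives
  the minimum. This is the least squares solution, the last coordinate belonging to
  \<open>b\<close>.\<close>

lemma gs_minimal:
  assumes "psd D Q" "0 < D" "x (D - 1) = 1"
  shows "qf D Q (gsG D Q (D - 1)) \<le> qf D Q x"
proof -
  obtain c where c: "\<And>a. a < D \<Longrightarrow> x a = (\<Sum>k<D. c k * gsG D Q k a)" "c (D - 1) = x (D - 1)"
    using gs_basis[OF assms(2)] by blast
  have h: "0 \<le> gsH D Q k k" if "k < D" for k
    using gs_orth[OF assms(1) that] psd_nonneg[OF assms(1)] by metis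
  have "qf D Q (gsG D Q (D - 1)) = (c (D - 1))\<^sup>2 * gsH D Q (D - 1) (D - 1)"
    using gs_orth[OF assms(1), of "D - 1"] assms c(2) by simp
  also have "\<dots> \<le> (\<Sum>k<D. (c k)\<^sup>2 * gsH D Q k k)"
    using assms h by (intro member_le_sum) auto
  also have "\<dots> = qf D Q x"
    unfolding qf_gs_combination[OF assms(1), symmetric] using c by (intro qf_cong) auto
  finally show ?thesis .
qed

text \<open>The trace of \<open>F\<close> relative to \<open>Q\<close>, that is
  \<open>tr(Q^+ F)\<close> if \<open>F\<close> vanishes wherever \<open>Q\<close> does; null
  directions of \<open>Q\<close> contribute \<open>0\<close> by division by zero. For a rank-one
  \<open>F\<close> this is the leverage score of the row.\<close>

definition tau :: "nat \<Rightarrow> form \<Rightarrow> form \<Rightarrow> real" where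
  "tau D Q F = (\<Sum>k<D. qf D F (gsG D Q k) / gsH D Q k k)"

lemma tau_nonneg:
  assumes "psd D Q" "psd D F"
  shows "0 \<le> tau D Q F"
  unfolding tau_def
proof (intro sum_nonneg divide_nonneg_nonneg)
  fix k assume "k \<in> {..<D}"
  then show "0 \<le> gsH D Q k k" using gs_orth[OF assms(1), of k] psd_nonneg[OF assms(1)] by (metis lessThan_iff)
qed (rule psd_nonneg[OF assms(2)])

text \<open>The relative trace dominates the largest relative eigenvalue: expand \<open>x\<close> in
  the basis, apply the triangle inequality for \<open>F\<close>, then Cauchy-Schwarz over
  \<open>k\<close> after splitting each term by \<open>sqrt (gsH D Q k k)\<close>. The assumption
  \<open>null\<close> lets the split go through where this root is \<open>0\<close>.\<close>

lemma tau_bound: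
  assumes Q: "psd D Q" and F: "psd D F" and D: "0 < D" and null: "\<And>x. qf D Q x = 0 \<Longrightarrow> qf D F x = 0"
  shows "qf D F x \<le> tau D Q F * qf D Q x"
proof -
  obtain c where c: "\<And>a. a < D \<Longrightarrow> x a = (\<Sum>k<D. c k * gsG D Q k a)"
    using gs_basis[OF D] by blast
  have h: "0 \<le> gsH D Q k k" "qf D Q (gsG D Q k) = gsH D Q k k" if "k < D" for k
    using gs_orth[OF Q that] psd_nonneg[OF Q] by metis+
  have "qf D F x = qf D F (\<lambda>a. \<Sum>k<D. c k * gsG D Q k a)"
    using c by (intro qf_cong) auto
  also have "\<dots> \<le> (\<Sum>k<D. \<bar>c k\<bar> * sqrt (qf D F (gsG D Q k)))\<^sup>2"
    using F by (rule qf_sum_le) simp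
  also have "(\<Sum>k<D. \<bar>c k\<bar> * sqrt (qf D F (gsG D Q k)))
      = (\<Sum>k<D. (\<bar>c k\<bar> * sqrt (gsH D Q k k)) * sqrt (qf D F (gsG D Q k) / gsH D Q k k))"
  proof (intro sum.cong refl)
    fix k assume "k \<in> {..<D}"
    then have k: "k < D" by simp
    show "\<bar>c k\<bar> * sqrt (qf D F (gsG D Q k))
        = (\<bar>c k\<bar> * sqrt (gsH D Q k k)) * sqrt (qf D F (gsG D Q k) / gsH D Q k k)"
      using h[OF k] null[of "gsG D Q k"] by (cases "gsH D Q k k = 0") (auto simp: real_sqrt_divide)
  qed
  also have "(\<Sum>k<D. (\<bar>c k\<bar> * sqrt (gsH D Q k k)) * sqrt (qf D F (gsG D Q k) / gsH D Q k k))\<^sup>2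
      \<le> (\<Sum>k<D. (\<bar>c k\<bar> * sqrt (gsH D Q k k))\<^sup>2) * (\<Sum>k<D. (sqrt (qf D F (gsG D Q k) / gsH D Q k k))\<^sup>2)"
    by (rule Cauchy_Schwarz_sum_real) simp
  also have "(\<Sum>k<D. (\<bar>c k\<bar> * sqrt (gsH D Q k k))\<^sup>2) = (\<Sum>k<D. (c k)\<^sup>2 * gsH D Q k k)"
    using h by (intro sum.cong) (auto simp: power_mult_distrib)
  also have "(\<Sum>k<D. (sqrt (qf D F (gsG D Q k) / gsH D Q k k))\<^sup>2) = tau D Q F"
    unfolding tau_def using h psd_nonneg[OF F] by (intro sum.cong) auto
  also have "(\<Sum>k<D. (c k)\<^sup>2 * gsH D Q k k) = qf D Q x"
    unfolding qf_gs_combination[OF Q, symmetric] using c by (intro qf_cong) auto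
  finally show ?thesis by (simp add: mult.commute)
qed

text \<open>After exchanging the sums, each basis vector contributes \<open>Q(g) / Q(g)\<close>,
  which is \<open>1\<close>, or \<open>0\<close> on a null direction: the scores sum to at most the
  rank.\<close>

lemma sum_tau_le:
  assumes "psd D Q" "\<And>x. qf D Q x = (\<Sum>j\<in>J. v j * qf D (F j) x)"
  shows "(\<Sum>j\<in>J. v j * tau D Q (F j)) \<le> real D"
proof -
  have "(\<Sum>j\<in>J. v j * tau D Q (F j)) = (\<Sum>j\<in>J. \<Sum>k<D. v j * qf D (F j) (gsG D Q k) / gsH D Q k k)"
    by (simp add: tau_def sum_distrib_left)
  also have "\<dots> = (\<Sum>k<D. \<Sum>j\<in>J. v j * qf D (F j) (gsG D Q k) / gsH D Q k k)"
    by (rule sum.swap)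
  also have "\<dots> = (\<Sum>k<D. qf D Q (gsG D Q k) / gsH D Q k k)"
    by (simp add: assms(2) sum_divide_distrib)
  also have "\<dots> \<le> (\<Sum>k<D. 1)"
    using gs_orth[OF assms(1)] by (intro sum_mono) simp
  finally show ?thesis by simp
qed

section \<open>Merging quadratic forms\<close>

text \<open>The inequality of geometric and arithmetic mean; \<open>exp\<close> is bounded below by
  its tangent at the mean \<open>c\<close>.\<close>

lemma exp_mean_le:
  fixes y :: "nat \<Rightarrow> real"
  assumes "0 < T"
  shows "exp ((\<Sum>k<T. y k) / real T) \<le> (\<Sum>k<T. exp (y k)) / real T"
proof -
  define c where "c = (\<Sum>k<T. y k) / real T"
  have "(\<Sum>k<T. exp c * (1 + (y k - c))) \<le> (\<Sum>k<T. exp (y k))"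
  proof (intro sum_mono)
    fix k
    have "exp c * (1 + (y k - c)) \<le> exp c * exp (y k - c)"
      by (intro mult_left_mono exp_ge_add_one_self) simp
    then show "exp c * (1 + (y k - c)) \<le> exp (y k)" by (simp add: exp_add[symmetric])
  qed
  moreover have "(\<Sum>k<T. exp c * (1 + (y k - c))) = exp c * real T"
    using assms by (simp add: sum_distrib_left[symmetric] sum.distrib sum_subtractf c_def)
  ultimately show ?thesis using assms by (simp add: c_def[symmetric] field_simps)
qed

text \<open>A crude weighted mean inequality, used in place of Hoelder's inequality: both bases are
  replaced by their maximum.\<close>

lemma powr_mix_le:
  fixes u w s t :: real
  assumes "0 \<le> u" "0 \<le> w" "0 \<le> s" "0 \<le> t" "s + t = 1"
  shows "w powr s * u powr t \<le> w + u"
proof -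
  let ?M = "max w u"
  have "w powr s * u powr t \<le> ?M powr s * ?M powr t"
    using assms by (intro mult_mono powr_mono2) auto
  also have "\<dots> = ?M powr 1" using assms(5) by (metis powr_add)
  also have "\<dots> \<le> w + u" using assms by auto
  finally show ?thesis .
qed

text \<open>The form attached to weights \<open>w\<close>. The \<open>\<ell>_p\<close> Lewis weights
  are the solution of \<open>w j powr (2 / p) = tau D (wform p m F w) (F j)\<close>.\<close>

definition wform :: "real \<Rightarrow> nat \<Rightarrow> mats \<Rightarrow> (nat \<Rightarrow> real) \<Rightarrow> nat \<Rightarrow> nat \<Rightarrow> real" where
  "wform p m F w = (\<lambda>a b. \<Sum>j<m. w j powr (1 - 2 / p) * F j a b)"

text \<open>For \<open>p > 2\<close> the new weights are the leverage scores of the old ones. For \<open>p < 2\<close> a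
  weight is halved as long as it remains an overestimate of the corresponding Lewis weight.\<close>

definition wstep :: "real \<Rightarrow> nat \<Rightarrow> real \<Rightarrow> real \<Rightarrow> real" where
  "wstep p m w t = (if 2 < p then w powr (1 - 2 / p) * t
     else if t < (w / 2) powr (2 / p) \<and> 2 / real m < w then w / 2 else w)"

fun wseq :: "real \<Rightarrow> nat \<Rightarrow> nat \<Rightarrow> mats \<Rightarrow> nat \<Rightarrow> nat \<Rightarrow> real" where
  "wseq p D m F 0 = (\<lambda>j. 1)"
| "wseq p D m F (Suc k) = (\<lambda>j. wstep p m (wseq p D m F k j) (tau D (wform p m F (wseq p D m F k)) (F j)))"

declare wseq.simps(2) [simp del]

text \<open>The number \<open>2 * m * m\<close> of rounds serves both cases. For
  \<open>p < 2\<close>, a stable round occurs within the first half, so the second half is good. For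
  \<open>p > 2\<close>, there are enough rounds for the initial total weight \<open>m\<close> to add
  at most \<open>1\<close> to the average.\<close>

definition wavg :: "real \<Rightarrow> nat \<Rightarrow> nat \<Rightarrow> mats \<Rightarrow> nat \<Rightarrow> nat \<Rightarrow> real" where
  "wavg p D m F = (\<lambda>a b. (\<Sum>k<2*m*m. wform p m F (wseq p D m F k) a b) / real (2*m*m))"

locale merging =
  fixes p :: real and D m :: nat and F :: "nat \<Rightarrow> nat \<Rightarrow> nat \<Rightarrow> real"
  assumes p1: "1 \<le> p" and D0: "0 < D" and m0: "0 < m" and psdF: "\<And>j. j < m \<Longrightarrow> psd D (F j)"
begin

abbreviation w :: "nat \<Rightarrow> nat \<Rightarrow> real" where "w \<equiv> wseq p D m F"
abbreviation Q :: "nat \<Rightarrow> nat \<Rightarrow> nat \<Rightarrow> real" where "Q k \<equiv> wform p m F (w k)"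
abbreviation f :: "(nat \<Rightarrow> real) \<Rightarrow> nat \<Rightarrow> real" where "f x j \<equiv> qf D (F j) x"
abbreviation T :: nat where "T \<equiv> 2 * m * m"
abbreviation q :: "(nat \<Rightarrow> real) \<Rightarrow> real" where "q \<equiv> qf D (wavg p D m F)"
abbreviation \<phi> :: "(nat \<Rightarrow> real) \<Rightarrow> real" where "\<phi> x \<equiv> \<Sum>j<m. f x j powr (p / 2)"

lemma T0: "0 < T" using m0 by simp

lemma T1: "1 \<le> real T" using T0 by (metis One_nat_def Suc_leI of_nat_1 of_nat_le_iff)

lemma f0: "j < m \<Longrightarrow> 0 \<le> f x j" using psdF by (rule psd_nonneg)

lemma qfQ: "qf D (Q k) x = (\<Sum>j<m. w k j powr (1 - 2 / p) * f x j)"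
  by (simp add: wform_def qf_sum_forms)

lemma psdQ: "psd D (Q k)"
  unfolding wform_def using psdF by (intro psd_sum_forms) auto

lemma Q0: "0 \<le> qf D (Q k) x" using psdQ by (rule psd_nonneg)

lemma q_eq: "q x = (\<Sum>k<T. qf D (Q k) x) / real T"
proof -
  have "wavg p D m F = (\<lambda>a b. \<Sum>k<T. (1 / real T) * Q k a b)"
    by (intro ext) (simp add: wavg_def sum_divide_distrib)
  then have "q x = (\<Sum>k<T. (1 / real T) * qf D (Q k) x)" by (simp only: qf_sum_forms)
  then show ?thesis by (simp add: sum_divide_distrib)
qed

lemma psd_wavg: "psd D (wavg p D m F)"
proof -
  have "wavg p D m F = (\<lambda>a b. \<Sum>k<T. (1 / real T) * Q k a b)"
    by (intro ext) (simp add: wavg_def sum_divide_distrib)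
  moreover have "psd D (\<lambda>a b. \<Sum>k<T. (1 / real T) * Q k a b)"
    using psdQ by (intro psd_sum_forms) auto
  ultimately show ?thesis by simp
qed

lemma q0: "0 \<le> q x" using psd_wavg by (rule psd_nonneg)

text \<open>A positive weight guarantees that \<open>F j\<close> vanishes wherever
  \<open>Q k\<close> does, which is the assumption \<open>null\<close> of
  \<open>tau_bound\<close>.\<close>

lemma f_le_tau:
  assumes "j < m" "0 < w k j"
  shows "f x j \<le> tau D (Q k) (F j) * qf D (Q k) x"
proof (rule tau_bound[OF psdQ psdF[OF assms(1)] D0])
  fix y assume "qf D (Q k) y = 0"
  then have "w k j powr (1 - 2 / p) * f y j = 0"
    unfolding qfQ using f0 assms(1) by (subst (asm) sum_nonneg_eq_0_iff) auto
  with assms(2) show "f y j = 0" by simp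
qed

lemma tau0: "j < m \<Longrightarrow> 0 \<le> tau D (Q k) (F j)"
  using psdQ psdF by (rule tau_nonneg)

lemma sum_leverage: "(\<Sum>j<m. w k j powr (1 - 2 / p) * tau D (Q k) (F j)) \<le> real D"
  using psdQ qfQ by (rule sum_tau_le)

lemma \<phi>0: "0 \<le> \<phi> x" by (intro sum_nonneg) simp

lemma f_zero: "\<phi> x = 0 \<Longrightarrow> j < m \<Longrightarrow> f x j = 0"
  by (subst (asm) sum_nonneg_eq_0_iff) auto

subsection \<open>The case \<open>p > 2\<close>\<close>

context
  assumes p2: "2 < p"
begin

lemma w_Suc: "w (Suc k) j = w k j powr (1 - 2 / p) * tau D (Q k) (F j)"
  using p2 by (simp add: wseq.simps(2) wstep_def)

lemma w_nonneg: "j < m \<Longrightarrow> 0 \<le> w k j"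
  by (cases k) (simp_all add: w_Suc tau0)

lemma sum_w_Suc: "(\<Sum>j<m. w (Suc k) j) \<le> real D"
  using sum_leverage by (simp only: w_Suc)

lemma w_Suc_le: "j < m \<Longrightarrow> w (Suc k) j \<le> real D"
  using member_le_sum[of j "{..<m}" "w (Suc k)"] w_nonneg[of _ "Suc k"] sum_w_Suc[of k]
  by (meson finite_lessThan lessThan_iff DiffD1 order_trans)

text \<open>A weight can become \<open>0\<close> only if its form vanishes identically: otherwise
  \<open>f_le_tau\<close> forces the score to be positive. So logarithms of weights may be
  taken.\<close>

lemma w_pos: "j < m \<Longrightarrow> 0 < f x j \<Longrightarrow> 0 < w k j"
proof (induction k)
  case (Suc k)
  then have "0 < tau D (Q k) (F j) * qf D (Q k) x" using f_le_tau[of j k x] by simp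
  then have "0 < tau D (Q k) (F j)" using Q0[of k x] by (simp add: zero_less_mult_iff)
  with Suc show ?case by (simp add: w_Suc)
qed simp

text \<open>The product of the traces over all rounds telescopes, and the mean of the forms dominates
  their geometric mean.\<close>

lemma ln_f_le:
  assumes "j < m" "0 < f x j"
  shows "ln (f x j) \<le> ln (q x) + ln (real D) + 2 / p * ((\<Sum>k<T. ln (w k j)) / real T)" "0 < q x"
proof -
  have wp: "0 < w k j" for k using w_pos assms by blast
  have tp: "0 < tau D (Q k) (F j) \<and> 0 < qf D (Q k) x" for k
  proof -
    have "0 < tau D (Q k) (F j) * qf D (Q k) x"
      using f_le_tau[OF assms(1) wp[of k], of x] assms(2) by linarith
    with Q0[of k x] tau0[OF assms(1), of k] show ?thesis by (auto simp: zero_less_mult_iff)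
  qed
  \<comment> \<open>The score is \<open>w (Suc k) j / w k j powr (1 - 2 / p)\<close>; summed over
    \<open>k\<close>, the logarithms of the weights telescope up to \<open>2 / p\<close> times their
    sum.\<close>
  have "ln (f x j) - (ln (w (Suc k) j) - (1 - 2 / p) * ln (w k j)) \<le> ln (qf D (Q k) x)" for k
  proof -
    have "ln (f x j) \<le> ln (tau D (Q k) (F j) * qf D (Q k) x)"
      using f_le_tau[OF assms(1) wp[of k], of x] assms(2) tp[of k] by (simp add: ln_le_cancel_iff)
    moreover have "ln (w (Suc k) j) = (1 - 2 / p) * ln (w k j) + ln (tau D (Q k) (F j))"
      using wp[of k] tp[of k] by (simp add: w_Suc ln_mult ln_powr)
    ultimately show ?thesis using tp[of k] by (simp add: ln_mult)
  qed
  then have "(\<Sum>k<T. ln (f x j) - (ln (w (Suc k) j) - (1 - 2 / p) * ln (w k j))) \<le> (\<Sum>k<T. ln (qf D (Q k) x))"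
    by (intro sum_mono) blast
  also have "(\<Sum>k<T. ln (f x j) - (ln (w (Suc k) j) - (1 - 2 / p) * ln (w k j)))
      = real T * ln (f x j) - (\<Sum>k<T. ln (w (Suc k) j) - ln (w k j)) - 2 / p * (\<Sum>k<T. ln (w k j))"
    by (simp add: sum_subtractf sum_distrib_left sum.distrib algebra_simps)
  also have "(\<Sum>k<T. ln (w (Suc k) j) - ln (w k j)) = ln (w T j) - ln (w 0 j)"
    by (rule sum_lessThan_telescope)
  also have "ln (w 0 j) = 0" by simp
  finally have 1: "real T * ln (f x j) - ln (w T j) - 2 / p * (\<Sum>k<T. ln (w k j)) \<le> (\<Sum>k<T. ln (qf D (Q k) x))"
    by simp
  obtain T' where T': "T = Suc T'" using T0 by (metis gr0_implies_Suc)
  \<comment> \<open>The boundary term of the telescoping sum. Division by \<open>T\<close> would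
    even leave only \<open>ln D / T\<close> of it.\<close>
  have "ln (w T j) \<le> ln (real D)"
    using w_Suc_le[OF assms(1), of T'] wp[of T] D0 unfolding T' by (subst ln_le_cancel_iff) auto
  also have "\<dots> \<le> real T * ln (real D)"
    using mult_right_mono[OF T1, of "ln (real D)"] D0 by simp
  finally have 2: "ln (w T j) \<le> real T * ln (real D)" .
  have "exp ((\<Sum>k<T. ln (qf D (Q k) x)) / real T) \<le> (\<Sum>k<T. exp (ln (qf D (Q k) x))) / real T"
    using T0 by (rule exp_mean_le)
  also have "\<dots> = q x" using tp by (simp add: q_eq)
  finally have 3: "exp ((\<Sum>k<T. ln (qf D (Q k) x)) / real T) \<le> q x" .
  then show "0 < q x" by (meson exp_gt_zero less_le_trans)
  with 3 have "(\<Sum>k<T. ln (qf D (Q k) x)) / real T \<le> ln (q x)" by (simp add: ln_ge_iff)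
  then have "(\<Sum>k<T. ln (qf D (Q k) x)) \<le> real T * ln (q x)" using T0 by (simp add: field_simps)
  with 1 2 have "real T * ln (f x j) \<le> real T * ln (q x) + real T * ln (real D) + 2 / p * (\<Sum>k<T. ln (w k j))"
    by linarith
  then have "real T * ln (f x j) \<le> real T * (ln (q x) + ln (real D) + 2 / p * ((\<Sum>k<T. ln (w k j)) / real T))"
    using T0 by (simp add: distrib_left)
  then show "ln (f x j) \<le> ln (q x) + ln (real D) + 2 / p * ((\<Sum>k<T. ln (w k j)) / real T)"
    using T0 by (simp only: mult_le_cancel_left_pos of_nat_0_less_iff)
qed

text \<open>Raising the estimate of \<open>ln_f_le\<close> to the power \<open>p / 2 - 1\<close>
  turns the exponent \<open>2 / p\<close> of the geometric mean of the weights into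
  \<open>1 - 2 / p\<close>, the exponent in \<open>Q k\<close>. The arithmetic mean of these powers
  then matches the definition of \<open>q\<close>.\<close>

lemma f_powr_le:
  assumes "j < m"
  shows "f x j powr (p / 2) \<le> (q x * real D) powr (p / 2 - 1) * ((\<Sum>k<T. w k j powr (1 - 2 / p) * f x j) / real T)"
proof (cases "f x j = 0")
  case True
  then show ?thesis using f0 w_nonneg assms by (simp add: sum_nonneg)
next
  case False
  then have fp: "0 < f x j" using f0[OF assms, of x] by simp
  define g where "g = (\<Sum>k<T. ln (w k j)) / real T"
  have wp: "0 < w k j" for k using w_pos assms fp by blast
  have q: "0 < q x" using ln_f_le(2)[OF assms fp] .
  have e: "(p / 2 - 1) * (2 / p) = 1 - 2 / p" using p1 by (simp add: field_simps)
  have "(p / 2 - 1) * ln (f x j) \<le> (p / 2 - 1) * (ln (q x) + ln (real D) + 2 / p * g)"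
    using ln_f_le(1)[OF assms fp] p2 by (intro mult_left_mono) (auto simp: g_def)
  also have "\<dots> = (p / 2 - 1) * ln (q x * real D) + ((p / 2 - 1) * (2 / p)) * g"
  proof -
    have "ln (q x * real D) = ln (q x) + ln (real D)" using q D0 by (simp add: ln_mult)
    then show ?thesis by (simp only: distrib_left mult.assoc)
  qed
  also have "\<dots> = (p / 2 - 1) * ln (q x * real D) + (1 - 2 / p) * g"
    unfolding e ..
  finally have "f x j powr (p / 2 - 1) \<le> (q x * real D) powr (p / 2 - 1) * exp ((1 - 2 / p) * g)"
    using q D0 fp by (simp add: powr_def exp_add[symmetric])
  also have "exp ((1 - 2 / p) * g) \<le> (\<Sum>k<T. w k j powr (1 - 2 / p)) / real T"
  proof -
    have "(1 - 2 / p) * g = (\<Sum>k<T. (1 - 2 / p) * ln (w k j)) / real T"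
      by (simp add: g_def sum_distrib_left)
    moreover have "exp ((1 - 2 / p) * ln (w k j)) = w k j powr (1 - 2 / p)" for k
      using wp[of k] by (simp add: powr_def)
    ultimately show ?thesis using exp_mean_le[OF T0, of "\<lambda>k. (1 - 2 / p) * ln (w k j)"] by simp
  qed
  finally have "f x j powr (p / 2 - 1) \<le> (q x * real D) powr (p / 2 - 1) * ((\<Sum>k<T. w k j powr (1 - 2 / p)) / real T)"
    by (simp add: mult_left_mono)
  then have "f x j powr (p / 2 - 1) * f x j \<le> (q x * real D) powr (p / 2 - 1) * ((\<Sum>k<T. w k j powr (1 - 2 / p)) / real T) * f x j"
    using fp by (intro mult_right_mono) auto
  moreover have "f x j powr (p / 2 - 1) * f x j = f x j powr (p / 2)"
    using fp powr_add[of "f x j" "p / 2 - 1" 1] by simp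
  ultimately show ?thesis by (simp add: sum_distrib_right sum_distrib_left mult_ac)
qed

text \<open>Summed over \<open>j\<close>, the averages on the right of \<open>f_powr_le\<close> are
  \<open>q x\<close> itself, which supplies the missing power of \<open>q x\<close>.\<close>

lemma upper_gt2: "\<phi> x \<le> real D powr (p / 2 - 1) * q x powr (p / 2)"
proof -
  have "\<phi> x \<le> (\<Sum>j<m. (q x * real D) powr (p / 2 - 1) * ((\<Sum>k<T. w k j powr (1 - 2 / p) * f x j) / real T))"
    using f_powr_le by (intro sum_mono) auto
  also have "\<dots> = (q x * real D) powr (p / 2 - 1) * ((\<Sum>j<m. \<Sum>k<T. w k j powr (1 - 2 / p) * f x j) / real T)"
    by (simp add: sum_distrib_left sum_divide_distrib)
  also have "(\<Sum>j<m. \<Sum>k<T. w k j powr (1 - 2 / p) * f x j) = (\<Sum>k<T. qf D (Q k) x)"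
    unfolding qfQ by (rule sum.swap)
  also have "\<dots> / real T = q x" by (simp add: q_eq)
  also have "(q x * real D) powr (p / 2 - 1) * q x = real D powr (p / 2 - 1) * q x powr (p / 2)"
  proof (cases "q x = 0")
    case False
    with q0[of x] have "0 < q x" by simp
    then have "q x powr (p / 2 - 1) * q x = q x powr (p / 2)"
      using powr_add[of "q x" "p / 2 - 1" 1] by simp
    then show ?thesis using q0 by (simp add: powr_mult mult_ac)
  qed simp
  finally show ?thesis .
qed

text \<open>A Hoelder argument for every round: \<open>Q k\<close> is at most
  \<open>\<phi> x powr (2 / p)\<close> times the total weight plus \<open>1\<close>, and the total
  weight is at most \<open>D + 1\<close> on average.\<close>

lemma lower_gt2: "q x powr (p / 2) \<le> real (D + 2) powr (p / 2) * \<phi> x"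
proof (cases "\<phi> x = 0")
  case True
  then have "f x j = 0" if "j < m" for j using f_zero that by blast
  then have "qf D (Q k) x = 0" for k unfolding qfQ by simp
  then have "q x = 0" by (simp add: q_eq)
  then show ?thesis by (simp add: True)
next
  case False
  then have \<phi>: "0 < \<phi> x" using \<phi>0[of x] by linarith
  have Qk: "qf D (Q k) x \<le> \<phi> x powr (2 / p) * ((\<Sum>j<m. w k j) + 1)" for k
  proof -
    have "qf D (Q k) x \<le> (\<Sum>j<m. \<phi> x powr (2 / p) * (w k j + f x j powr (p / 2) / \<phi> x))"
      unfolding qfQ
    proof (intro sum_mono)
      fix j assume "j \<in> {..<m}"
      then have j: "j < m" by simp
      \<comment> \<open>The share of form \<open>j\<close> in the objective; the shares sum to
        \<open>1\<close>.\<close>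
      define u where "u = f x j powr (p / 2) / \<phi> x"
      have u0: "0 \<le> u" using \<phi> by (simp add: u_def)
      have "f x j = (f x j powr (p / 2)) powr (2 / p)"
        using f0[OF j, of x] p1 by (simp add: powr_powr)
      also have "f x j powr (p / 2) = \<phi> x * u" using \<phi> by (simp add: u_def)
      also have "(\<phi> x * u) powr (2 / p) = \<phi> x powr (2 / p) * u powr (2 / p)"
        using \<phi> u0 by (simp add: powr_mult)
      finally have "w k j powr (1 - 2 / p) * f x j = \<phi> x powr (2 / p) * (w k j powr (1 - 2 / p) * u powr (2 / p))"
        by simp
      also have "\<dots> \<le> \<phi> x powr (2 / p) * (w k j + u)"
        using u0 w_nonneg[OF j] p2 by (intro mult_left_mono powr_mix_le) (auto simp: field_simps)
      finally show "w k j powr (1 - 2 / p) * f x j \<le> \<phi> x powr (2 / p) * (w k j + f x j powr (p / 2) / \<phi> x)"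
        by (simp add: u_def)
    qed
    also have "\<dots> = \<phi> x powr (2 / p) * ((\<Sum>j<m. w k j) + \<phi> x / \<phi> x)"
      by (simp only: sum_distrib_left[symmetric] sum.distrib sum_divide_distrib[symmetric])
    finally show ?thesis using \<phi> by simp
  qed
  obtain T' where T': "T = Suc T'" using T0 by (metis gr0_implies_Suc)
  \<comment> \<open>Round \<open>0\<close> has total weight \<open>m\<close>, which is at most
    \<open>T\<close>; every later round has total weight at most \<open>D\<close>.\<close>
  have "(\<Sum>k<T. \<Sum>j<m. w k j) = (\<Sum>j<m. w 0 j) + (\<Sum>k<T'. \<Sum>j<m. w (Suc k) j)"
    unfolding T' by (rule sum.lessThan_Suc_shift)
  also have "\<dots> \<le> real m + (\<Sum>k<T'. real D)"
    using sum_w_Suc by (intro add_mono sum_mono) auto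
  also have "\<dots> \<le> real T + real T * real D"
  proof (intro add_mono)
    show "real m \<le> real T" using m0 by simp
    show "(\<Sum>k<T'. real D) \<le> real T * real D" unfolding T' by (simp add: mult_right_mono)
  qed
  finally have S: "(\<Sum>k<T. \<Sum>j<m. w k j) \<le> real T * (1 + real D)" by (simp add: algebra_simps)
  have "(\<Sum>k<T. qf D (Q k) x) \<le> (\<Sum>k<T. \<phi> x powr (2 / p) * ((\<Sum>j<m. w k j) + 1))"
    using Qk by (intro sum_mono)
  also have "\<dots> = \<phi> x powr (2 / p) * ((\<Sum>k<T. \<Sum>j<m. w k j) + real T)"
    by (simp only: sum_distrib_left[symmetric] sum.distrib) simp
  also have "\<dots> \<le> \<phi> x powr (2 / p) * (real T * (1 + real D) + real T)"
    using S by (intro mult_left_mono) auto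
  also have "\<dots> = real T * (\<phi> x powr (2 / p) * real (D + 2))" by (simp add: algebra_simps)
  finally have "q x \<le> \<phi> x powr (2 / p) * real (D + 2)"
    using T0 by (simp add: q_eq field_simps)
  then have "q x powr (p / 2) \<le> (\<phi> x powr (2 / p) * real (D + 2)) powr (p / 2)"
    using q0 p1 by (intro powr_mono2) auto
  also have "\<dots> = real (D + 2) powr (p / 2) * \<phi> x"
    using \<phi> p1 by (simp add: powr_mult powr_powr)
  finally show ?thesis .
qed

end

subsection \<open>The case \<open>p < 2\<close>\<close>

context
  assumes p2: "p < 2"
begin

lemma w_Suc_cases: "w (Suc k) j = w k j \<or> w (Suc k) j = w k j / 2 \<and> 2 / real m < w k j
    \<and> tau D (Q k) (F j) < (w k j / 2) powr (2 / p)"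
  using p2 by (auto simp: wseq.simps(2) wstep_def)

text \<open>Only weights above \<open>2 / m\<close> are halved. This floor limits the number of
  halvings, and it costs little: the weights not exceeding \<open>2 / m\<close> sum to at most
  \<open>2\<close>.\<close>

lemma w_lower: "1 / real m \<le> w k j"
proof (induction k)
  case 0
  show ?case using m0 by simp
next
  case (Suc k)
  then show ?case using w_Suc_cases[of k j] by auto
qed

lemma w_gt0: "0 < w k j"
  using w_lower[of k j] m0 by (metis less_le_trans of_nat_0_less_iff zero_less_divide_1_iff)

lemma w_decseq: "w (Suc k) j \<le> w k j"
  using w_Suc_cases[of k j] w_gt0[of k j] by auto

lemma w_antimono: "k \<le> l \<Longrightarrow> w l j \<le> w k j"
  using w_decseq lift_Suc_antimono_le[where f = "\<lambda>k. w k j"] by blast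

text \<open>The exponent \<open>1 - 2 / p\<close> is negative for \<open>p < 2\<close>: decreasing
  weights make the forms increase.\<close>

lemma w_powr_mono: "k \<le> l \<Longrightarrow> w k j powr (1 - 2 / p) \<le> w l j powr (1 - 2 / p)"
  using w_antimono[of k l j] w_gt0 p1 p2 by (intro powr_mono2') auto

lemma Q_mono: "k \<le> l \<Longrightarrow> qf D (Q k) x \<le> qf D (Q l) x"
  unfolding qfQ using w_powr_mono f0 by (intro sum_mono mult_right_mono) auto

text \<open>A weight that stays keeps the estimate because the form only grows. A halved weight has
  it by the test: the score bounds the form, and it lies below
  \<open>(w / 2) powr (2 / p)\<close>.\<close>

lemma overestimate: "j < m \<Longrightarrow> f x j \<le> w k j powr (2 / p) * qf D (Q k) x"
proof (induction k)
  case 0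
  have "f x j \<le> (\<Sum>j<m. f x j)" using f0 0 by (intro member_le_sum) auto
  then show ?case unfolding qfQ by simp
next
  case (Suc k)
  have mono: "qf D (Q k) x \<le> qf D (Q (Suc k)) x" by (rule Q_mono) simp
  from w_Suc_cases[of k j] show ?case
  proof
    assume e: "w (Suc k) j = w k j"
    have "f x j \<le> w k j powr (2 / p) * qf D (Q k) x" using Suc by blast
    also have "\<dots> \<le> w k j powr (2 / p) * qf D (Q (Suc k)) x" using mono by (intro mult_left_mono) auto
    finally show ?thesis unfolding e .
  next
    assume e: "w (Suc k) j = w k j / 2 \<and> 2 / real m < w k j \<and> tau D (Q k) (F j) < (w k j / 2) powr (2 / p)"
    have "f x j \<le> tau D (Q k) (F j) * qf D (Q k) x" using f_le_tau Suc.prems w_gt0 by blast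
    also have "\<dots> \<le> w (Suc k) j powr (2 / p) * qf D (Q (Suc k)) x"
      unfolding conjunct1[OF e] using e mono Q0 tau0[OF Suc.prems, of k] by (intro mult_mono) auto
    finally show ?thesis .
  qed
qed

text \<open>A weight can be halved at most \<open>log 2 m\<close> times, so some round among the first \<open>m\<^sup>2\<close> leaves
  all weights unchanged.\<close>

lemma stable_round: "\<exists>k<m*m. \<forall>j<m. w (Suc k) j = w k j"
proof (rule ccontr)
  assume "\<not> ?thesis"
  then have ex: "\<exists>j<m. w (Suc k) j \<noteq> w k j" if "k < m * m" for k using that by blast
  \<comment> \<open>The weights start at \<open>1\<close>, so \<open>- \<Psi> k\<close> counts all
    halvings before round \<open>k\<close>.\<close>
  define \<Psi> where "\<Psi> k = (\<Sum>j<m. log 2 (w k j))" for k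
  have step: "\<Psi> (Suc k) \<le> \<Psi> k - 1" if k: "k < m * m" for k
  proof -
    obtain i where i: "i < m" "w (Suc k) i \<noteq> w k i" using ex k by blast
    then have l': "w (Suc k) i = w k i / 2" using w_Suc_cases[of k i] by auto
    have l: "log 2 (w (Suc k) i) = log 2 (w k i) - 1"
    proof -
      have "log 2 (w k i / 2) = log 2 (w k i) - log 2 2" using w_gt0[of k i] by (subst log_divide) auto
      then show ?thesis unfolding l' by simp
    qed
    have "\<Psi> (Suc k) \<le> (\<Sum>j<m. log 2 (w k j) - (if j = i then 1 else 0))"
      unfolding \<Psi>_def using l w_decseq w_gt0 by (intro sum_mono) auto
    also have "\<dots> = \<Psi> k - 1" using i(1) by (simp add: sum_subtractf \<Psi>_def)
    finally show ?thesis .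
  qed
  have "\<Psi> k \<le> - real k" if "k \<le> m * m" for k
    using that
  proof (induction k)
    case 0
    show ?case by (simp add: \<Psi>_def)
  next
    case (Suc k)
    then show ?case using step[of k] by simp
  qed
  then have "\<Psi> (m * m) \<le> - real (m * m)" by blast
  moreover have "- real (m * m) < \<Psi> (m * m)"
  proof -
    have lm: "log 2 (real m) < real m"
      using m0 less_exp[of m] by (subst log_less_iff) (auto simp: powr_realpow of_nat_less_numeral_power_cancel_iff)
    have "- log 2 (real m) \<le> log 2 (w (m * m) j)" for j
    proof -
      have "log 2 (1 / real m) \<le> log 2 (w (m * m) j)"
        using w_lower[of "m * m" j] w_gt0[of "m * m" j] m0 by (subst log_le_cancel_iff) auto
      then show ?thesis using m0 by (simp add: log_divide)
    qed
    then have "(\<Sum>j<m. - log 2 (real m)) \<le> \<Psi> (m * m)"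
      unfolding \<Psi>_def by (intro sum_mono)
    then have "- (real m * log 2 (real m)) \<le> \<Psi> (m * m)" by simp
    moreover have "real m * log 2 (real m) < real m * real m"
      using lm m0 by (intro mult_strict_left_mono) auto
    ultimately show ?thesis by simp
  qed
  ultimately show False by simp
qed

text \<open>In a stable round every weight fails the test: it is at most \<open>2 / m\<close>, or
  its score is at least \<open>(w / 2) powr (2 / p)\<close>. The latter bounds it by
  \<open>4\<close> times its leverage term, since \<open>2 powr (2 / p) \<le> 4\<close> for
  \<open>p \<ge> 1\<close>. Leverage terms sum to at most \<open>D\<close>, and later weights are
  smaller.\<close>

lemma sum_w_le:
  assumes "m * m \<le> k"
  shows "(\<Sum>j<m. w k j) \<le> 4 * real D + 2"
proof -
  obtain l where l: "l < m * m" "\<And>j. j < m \<Longrightarrow> w (Suc l) j = w l j" using stable_round by blast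
  have "(\<Sum>j<m. w k j) \<le> (\<Sum>j<m. w l j)"
    using l(1) assms by (intro sum_mono w_antimono) auto
  also have "\<dots> \<le> (\<Sum>j<m. 2 / real m + 4 * (w l j powr (1 - 2 / p) * tau D (Q l) (F j)))"
  proof (intro sum_mono)
    fix j assume "j \<in> {..<m}"
    then have j: "j < m" by simp
    show "w l j \<le> 2 / real m + 4 * (w l j powr (1 - 2 / p) * tau D (Q l) (F j))"
    proof (cases "w l j \<le> 2 / real m")
      case True
      then show ?thesis using tau0[OF j, of l] by (simp add: add_increasing2)
    next
      case False
      have "\<not> tau D (Q l) (F j) < (w l j / 2) powr (2 / p)"
      proof
        assume "tau D (Q l) (F j) < (w l j / 2) powr (2 / p)"
        then have "w (Suc l) j = w l j / 2" using False p2 by (simp add: wseq.simps(2) wstep_def)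
        then show False using l(2)[OF j] w_gt0[of l j] by simp
      qed
      then have h1: "w l j powr (1 - 2 / p) * (w l j / 2) powr (2 / p) \<le> w l j powr (1 - 2 / p) * tau D (Q l) (F j)"
        by (intro mult_left_mono) auto
      have h2: "w l j powr (1 - 2 / p) * (w l j / 2) powr (2 / p) = w l j / 2 powr (2 / p)"
      proof -
        have "w l j powr (1 - 2 / p) * w l j powr (2 / p) = w l j"
          using w_gt0[of l j] by (simp add: powr_add[symmetric])
        then show ?thesis using w_gt0[of l j] by (simp add: powr_divide)
      qed
      have h3: "w l j / 4 \<le> w l j / 2 powr (2 / p)"
      proof -
        have "2 powr (2 / p) \<le> (2::real) powr 2" using p1 by (intro powr_mono) (auto simp: field_simps)
        then have "2 powr (2 / p) \<le> (4::real)" by simp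
        then show ?thesis using w_gt0[of l j] by (intro divide_left_mono) auto
      qed
      have "w l j / 4 \<le> w l j powr (1 - 2 / p) * tau D (Q l) (F j)"
        using h3 h1[unfolded h2] by (rule order_trans)
      then have "w l j \<le> 4 * (w l j powr (1 - 2 / p) * tau D (Q l) (F j))" by simp
      then show ?thesis by (simp add: add_increasing)
    qed
  qed
  also have "\<dots> = 2 + 4 * (\<Sum>j<m. w l j powr (1 - 2 / p) * tau D (Q l) (F j))"
    using m0 by (simp add: sum.distrib sum_distrib_left)
  also have "\<dots> \<le> 2 + 4 * real D" using sum_leverage[of l] by simp
  finally show ?thesis by simp
qed

text \<open>Hoelder with exponents \<open>1 - p / 2\<close> and \<open>p / 2\<close> at round
  \<open>m * m\<close>, where the total weight is at most \<open>4 D + 2\<close>; the shares of the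
  forms in \<open>K\<close> add the \<open>1\<close> in \<open>4 D + 3\<close>. The factor
  \<open>2\<close> is the price of averaging.\<close>

lemma upper_lt2: "\<phi> x \<le> 2 * (4 * real D + 3) * q x powr (p / 2)"
proof -
  define K where "K = qf D (Q (m * m)) x"
  have K0: "0 \<le> K" unfolding K_def by (rule Q0)
  have A: "\<phi> x \<le> K powr (p / 2) * (4 * real D + 3)"
  proof (cases "K = 0")
    case True
    then have "f x j = 0" if "j < m" for j
      using overestimate[OF that, of x "m * m"] f0[OF that, of x] by (simp add: K_def)
    then have "\<phi> x \<le> 0" by (intro sum_nonpos) simp
    then show ?thesis using K0 by (simp add: order_trans)
  next
    case False
    with K0 have K: "0 < K" by simp
    have "\<phi> x \<le> (\<Sum>j<m. K powr (p / 2) * (w (m * m) j + w (m * m) j powr (1 - 2 / p) * f x j / K))"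
    proof (intro sum_mono)
      fix j assume "j \<in> {..<m}"
      then have j: "j < m" by simp
      define v u where "v = w (m * m) j" and "u = v powr (1 - 2 / p) * f x j / K"
      have v: "0 < v" unfolding v_def by (rule w_gt0)
      have u: "0 \<le> u" unfolding u_def using K f0[OF j, of x] by simp
      have "f x j = K * u * v powr (2 / p - 1)"
      proof -
        have "v powr (1 - 2 / p) * v powr (2 / p - 1) = 1" using v by (simp add: powr_add[symmetric])
        then show ?thesis unfolding u_def using K by simp
      qed
      then have "f x j powr (p / 2) = K powr (p / 2) * (v powr ((2 / p - 1) * (p / 2)) * u powr (p / 2))"
        using K u v by (simp add: powr_mult powr_powr)
      also have "(2 / p - 1) * (p / 2) = 1 - p / 2" using p1 by (simp add: field_simps)
      also have "K powr (p / 2) * (v powr (1 - p / 2) * u powr (p / 2)) \<le> K powr (p / 2) * (v + u)"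
        using u v p1 p2 by (intro mult_left_mono powr_mix_le) auto
      finally show "f x j powr (p / 2) \<le> K powr (p / 2) * (w (m * m) j + w (m * m) j powr (1 - 2 / p) * f x j / K)"
        by (simp add: u_def v_def)
    qed
    also have "\<dots> = K powr (p / 2) * ((\<Sum>j<m. w (m * m) j) + K / K)"
      unfolding K_def qfQ by (simp only: sum_distrib_left[symmetric] sum.distrib sum_divide_distrib[symmetric])
    also have "\<dots> \<le> K powr (p / 2) * (4 * real D + 3)"
      using K sum_w_le[of "m * m"] by (intro mult_left_mono) auto
    finally show ?thesis .
  qed
  have "K powr (p / 2) \<le> 2 * q x powr (p / 2)"
  proof -
    \<comment> \<open>Half of the rounds come at or after \<open>m * m\<close>, and their forms are
      at least \<open>K\<close>.\<close>
    have "real (m * m) * K = (\<Sum>k\<in>{m*m..<T}. K)" by simp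
    also have "\<dots> \<le> (\<Sum>k\<in>{m*m..<T}. qf D (Q k) x)"
      unfolding K_def by (intro sum_mono Q_mono) auto
    also have "\<dots> \<le> (\<Sum>k<T. qf D (Q k) x)"
      using Q0 by (intro sum_mono2) auto
    also have "\<dots> = real T * q x" using m0 by (simp add: q_eq)
    finally have "K \<le> 2 * q x" using m0 by simp
    then have "K powr (p / 2) \<le> (2 * q x) powr (p / 2)" using K0 p1 by (intro powr_mono2) auto
    also have "\<dots> = 2 powr (p / 2) * q x powr (p / 2)" using q0 by (simp add: powr_mult)
    also have "\<dots> \<le> 2 * q x powr (p / 2)"
      using p2 powr_mono[of "p / 2" 1 "2::real"] by (intro mult_right_mono) auto
    finally show ?thesis .
  qed
  then have "K powr (p / 2) * (4 * real D + 3) \<le> 2 * q x powr (p / 2) * (4 * real D + 3)"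
    by (intro mult_right_mono) auto
  with A show ?thesis by (simp only: mult_ac)
qed

text \<open>Split \<open>f\<close> as \<open>f powr (p / 2) * f powr (1 - p / 2)\<close> and apply
  \<open>overestimate\<close> to the second factor: the weights cancel exactly, leaving
  \<open>K \<le> \<phi> x * K powr (1 - p / 2)\<close>. No bound on the total weight enters.\<close>

lemma lower_lt2: "q x powr (p / 2) \<le> \<phi> x"
proof -
  have Qk: "qf D (Q k) x \<le> \<phi> x powr (2 / p)" for k
  proof (cases "qf D (Q k) x = 0")
    case False
    define K where "K = qf D (Q k) x"
    have K: "0 < K" using False Q0[of k x] by (simp add: K_def)
    have "K \<le> (\<Sum>j<m. f x j powr (p / 2) * K powr (1 - p / 2))"
      unfolding K_def[unfolded qfQ]
    proof (intro sum_mono)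
      fix j assume "j \<in> {..<m}"
      then have j: "j < m" by simp
      show "w k j powr (1 - 2 / p) * f x j
          \<le> f x j powr (p / 2) * (\<Sum>j<m. w k j powr (1 - 2 / p) * f x j) powr (1 - p / 2)"
        unfolding K_def[unfolded qfQ, symmetric]
      proof (cases "f x j = 0")
        case False
        then have fp: "0 < f x j" using f0[OF j, of x] by simp
        have "f x j = f x j powr (p / 2) * f x j powr (1 - p / 2)"
          using fp by (simp add: powr_add[symmetric])
        also have "\<dots> \<le> f x j powr (p / 2) * (w k j powr (2 / p) * K) powr (1 - p / 2)"
          using overestimate[OF j, of x k] fp p2
          by (intro mult_left_mono powr_mono2) (auto simp: K_def)
        also have "(w k j powr (2 / p) * K) powr (1 - p / 2) = w k j powr (2 / p * (1 - p / 2)) * K powr (1 - p / 2)"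
          using K by (simp add: powr_mult powr_powr)
        also have "2 / p * (1 - p / 2) = 2 / p - 1" using p1 by (simp add: field_simps)
        finally have "w k j powr (1 - 2 / p) * f x j
            \<le> w k j powr (1 - 2 / p) * (f x j powr (p / 2) * (w k j powr (2 / p - 1) * K powr (1 - p / 2)))"
          by (intro mult_left_mono) auto
        also have "\<dots> = (w k j powr (1 - 2 / p) * w k j powr (2 / p - 1)) * (f x j powr (p / 2) * K powr (1 - p / 2))"
          by (simp add: mult_ac)
        also have "w k j powr (1 - 2 / p) * w k j powr (2 / p - 1) = 1"
          using w_gt0[of k j] by (simp add: powr_add[symmetric])
        finally show "w k j powr (1 - 2 / p) * f x j \<le> f x j powr (p / 2) * K powr (1 - p / 2)" by simp
      qed simp
    qed
    also have "\<dots> = \<phi> x * K powr (1 - p / 2)" by (simp add: sum_distrib_right)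
    finally have "K * K powr (p / 2 - 1) \<le> \<phi> x * K powr (1 - p / 2) * K powr (p / 2 - 1)"
      by (intro mult_right_mono) auto
    also have "\<dots> = \<phi> x" using K by (simp add: mult.assoc powr_add[symmetric])
    also have "K * K powr (p / 2 - 1) = K powr (p / 2)" using K powr_add[of K 1 "p / 2 - 1"] by simp
    finally have "(K powr (p / 2)) powr (2 / p) \<le> \<phi> x powr (2 / p)" using p1 by (intro powr_mono2) auto
    then show ?thesis using K p1 by (simp add: powr_powr K_def)
  qed simp
  have "(\<Sum>k<T. qf D (Q k) x) \<le> (\<Sum>k<T. \<phi> x powr (2 / p))" using Qk by (intro sum_mono)
  then have "q x \<le> \<phi> x powr (2 / p)" using T0 by (simp add: q_eq field_simps)
  then have "q x powr (p / 2) \<le> (\<phi> x powr (2 / p)) powr (p / 2)" using q0 p1 by (intro powr_mono2) auto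
  also have "\<dots> = \<phi> x" using \<phi>0[of x] p1 by (simp add: powr_powr)
  finally show ?thesis .
qed

end

section \<open>Both cases of the merging bound combined\<close>

lemma weight_nonneg: "p \<noteq> 2 \<Longrightarrow> j < m \<Longrightarrow> 0 \<le> w k j"
  using w_nonneg w_gt0 by (metis less_eq_real_def linorder_neqE_linordered_idom)

text \<open>A single exponent that dominates all four bounds: for \<open>p < 2\<close> the constant
  \<open>8 (D + 1)\<close> is at most \<open>(D + 1)^4\<close>, and for \<open>p > 2\<close> the
  worse factor \<open>(D + 2) powr (p / 2)\<close> is at most \<open>(D + 1) powr p\<close>.\<close>

lemma wavg_bounds:
  assumes "p \<noteq> 2"
  shows "q x powr (p / 2) \<le> real (D + 1) powr (5 + p) * \<phi> x"
    and "\<phi> x \<le> real (D + 1) powr (5 + p) * q x powr (p / 2)"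
proof -
  have D1: "1 \<le> real (D + 1)" "real D \<le> real (D + 1)" by auto
  have D2: "2 \<le> real (D + 1)" using D0 by simp
  have one: "1 \<le> real (D + 1) powr (5 + p)" using D1 p1 by (intro ge_one_powr_ge_zero) auto
  have c5: "2 * (4 * real D + 3) \<le> real (D + 1) powr (5 + p)"
  proof -
    have "2 * (4 * real D + 3) \<le> 8 * real (D + 1)" by simp
    also have "\<dots> = 2 ^ 3 * real (D + 1) ^ 1" by simp
    also have "\<dots> \<le> real (D + 1) ^ 3 * real (D + 1) ^ 1"
      using D2 by (intro mult_right_mono power_mono) auto
    also have "\<dots> = real (D + 1) ^ 4" by (simp only: power_add[symmetric]) simp
    also have "\<dots> = real (D + 1) powr 4" using powr_realpow[of "real (D + 1)" 4] by simp
    also have "\<dots> \<le> real (D + 1) powr (5 + p)" using D1 p1 by (intro powr_mono) auto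
    finally show ?thesis .
  qed
  have cp: "real (D + 2) powr (p / 2) \<le> real (D + 1) powr (5 + p)"
  proof -
    have "real (D + 2) \<le> real (D + 1) ^ 2"
    proof -
      have "1 \<le> real D" using D0 by simp
      moreover have "0 \<le> real D * real D" by simp
      moreover have "real (D + 1) ^ 2 = real D * real D + 2 * real D + 1"
        by (simp add: power2_eq_square algebra_simps)
      moreover have "real (D + 2) = real D + 2" by simp
      ultimately show ?thesis by linarith
    qed
    also have "\<dots> = real (D + 1) powr 2" using powr_realpow[of "real (D + 1)" 2] by simp
    finally have "real (D + 2) powr (p / 2) \<le> (real (D + 1) powr 2) powr (p / 2)"
      using p1 by (intro powr_mono2) auto
    also have "\<dots> = real (D + 1) powr p" by (simp only: powr_powr) simp
    also have "\<dots> \<le> real (D + 1) powr (5 + p)" using D1 by (intro powr_mono) auto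
    finally show ?thesis .
  qed
  have cd: "real D powr (p / 2 - 1) \<le> real (D + 1) powr (5 + p)" if "2 < p"
  proof -
    have "real D powr (p / 2 - 1) \<le> real (D + 1) powr (p / 2 - 1)"
      using that by (intro powr_mono2) auto
    also have "\<dots> \<le> real (D + 1) powr (5 + p)" using D1 p1 by (intro powr_mono) auto
    finally show ?thesis .
  qed
  show "q x powr (p / 2) \<le> real (D + 1) powr (5 + p) * \<phi> x"
  proof (cases "2 < p")
    case True
    note lower_gt2[OF this, of x]
    also have "real (D + 2) powr (p / 2) * \<phi> x \<le> real (D + 1) powr (5 + p) * \<phi> x"
      using cp \<phi>0 by (rule mult_right_mono)
    finally show ?thesis .
  next
    case False
    then have "q x powr (p / 2) \<le> \<phi> x" using lower_lt2[of x] assms by simp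
    also have "\<dots> \<le> real (D + 1) powr (5 + p) * \<phi> x"
      using mult_right_mono[OF one \<phi>0[of x]] by simp
    finally show ?thesis .
  qed
  show "\<phi> x \<le> real (D + 1) powr (5 + p) * q x powr (p / 2)"
  proof (cases "2 < p")
    case True
    note upper_gt2[OF this, of x]
    also have "real D powr (p / 2 - 1) * q x powr (p / 2) \<le> real (D + 1) powr (5 + p) * q x powr (p / 2)"
      using cd True by (intro mult_right_mono) auto
    finally show ?thesis .
  next
    case False
    then have "\<phi> x \<le> 2 * (4 * real D + 3) * q x powr (p / 2)" using upper_lt2[of x] assms by simp
    also have "\<dots> \<le> real (D + 1) powr (5 + p) * q x powr (p / 2)"
      using c5 by (intro mult_right_mono) auto
    finally show ?thesis .
  qed
qed

end

section \<open>Reasoning about programs of the real RAM\<close>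

text \<open>Time is accounted for syntactically: \<open>tb W c\<close> bounds the time of \<open>c\<close> as soon as each of its loops is
  iterated at most \<open>W\<close> times whenever it is entered.\<close>

fun tb :: "nat \<Rightarrow> com \<Rightarrow> nat" where
  "tb W Skip = 1"
| "tb W (AssignI a e) = 1 + icost a + icost e"
| "tb W (AssignR a e) = 1 + icost a + rcost e"
| "tb W (Seq c c') = tb W c + tb W c'"
| "tb W (If b c c') = 1 + bcost b + tb W c + tb W c'"
| "tb W (While b c) = (W + 1) * (1 + bcost b + tb W c)"

fun csize :: "com \<Rightarrow> nat" where
  "csize Skip = 1"
| "csize (AssignI a e) = 1 + icost a + icost e"
| "csize (AssignR a e) = 1 + icost a + rcost e"
| "csize (Seq c c') = csize c + csize c'"
| "csize (If b c c') = 1 + bcost b + csize c + csize c'"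
| "csize (While b c) = 1 + bcost b + csize c"

fun depth :: "com \<Rightarrow> nat" where
  "depth (Seq c c') = max (depth c) (depth c')"
| "depth (If b c c') = max (depth c) (depth c')"
| "depth (While b c) = Suc (depth c)"
| "depth _ = 0"

text \<open>For a fixed program the time is thus polynomial in the loop bound \<open>W\<close>, with
  the nesting depth of its loops as degree. Only \<open>W\<close> depends on the input.\<close>

lemma tb_le: "depth c \<le> k \<Longrightarrow> tb W c \<le> csize c * (W + 1) ^ k"
proof (induction c arbitrary: k)
  case Skip
  show ?case by simp
next
  case (AssignI a e)
  show ?case using mult_le_mono2[of 1 "(W + 1) ^ k" "csize (AssignI a e)"] by simp
next
  case (AssignR a e)
  show ?case using mult_le_mono2[of 1 "(W + 1) ^ k" "csize (AssignR a e)"] by simp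
next
  case (Seq c c')
  then show ?case by (simp add: add_mono distrib_right)
next
  case (If b c c')
  have "1 + bcost b \<le> (1 + bcost b) * (W + 1) ^ k"
    using mult_le_mono2[of 1 "(W + 1) ^ k" "1 + bcost b"] by simp
  moreover have "tb W c \<le> csize c * (W + 1) ^ k" "tb W c' \<le> csize c' * (W + 1) ^ k" using If by auto
  ultimately have "1 + bcost b + tb W c + tb W c'
      \<le> (1 + bcost b) * (W + 1) ^ k + csize c * (W + 1) ^ k + csize c' * (W + 1) ^ k"
    by linarith
  then show ?case by (simp only: tb.simps csize.simps distrib_right)
next
  case (While b c)
  then obtain k' where k: "k = Suc k'" by (cases k) auto
  have 1: "1 + bcost b \<le> (1 + bcost b) * (W + 1) ^ k'"
    using mult_le_mono2[of 1 "(W + 1) ^ k'" "1 + bcost b"] by simp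
  have "1 + bcost b + tb W c \<le> (1 + bcost b + csize c) * (W + 1) ^ k'"
    using 1 While.IH[of k'] While.prems k by (simp only: distrib_right) (simp del: mult_Suc)
  then have "(W + 1) * (1 + bcost b + tb W c) \<le> (W + 1) * ((1 + bcost b + csize c) * (W + 1) ^ k')"
    by (rule mult_le_mono2)
  then show ?case unfolding k by (simp only: tb.simps csize.simps power_Suc mult_ac)
qed

lemma ival_fst: "fst s = fst s' \<Longrightarrow> ival \<iota> s e = ival \<iota> s' e"
  by (induction e) (simp_all add: Let_def)

lemma ispan_fst: "fst s = fst s' \<Longrightarrow> ispan \<iota> s e = ispan \<iota> s' e"
  by (induction e) (simp_all add: ival_fst[of s s'])

abbreviation V :: "nat \<Rightarrow> iexp" where "V r \<equiv> IMem (INat r)"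
abbreviation SetI :: "nat \<Rightarrow> iexp \<Rightarrow> com" where "SetI r e \<equiv> AssignI (INat r) e"
abbreviation De :: iexp where "De \<equiv> IAdd ICols (INat 1)"

text \<open>The real memory holds 16 interleaved matrices with rows of length \<open>D = d + 1\<close>; entry \<open>(i, j)\<close>
  of matrix \<open>q\<close> is the cell \<open>16 * (i * D + j) + q\<close>.\<close>

definition adr :: "nat \<Rightarrow> iexp \<Rightarrow> iexp \<Rightarrow> iexp" where
  "adr q i j = IAdd (IMul (INat 16) (IAdd (IMul i De) j)) (INat q)"

definition Cell :: "nat \<Rightarrow> iexp \<Rightarrow> iexp \<Rightarrow> rexp" where
  "Cell q i j = RMem (adr q i j)"

definition SetA :: "nat \<Rightarrow> iexp \<Rightarrow> iexp \<Rightarrow> rexp \<Rightarrow> com" where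
  "SetA q i j e = AssignR (adr q i j) e"

text \<open>The limit \<open>e\<close> is evaluated anew before each iteration, so the rules for
  \<open>For\<close> ask for its value in every intermediate state.\<close>

definition For :: "nat \<Rightarrow> iexp \<Rightarrow> com \<Rightarrow> com" where
  "For r e c = Seq (SetI r (INat 0)) (While (BLessI (V r) e) (Seq c (SetI r (IAdd (V r) (INat 1)))))"

definition SumTo :: "nat \<Rightarrow> iexp \<Rightarrow> iexp \<Rightarrow> nat \<Rightarrow> iexp \<Rightarrow> rexp \<Rightarrow> com" where
  "SumTo q i j r N e = Seq (SetA q i j (RReal 0)) (For r N (SetA q i j (RAdd (Cell q i j) e)))"

definition Fill :: "nat \<Rightarrow> iexp \<Rightarrow> rexp \<Rightarrow> com" where
  "Fill q base e = For 11 De (For 12 De (SetA q (IAdd base (V 11)) (V 12) e))"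

definition upd3 :: "mats \<Rightarrow> nat \<Rightarrow> nat \<Rightarrow> nat \<Rightarrow> real \<Rightarrow> mats" where
  "upd3 \<mu> q i j v = (\<lambda>q' i' j'. if q' = q \<and> i' = i \<and> j' = j then v else \<mu> q' i' j')"

text \<open>The frame condition: at most the natural cells in \<open>X\<close> have changed.\<close>

definition agree :: "nat set \<Rightarrow> (nat \<Rightarrow> nat) \<Rightarrow> (nat \<Rightarrow> nat) \<Rightarrow> bool" where
  "agree X \<rho> \<rho>' \<longleftrightarrow> (\<forall>r. r \<notin> X \<longrightarrow> \<rho>' r = \<rho> r)"

lemma agree_refl: "agree X \<rho> \<rho>"
  by (simp add: agree_def)

lemma agree_upd: "agree X \<rho> \<rho>' \<Longrightarrow> r \<in> X \<Longrightarrow> agree X \<rho> (\<rho>'(r := v))"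
  by (auto simp: agree_def)

lemma agree_trans: "agree X \<rho> \<rho>' \<Longrightarrow> agree Y \<rho>' \<rho>'' \<Longrightarrow> X \<subseteq> Z \<Longrightarrow> Y \<subseteq> Z \<Longrightarrow> agree Z \<rho> \<rho>''"
  unfolding agree_def by (metis subsetD)

lemma cell_inj:
  fixes D :: nat
  assumes "q < 16" "q' < 16" "j < D" "j' < D" "16 * (i * D + j) + q = 16 * (i' * D + j') + q'"
  shows "q = q' \<and> i = i' \<and> j = j'"
proof -
  have "q = q' \<and> x = x'" if "16 * x + q = 16 * x' + q'" for x x' :: nat
    using assms(1,2) that by arith
  from this[OF assms(5)] have "q = q'" and e: "i * D + j = i' * D + j'" by auto
  have "(i * D + j) div D = i" "(i' * D + j') div D = i'" using assms(3,4) by auto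
  with e have "i = i'" by simp
  with e \<open>q = q'\<close> show ?thesis by simp
qed

lemma cell_less:
  fixes D :: nat
  assumes "i < R" "j < D"
  shows "i * D + j < R * D"
proof -
  have "i * D + j < Suc i * D" using assms by simp
  also have "\<dots> \<le> R * D" using assms by (intro mult_le_mono1) simp
  finally show ?thesis .
qed

text \<open>\<open>M\<close> bounds all addresses, \<open>W\<close> the iterations of a loop, and
  \<open>R\<close> is the number of rows of each interleaved matrix; \<open>64 \<le> M\<close> makes
  room for the natural cells used as variables.\<close>

locale ram =
  fixes \<iota> :: input and D M W R :: nat
  assumes D_eq: "D = Suc (cols_of \<iota>)"
    and M64: "64 \<le> M" and M_R: "16 * (R * D) \<le> M" and D_R: "D \<le> R" and D_W: "D \<le> W"
begin

declare distrib_left_numeral [simp del]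

definition run :: "com \<Rightarrow> store \<Rightarrow> (store \<Rightarrow> bool) \<Rightarrow> bool" where
  "run c s P \<longleftrightarrow> (\<exists>t m s'. exec \<iota> c s t m s' \<and> t \<le> tb W c \<and> m \<le> M \<and> P s')"

section \<open>The real memory viewed as sixteen matrices\<close>

definition view :: "store \<Rightarrow> mats" where
  "view s = (\<lambda>q i j. if q < 16 \<and> i < R \<and> j < D then snd s (16 * (i * D + j) + q) else 0)"

text \<open>A memory with a given view. It allows expressions to be evaluated on a view, although
  their semantics is defined on stores.\<close>

definition unview :: "mats \<Rightarrow> nat \<Rightarrow> real" where
  "unview \<mu> c = \<mu> (c mod 16) (c div 16 div D) (c div 16 mod D)"

definition iv :: "(nat \<Rightarrow> nat) \<Rightarrow> iexp \<Rightarrow> nat" where "iv \<rho> e = ival \<iota> (\<rho>, \<lambda>_. 0) e"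
definition isp :: "(nat \<Rightarrow> nat) \<Rightarrow> iexp \<Rightarrow> nat" where "isp \<rho> e = ispan \<iota> (\<rho>, \<lambda>_. 0) e"
definition re :: "(nat \<Rightarrow> nat) \<Rightarrow> mats \<Rightarrow> rexp \<Rightarrow> real" where
  "re \<rho> \<mu> e = rval \<iota> (\<rho>, unview \<mu>) e"
definition be :: "(nat \<Rightarrow> nat) \<Rightarrow> mats \<Rightarrow> bexp \<Rightarrow> bool" where
  "be \<rho> \<mu> b = bval \<iota> (\<rho>, unview \<mu>) b"

text \<open>All real cells read must lie within the view; only then may the value be computed from
  \<open>view s\<close> instead of the raw memory.\<close>

definition rok :: "(nat \<Rightarrow> nat) \<Rightarrow> rexp \<Rightarrow> bool" where
  "rok \<rho> e \<longleftrightarrow> (\<forall>s. fst s = \<rho> \<longrightarrow> rspan \<iota> s e \<le> M \<and> rval \<iota> s e = re \<rho> (view s) e)"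
definition bok :: "(nat \<Rightarrow> nat) \<Rightarrow> bexp \<Rightarrow> bool" where
  "bok \<rho> e \<longleftrightarrow> (\<forall>s. fst s = \<rho> \<longrightarrow> bspan \<iota> s e \<le> M \<and> bval \<iota> s e = be \<rho> (view s) e)"

lemma D0: "0 < D" by (simp add: D_eq)

lemma ival_iv: "ival \<iota> s e = iv (fst s) e"
  unfolding iv_def by (rule ival_fst) simp

lemma ispan_isp: "ispan \<iota> s e = isp (fst s) e"
  unfolding isp_def by (rule ispan_fst) simp

lemma iv_simps [simp]:
  "iv \<rho> (INat c) = c" "iv \<rho> IRows = rows_of \<iota>" "iv \<rho> ICols = cols_of \<iota>" "iv \<rho> IMsgs = length (msgs_of \<iota>)"
  "iv \<rho> (IMem a) = \<rho> (iv \<rho> a)" "iv \<rho> (IAdd a b) = iv \<rho> a + iv \<rho> b" "iv \<rho> (ISub a b) = iv \<rho> a - iv \<rho> b"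
  "iv \<rho> (IMul a b) = iv \<rho> a * iv \<rho> b"
  by (simp_all add: iv_def)

lemma iv_IMsgLen [simp]:
  "iv \<rho> (IMsgLen a) = (let i = iv \<rho> a in if i < length (msgs_of \<iota>) then length (msgs_of \<iota> ! i) else 0)"
  by (simp add: iv_def)

lemma isp_simps [simp]:
  "isp \<rho> (INat c) = 0" "isp \<rho> IRows = 0" "isp \<rho> ICols = 0" "isp \<rho> IMsgs = 0"
  "isp \<rho> (IMsgLen a) = isp \<rho> a"
  "isp \<rho> (IMem a) = max (isp \<rho> a) (Suc (iv \<rho> a))" "isp \<rho> (IAdd a b) = max (isp \<rho> a) (isp \<rho> b)"
  "isp \<rho> (ISub a b) = max (isp \<rho> a) (isp \<rho> b)" "isp \<rho> (IMul a b) = max (isp \<rho> a) (isp \<rho> b)"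
  by (simp_all add: isp_def iv_def)

lemma iv_adr: "iv \<rho> (adr q i j) = 16 * (iv \<rho> i * D + iv \<rho> j) + q"
  by (simp add: adr_def D_eq)

lemma isp_adr: "isp \<rho> (adr q i j) = max (isp \<rho> i) (isp \<rho> j)"
  by (simp add: adr_def)

lemma cell_M: "i < R \<Longrightarrow> j < D \<Longrightarrow> q < 16 \<Longrightarrow> Suc (16 * (i * D + j) + q) \<le> M"
proof -
  assume "i < R" "j < D" "q < 16"
  then have "i * D + j < R * D" using cell_less by blast
  moreover have "Suc (16 * x + q) \<le> 16 * y" if "x < y" for x y :: nat
    using that \<open>q < 16\<close> by linarith
  ultimately show ?thesis using M_R le_trans by blast
qed

lemma unview_cell:
  assumes "q < 16" "j < D"
  shows "unview \<mu> (16 * (i * D + j) + q) = \<mu> q i j"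
proof -
  have "(16 * x + q) div 16 = x" "(16 * x + q) mod 16 = q" for x using assms(1) by presburger+
  then show ?thesis unfolding unview_def by (simp only:) (use assms(2) in simp)
qed

lemma view_fst: "view (\<rho>, snd s) = view s"
  by (simp only: view_def snd_conv)

lemma view_range: "\<not> (q < 16 \<and> i < R \<and> j < D) \<Longrightarrow> view s q i j = 0"
  by (auto simp: view_def)

lemma re_simps [simp]:
  "re \<rho> \<mu> (RReal c) = c" "re \<rho> \<mu> (RNat a) = real (iv \<rho> a)"
  "re \<rho> \<mu> (RAdd e f) = re \<rho> \<mu> e + re \<rho> \<mu> f" "re \<rho> \<mu> (RSub e f) = re \<rho> \<mu> e - re \<rho> \<mu> f"
  "re \<rho> \<mu> (RMul e f) = re \<rho> \<mu> e * re \<rho> \<mu> f" "re \<rho> \<mu> (RDiv e f) = re \<rho> \<mu> e / re \<rho> \<mu> f"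
  "re \<rho> \<mu> (RPow e v) = \<bar>re \<rho> \<mu> e\<bar> powr v"
  by (simp_all add: re_def ival_iv)

lemma re_RMsg [simp]: "re \<rho> \<mu> (RMsg a b) = (let i = iv \<rho> a; j = iv \<rho> b in
      if i < length (msgs_of \<iota>) \<and> j < length (msgs_of \<iota> ! i) then msgs_of \<iota> ! i ! j else 0)"
  by (simp add: re_def ival_iv)

lemma re_Cell: "q < 16 \<Longrightarrow> iv \<rho> j < D \<Longrightarrow> re \<rho> \<mu> (Cell q i j) = \<mu> q (iv \<rho> i) (iv \<rho> j)"
  by (simp only: re_def Cell_def rval.simps ival_iv iv_adr fst_conv snd_conv unview_cell)

lemma be_simps [simp]:
  "be \<rho> \<mu> (BLessI a b) = (iv \<rho> a < iv \<rho> b)" "be \<rho> \<mu> (BLessR e f) = (re \<rho> \<mu> e < re \<rho> \<mu> f)"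
  "be \<rho> \<mu> (BNot c) = (\<not> be \<rho> \<mu> c)" "be \<rho> \<mu> (BAnd c d) = (be \<rho> \<mu> c \<and> be \<rho> \<mu> d)"
  by (simp_all add: be_def re_def ival_iv)

lemma rok_simps [simp]:
  "rok \<rho> (RReal c)"
  "isp \<rho> a \<le> M \<Longrightarrow> rok \<rho> (RNat a)"
  "isp \<rho> a \<le> M \<Longrightarrow> isp \<rho> b \<le> M \<Longrightarrow> rok \<rho> (RMsg a b)"
  "rok \<rho> e \<Longrightarrow> rok \<rho> f \<Longrightarrow> rok \<rho> (RAdd e f)" "rok \<rho> e \<Longrightarrow> rok \<rho> f \<Longrightarrow> rok \<rho> (RSub e f)"
  "rok \<rho> e \<Longrightarrow> rok \<rho> f \<Longrightarrow> rok \<rho> (RMul e f)" "rok \<rho> e \<Longrightarrow> rok \<rho> f \<Longrightarrow> rok \<rho> (RDiv e f)"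
  "rok \<rho> e \<Longrightarrow> rok \<rho> (RPow e v)"
  by (simp_all add: rok_def ival_iv ispan_isp)

lemma rok_Cell [simp]:
  assumes "q < 16" "iv \<rho> i < R" "iv \<rho> j < D" "isp \<rho> i \<le> M" "isp \<rho> j \<le> M"
  shows "rok \<rho> (Cell q i j)"
  unfolding rok_def
proof (intro allI impI conjI)
  fix s :: store
  assume s: "fst s = \<rho>"
  show "rspan \<iota> s (Cell q i j) \<le> M"
    using assms s cell_M[of "iv \<rho> i" "iv \<rho> j" q] by (simp add: Cell_def ispan_isp ival_iv iv_adr isp_adr)
  have "rval \<iota> s (Cell q i j) = view s q (iv \<rho> i) (iv \<rho> j)"
    using assms s by (simp add: Cell_def ival_iv iv_adr view_def)
  with assms show "rval \<iota> s (Cell q i j) = re \<rho> (view s) (Cell q i j)" by (simp add: re_Cell)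
qed

lemma bok_simps [simp]:
  "isp \<rho> a \<le> M \<Longrightarrow> isp \<rho> b \<le> M \<Longrightarrow> bok \<rho> (BLessI a b)"
  "rok \<rho> e \<Longrightarrow> rok \<rho> f \<Longrightarrow> bok \<rho> (BLessR e f)"
  "bok \<rho> c \<Longrightarrow> bok \<rho> (BNot c)" "bok \<rho> c \<Longrightarrow> bok \<rho> d \<Longrightarrow> bok \<rho> (BAnd c d)"
  by (simp_all add: bok_def rok_def ival_iv ispan_isp)

lemma rok_span: "rok (fst s) e \<Longrightarrow> rspan \<iota> s e \<le> M"
  unfolding rok_def by blast

lemma rok_val: "rok (fst s) e \<Longrightarrow> rval \<iota> s e = re (fst s) (view s) e"
  unfolding rok_def by blast

lemma bok_span: "bok (fst s) e \<Longrightarrow> bspan \<iota> s e \<le> M"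
  unfolding bok_def by blast

lemma bok_val: "bok (fst s) e \<Longrightarrow> bval \<iota> s e = be (fst s) (view s) e"
  unfolding bok_def by blast

section \<open>Total correctness rules with time and space bounds\<close>

lemma runI: "exec \<iota> c s t m s' \<Longrightarrow> t \<le> tb W c \<Longrightarrow> m \<le> M \<Longrightarrow> P s' \<Longrightarrow> run c s P"
  unfolding run_def by blast

lemma runE:
  assumes "run c s P"
  obtains t m s' where "exec \<iota> c s t m s'" "t \<le> tb W c" "m \<le> M" "P s'"
  using assms unfolding run_def by blast

lemma run_weaken: "run c s P \<Longrightarrow> (\<And>s'. P s' \<Longrightarrow> Q s') \<Longrightarrow> run c s Q"
  unfolding run_def by blast

lemma run_Skip: "P s \<Longrightarrow> run Skip s P"
  by (rule runI[OF exec.Skip]) simp_all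

lemma run_Seq:
  assumes "run c s (\<lambda>s'. run c' s' P)"
  shows "run (Seq c c') s P"
proof -
  obtain t m s' where 1: "exec \<iota> c s t m s'" "t \<le> tb W c" "m \<le> M" "run c' s' P"
    using assms by (rule runE)
  obtain t' m' s'' where 2: "exec \<iota> c' s' t' m' s''" "t' \<le> tb W c'" "m' \<le> M" "P s''"
    using 1(4) by (rule runE)
  show ?thesis by (rule runI[OF exec.Seq[OF 1(1) 2(1)]]) (use 1 2 in auto)
qed

lemma run_AssignI:
  assumes "iv (fst s) a < M" "isp (fst s) a \<le> M" "isp (fst s) e \<le> M"
    "P ((fst s)(iv (fst s) a := iv (fst s) e), snd s)"
  shows "run (AssignI a e) s P"
  by (rule runI[OF exec.AssignI]) (use assms in \<open>auto simp: ival_iv ispan_isp\<close>)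

lemma run_AssignR:
  assumes "iv (fst s) a < M" "isp (fst s) a \<le> M" "rok (fst s) e"
    "P (fst s, (snd s)(iv (fst s) a := re (fst s) (view s) e))"
  shows "run (AssignR a e) s P"
  by (rule runI[OF exec.AssignR]) (use assms in \<open>auto simp: ival_iv ispan_isp rok_val rok_span\<close>)

lemma run_If:
  assumes "bok (fst s) b" "be (fst s) (view s) b \<Longrightarrow> run c s P" "\<not> be (fst s) (view s) b \<Longrightarrow> run c' s P"
  shows "run (If b c c') s P"
proof (cases "be (fst s) (view s) b")
  case True
  obtain t m s' where 1: "exec \<iota> c s t m s'" "t \<le> tb W c" "m \<le> M" "P s'"
    using assms(2)[OF True] by (rule runE)
  show ?thesis
    by (rule runI[OF exec.IfTrue[OF _ 1(1)]]) (use 1 True assms(1) in \<open>auto simp: bok_val bok_span\<close>)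
next
  case False
  obtain t m s' where 1: "exec \<iota> c' s t m s'" "t \<le> tb W c'" "m \<le> M" "P s'"
    using assms(3)[OF False] by (rule runE)
  show ?thesis
    by (rule runI[OF exec.IfFalse[OF _ 1(1)]]) (use 1 False assms(1) in \<open>auto simp: bok_val bok_span\<close>)
qed

text \<open>\<open>N\<close> is the exact number of iterations, so the invariant at \<open>N\<close>
  must refute the condition. The induction is on the iterations that remain; the last test accounts
  for the \<open>+ 1\<close> in the time bound.\<close>

lemma run_While:
  assumes "I 0 s" "N \<le> W"
    and step: "\<And>k s. k < N \<Longrightarrow> I k s \<Longrightarrow> bok (fst s) b \<and> be (fst s) (view s) b \<and> run c s (I (Suc k))"
    and stop: "\<And>s. I N s \<Longrightarrow> bok (fst s) b \<and> \<not> be (fst s) (view s) b \<and> P s"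
  shows "run (While b c) s P"
proof -
  have "\<exists>t m s'. exec \<iota> (While b c) s t m s' \<and> t \<le> (n + 1) * (1 + bcost b + tb W c) \<and> m \<le> M \<and> P s'"
    if "n \<le> N" "I (N - n) s" for n s
    using that
  proof (induction n arbitrary: s)
    case 0
    then have b: "bok (fst s) b" "\<not> be (fst s) (view s) b" "P s" using stop by auto
    show ?case
      by (intro exI conjI, rule exec.WhileFalse) (use b in \<open>auto simp: bok_val bok_span\<close>)
  next
    case (Suc n)
    then have "bok (fst s) b" "be (fst s) (view s) b" "run c s (I (Suc (N - Suc n)))"
      using step[of "N - Suc n" s] by auto
    moreover have "Suc (N - Suc n) = N - n" using Suc.prems by simp
    ultimately obtain t m s' where b: "bok (fst s) b" "be (fst s) (view s) b"
      and c: "exec \<iota> c s t m s'" "t \<le> tb W c" "m \<le> M" "I (N - n) s'" by (auto simp: run_def)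
    obtain t' m' s'' where w: "exec \<iota> (While b c) s' t' m' s''" "t' \<le> (n + 1) * (1 + bcost b + tb W c)" "m' \<le> M" "P s''"
      using Suc.IH[OF _ c(4)] Suc.prems by auto
    have "exec \<iota> (While b c) s (1 + bcost b + t + t') (max (bspan \<iota> s b) (max m m')) s''"
      by (rule exec.WhileTrue[OF _ c(1) w(1)]) (use b in \<open>simp add: bok_val\<close>)
    moreover have "1 + bcost b + t + t' \<le> (Suc n + 1) * (1 + bcost b + tb W c)"
      using c(2) w(2) by simp
    moreover have "max (bspan \<iota> s b) (max m m') \<le> M" using b c w by (simp add: bok_span)
    ultimately show ?case using w(4) by blast
  qed
  from this[of N s] assms(1) obtain t m s' where
    e: "exec \<iota> (While b c) s t m s'" "t \<le> (N + 1) * (1 + bcost b + tb W c)" "m \<le> M" "P s'" by auto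
  have "(N + 1) * (1 + bcost b + tb W c) \<le> tb W (While b c)"
    unfolding tb.simps using assms(2) by (intro mult_le_mono1) simp
  with e show ?thesis unfolding run_def by (meson order_trans)
qed

lemma run_For:
  assumes "r < 64" "N \<le> W" "I 0 ((fst s)(r := 0), snd s)"
    and bound: "\<And>k s. k \<le> N \<Longrightarrow> I k s \<Longrightarrow> fst s r = k \<Longrightarrow> iv (fst s) e = N \<and> isp (fst s) e \<le> M"
    and step: "\<And>k s. k < N \<Longrightarrow> I k s \<Longrightarrow> fst s r = k \<Longrightarrow>
        run c s (\<lambda>s'. fst s' r = k \<and> I (Suc k) ((fst s')(r := Suc k), snd s'))"
    and post: "\<And>s. I N s \<Longrightarrow> fst s r = N \<Longrightarrow> P s"
  shows "run (For r e c) s P"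
  unfolding For_def
proof (rule run_Seq, rule run_AssignI)
  have r: "r < M" using assms(1) M64 by simp
  show "run (While (BLessI (V r) e) (Seq c (SetI r (IAdd (V r) (INat 1)))))
     ((fst s)(iv (fst s) (INat r) := iv (fst s) (INat 0)), snd s) P"
  proof (rule run_While[where I = "\<lambda>k s. I k s \<and> fst s r = k" and N = N])
    fix k s assume k: "k < N" "I k s \<and> fst s r = k"
    have "run (Seq c (SetI r (IAdd (V r) (INat 1)))) s (\<lambda>s. I (Suc k) s \<and> fst s r = Suc k)"
    proof (rule run_Seq, rule run_weaken[OF step[of k s]])
      fix s' assume "fst s' r = k \<and> I (Suc k) ((fst s')(r := Suc k), snd s')"
      with r M64 show "run (SetI r (IAdd (V r) (INat 1))) s' (\<lambda>s. I (Suc k) s \<and> fst s r = Suc k)"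
        by (intro run_AssignI) auto
    qed (use k in auto)
    with k bound[of k s] r show "bok (fst s) (BLessI (V r) e) \<and> be (fst s) (view s) (BLessI (V r) e) \<and>
      run (Seq c (SetI r (IAdd (V r) (INat 1)))) s (\<lambda>s. I (Suc k) s \<and> fst s r = Suc k)"
      by simp
  next
    fix s assume k: "I N s \<and> fst s r = N"
    with bound[of N s] r post show "bok (fst s) (BLessI (V r) e) \<and> \<not> be (fst s) (view s) (BLessI (V r) e) \<and> P s"
      by simp
  qed (use assms in auto)
qed (use assms M64 in auto)

text \<open>Assertions see only the natural cells and the view. Loops that address raw real cells,
  as in \<open>LoadC\<close>, \<open>LeafC\<close> and the output of \<open>FinC\<close>, are
  treated with \<open>run\<close> instead.\<close>

definition wp :: "com \<Rightarrow> ((nat \<Rightarrow> nat) \<Rightarrow> mats \<Rightarrow> bool) \<Rightarrow> (nat \<Rightarrow> nat) \<Rightarrow> mats \<Rightarrow> bool" where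
  "wp c P \<rho> \<mu> \<longleftrightarrow> (\<forall>s. fst s = \<rho> \<and> view s = \<mu> \<longrightarrow> run c s (\<lambda>s'. P (fst s') (view s')))"

lemma wpD: "wp c P (fst s) (view s) \<Longrightarrow> run c s (\<lambda>s'. P (fst s') (view s'))"
  unfolding wp_def by blast

lemma wp_weaken: "wp c P \<rho> \<mu> \<Longrightarrow> (\<And>\<rho>' \<mu>'. P \<rho>' \<mu>' \<Longrightarrow> Q \<rho>' \<mu>') \<Longrightarrow> wp c Q \<rho> \<mu>"
  unfolding wp_def using run_weaken by (metis (no_types, lifting))

lemma wp_Skip: "P \<rho> \<mu> \<Longrightarrow> wp Skip P \<rho> \<mu>"
  unfolding wp_def by (auto intro: run_Skip)

lemma wp_Seq: "wp c (\<lambda>\<rho>' \<mu>'. wp c' P \<rho>' \<mu>') \<rho> \<mu> \<Longrightarrow> wp (Seq c c') P \<rho> \<mu>"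
  unfolding wp_def by (auto intro!: run_Seq elim!: run_weaken)

lemma wp_SetI:
  assumes "r < 64" "isp \<rho> e \<le> M" "P (\<rho>(r := iv \<rho> e)) \<mu>"
  shows "wp (SetI r e) P \<rho> \<mu>"
  unfolding wp_def
proof (intro allI impI run_AssignI; elim conjE)
  fix s :: store
  assume "fst s = \<rho>" "view s = \<mu>"
  then show "P (fst ((fst s)(iv (fst s) (INat r) := iv (fst s) e), snd s))
      (view ((fst s)(iv (fst s) (INat r) := iv (fst s) e), snd s))"
    using assms by (simp add: view_fst)
qed (use assms M64 in auto)

lemma view_upd:
  assumes "q < 16" "i < R" "j < D"
  shows "view (\<rho>, f(16 * (i * D + j) + q := v)) = upd3 (view (\<rho>, f)) q i j v"
  unfolding view_def upd3_def using assms cell_inj[of _ q _ D j _ i] by (auto simp: fun_eq_iff)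

lemma wp_SetA:
  assumes "q < 16" "iv \<rho> i < R" "iv \<rho> j < D" "isp \<rho> i \<le> M" "isp \<rho> j \<le> M" "rok \<rho> e"
    "P \<rho> (upd3 \<mu> q (iv \<rho> i) (iv \<rho> j) (re \<rho> \<mu> e))"
  shows "wp (SetA q i j e) P \<rho> \<mu>"
  unfolding wp_def SetA_def
proof (intro allI impI run_AssignR; elim conjE)
  fix s :: store
  assume s: "fst s = \<rho>" "view s = \<mu>"
  show "iv (fst s) (adr q i j) < M"
    using cell_M[OF assms(2,3,1)] s by (simp add: iv_adr Suc_le_eq)
  have "view (\<rho>, snd s) = \<mu>" using s by (simp add: view_fst)
  then show "P (fst (fst s, (snd s)(iv (fst s) (adr q i j) := re (fst s) (view s) e)))
     (view (fst s, (snd s)(iv (fst s) (adr q i j) := re (fst s) (view s) e)))"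
    using s assms by (simp add: iv_adr view_upd)
qed (use assms in \<open>auto simp: isp_adr\<close>)

lemma wp_If: "bok \<rho> b \<Longrightarrow> (be \<rho> \<mu> b \<Longrightarrow> wp c P \<rho> \<mu>) \<Longrightarrow> (\<not> be \<rho> \<mu> b \<Longrightarrow> wp c' P \<rho> \<mu>) \<Longrightarrow> wp (If b c c') P \<rho> \<mu>"
  unfolding wp_def by (auto intro!: run_If)

lemma wp_While:
  assumes "I 0 \<rho> \<mu>" "N \<le> W"
    and "\<And>k \<rho> \<mu>. k < N \<Longrightarrow> I k \<rho> \<mu> \<Longrightarrow> bok \<rho> b \<and> be \<rho> \<mu> b \<and> wp c (I (Suc k)) \<rho> \<mu>"
    and "\<And>\<rho> \<mu>. I N \<rho> \<mu> \<Longrightarrow> bok \<rho> b \<and> \<not> be \<rho> \<mu> b \<and> P \<rho> \<mu>"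
  shows "wp (While b c) P \<rho> \<mu>"
  unfolding wp_def
proof (intro allI impI, rule run_While[where I = "\<lambda>k s. I k (fst s) (view s)" and N = N])
  fix k s assume "k < N" "I k (fst s) (view s)"
  from assms(3)[OF this] show "bok (fst s) b \<and> be (fst s) (view s) b \<and> run c s (\<lambda>s. I (Suc k) (fst s) (view s))"
    by (auto intro: wpD)
qed (use assms in auto)

lemma wp_For:
  assumes "r < 64" "N \<le> W" "I 0 (\<rho>(r := 0)) \<mu>"
    and bound: "\<And>k \<rho> \<mu>. k \<le> N \<Longrightarrow> I k \<rho> \<mu> \<Longrightarrow> \<rho> r = k \<Longrightarrow> iv \<rho> e = N \<and> isp \<rho> e \<le> M"
    and step: "\<And>k \<rho> \<mu>. k < N \<Longrightarrow> I k \<rho> \<mu> \<Longrightarrow> \<rho> r = k \<Longrightarrow>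
        wp c (\<lambda>\<rho>' \<mu>'. \<rho>' r = k \<and> I (Suc k) (\<rho>'(r := Suc k)) \<mu>') \<rho> \<mu>"
    and post: "\<And>\<rho> \<mu>. I N \<rho> \<mu> \<Longrightarrow> \<rho> r = N \<Longrightarrow> P \<rho> \<mu>"
  shows "wp (For r e c) P \<rho> \<mu>"
  unfolding wp_def
proof (intro allI impI, rule run_For[where I = "\<lambda>k s. I k (fst s) (view s)" and N = N])
  fix k and s :: store assume "k < N" "I k (fst s) (view s)" "fst s r = k"
  from wpD[OF step[OF this]]
  show "run c s (\<lambda>s'. fst s' r = k \<and> I (Suc k) (fst ((fst s')(r := Suc k), snd s')) (view ((fst s')(r := Suc k), snd s')))"
    by (simp add: view_fst)
qed (use assms in \<open>auto simp: view_fst\<close>)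

text \<open>The summand is evaluated while the target cell holds a partial sum; hence its value is
  required for an arbitrary content \<open>v\<close> of that cell.\<close>

lemma wp_SumTo:
  assumes r: "r < 64" and N: "N \<le> W" and q: "q < 16" "ii < R" "jj < D"
    and i: "\<And>k. iv (\<rho>(r := k)) i = ii" "\<And>k. iv (\<rho>(r := k)) j = jj" "\<And>k. iv (\<rho>(r := k)) e = N"
    and sp: "\<And>k. isp (\<rho>(r := k)) i \<le> M" "\<And>k. isp (\<rho>(r := k)) j \<le> M" "\<And>k. isp (\<rho>(r := k)) e \<le> M"
    and f: "\<And>k v. k < N \<Longrightarrow> rok (\<rho>(r := k)) f \<and> re (\<rho>(r := k)) (upd3 \<mu> q ii jj v) f = g k"
    and P: "P (\<rho>(r := N)) (upd3 \<mu> q ii jj (\<Sum>k<N. g k))"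
  shows "wp (SumTo q i j r e f) P \<rho> \<mu>"
  unfolding SumTo_def
proof (rule wp_Seq, rule wp_SetA)
  have i': "iv \<rho> i = ii" "iv \<rho> j = jj" "isp \<rho> i \<le> M" "isp \<rho> j \<le> M"
    using i(1,2)[of "\<rho> r"] sp(1,2)[of "\<rho> r"] by auto
  then show "iv \<rho> i < R" "iv \<rho> j < D" "isp \<rho> i \<le> M" "isp \<rho> j \<le> M" using q by auto
  show "wp (For r e (SetA q i j (RAdd (Cell q i j) f))) P \<rho> (upd3 \<mu> q (iv \<rho> i) (iv \<rho> j) (re \<rho> \<mu> (RReal 0)))"
  proof (rule wp_For[where N = N and I = "\<lambda>n \<rho>' \<mu>'. \<rho>' = \<rho>(r := n) \<and> \<mu>' = upd3 \<mu> q ii jj (\<Sum>k<n. g k)"])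
    fix k \<rho>' \<mu>' assume k: "k < N" "\<rho>' = \<rho>(r := k) \<and> \<mu>' = upd3 \<mu> q ii jj (\<Sum>k<k. g k)" "\<rho>' r = k"
    have u: "upd3 (upd3 \<mu> q ii jj a) q ii jj b = upd3 \<mu> q ii jj b" for a b
      by (auto simp: upd3_def fun_eq_iff)
    have Cell: "re (\<rho>(r := k)) (upd3 \<mu> q ii jj v) (Cell q i j) = v" for v
      using re_Cell[of q "\<rho>(r := k)" j "upd3 \<mu> q ii jj v" i] i(1,2)[of k] q by (simp add: upd3_def)
    show "wp (SetA q i j (RAdd (Cell q i j) f)) (\<lambda>\<rho>' \<mu>'. \<rho>' r = k \<and> \<rho>'(r := Suc k) = \<rho>(r := Suc k) \<and>
        \<mu>' = upd3 \<mu> q ii jj (\<Sum>k<Suc k. g k)) \<rho>' \<mu>'"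
      using k q i[of k] sp[of k] f[OF k(1)]
      by (intro wp_SetA) (auto simp: u Cell)
  qed (use assms i' in auto)
qed (use q in auto)

text \<open>A snapshot inside the double loop: \<open>n\<close> rows and \<open>k\<close> entries of
  the next row are written. The expression is evaluated in this state because it may read the matrix
  being filled, as when a row is added to slot \<open>0\<close> in \<open>InsC\<close>.\<close>

definition fillmem :: "mats \<Rightarrow> nat \<Rightarrow> nat \<Rightarrow> form \<Rightarrow> nat \<Rightarrow> nat \<Rightarrow> mats" where
  "fillmem \<mu> q b g n k = (\<lambda>q' i' j'. if q' = q \<and> (b \<le> i' \<and> i' < b + n \<and> j' < D \<or> i' = b + n \<and> j' < k)
     then g (i' - b) j' else \<mu> q' i' j' :: real)"

lemma wp_Fill:
  assumes q: "q < 16" "b + D \<le> R"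
    and base: "\<And>\<rho>'. agree {11, 12} \<rho> \<rho>' \<Longrightarrow> iv \<rho>' base = b \<and> isp \<rho>' base \<le> M"
    and f: "\<And>\<rho>' n k. agree {11, 12} \<rho> \<rho>' \<Longrightarrow> n < D \<Longrightarrow> k < D \<Longrightarrow> \<rho>' 11 = n \<Longrightarrow> \<rho>' 12 = k \<Longrightarrow>
       rok \<rho>' f \<and> re \<rho>' (fillmem \<mu> q b g n k) f = g n k"
    and P: "\<And>\<rho>'. agree {11, 12} \<rho> \<rho>' \<Longrightarrow> P \<rho>' (fillmem \<mu> q b g D 0)"
  shows "wp (Fill q base f) P \<rho> \<mu>"
  unfolding Fill_def
proof (rule wp_For[where N = D and I = "\<lambda>n \<rho>' \<mu>'. agree {11, 12} \<rho> \<rho>' \<and> \<mu>' = fillmem \<mu> q b g n 0"])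
  show "agree {11, 12} \<rho> (\<rho>(11 := 0)) \<and> \<mu> = fillmem \<mu> q b g 0 0"
    by (auto simp: agree_def fillmem_def fun_eq_iff)
  fix n \<rho>1 \<mu>1
  assume n: "n < D" "agree {11, 12} \<rho> \<rho>1 \<and> \<mu>1 = fillmem \<mu> q b g n 0" "\<rho>1 11 = n"
  show "wp (For 12 De (SetA q (IAdd base (V 11)) (V 12) f))
     (\<lambda>\<rho>' \<mu>'. \<rho>' 11 = n \<and> agree {11, 12} \<rho> (\<rho>'(11 := Suc n)) \<and> \<mu>' = fillmem \<mu> q b g (Suc n) 0) \<rho>1 \<mu>1"
  proof (rule wp_For[where N = D and I = "\<lambda>k \<rho>' \<mu>'. agree {11, 12} \<rho> \<rho>' \<and> \<rho>' 11 = n \<and> \<mu>' = fillmem \<mu> q b g n k"])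
    fix k \<rho>2 \<mu>2
    assume k: "k < D" "agree {11, 12} \<rho> \<rho>2 \<and> \<rho>2 11 = n \<and> \<mu>2 = fillmem \<mu> q b g n k" "\<rho>2 12 = k"
    have u: "upd3 (fillmem \<mu> q b g n k) q (b + n) k (g n k) = fillmem \<mu> q b g n (Suc k)"
      by (auto simp: upd3_def fillmem_def fun_eq_iff less_Suc_eq)
    show "wp (SetA q (IAdd base (V 11)) (V 12) f)
       (\<lambda>\<rho>' \<mu>'. \<rho>' 12 = k \<and> agree {11, 12} \<rho> (\<rho>'(12 := Suc k)) \<and> (\<rho>'(12 := Suc k)) 11 = n \<and>
           \<mu>' = fillmem \<mu> q b g n (Suc k)) \<rho>2 \<mu>2"
      using k n(1) base[of \<rho>2] f[of \<rho>2 n k] q M64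
      by (intro wp_SetA) (auto simp: u agree_upd)
  next
    fix \<rho>2 \<mu>2
    assume k: "agree {11, 12} \<rho> \<rho>2 \<and> \<rho>2 11 = n \<and> \<mu>2 = fillmem \<mu> q b g n D" "\<rho>2 12 = D"
    have "fillmem \<mu> q b g n D = fillmem \<mu> q b g (Suc n) 0"
      by (auto simp: fillmem_def fun_eq_iff less_Suc_eq)
    with k show "\<rho>2 11 = n \<and> agree {11, 12} \<rho> (\<rho>2(11 := Suc n)) \<and> \<mu>2 = fillmem \<mu> q b g (Suc n) 0"
      by (auto simp: agree_upd)
  qed (use n D_W in \<open>auto simp: agree_upd D_eq\<close>)
qed (use P D_W in \<open>auto simp: D_eq\<close>)

end

section \<open>The merging program\<close>

text \<open>
  Matrix 0 consists of \<open>D \<times> D\<close> blocks (slots) that hold one form each. Matrix 1 is the form to be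
  inserted next, 2 the current form of the merging iteration, 3 and 4 are \<open>gsG\<close> and \<open>gsH\<close>, 5 sums up
  the forms of all rounds, 6 holds the weights, 7 the number of occupied slots of each level, 10 a
  row; 8 and 9 hold scalars. Natural cells: 1 is \<open>B\<close>, 2 the total number of slots, 3 the
  level, 4 the carry flag, 5 the position in the level, 6 and 7 the first slot and the number
  of slots to be merged. Nothing but the real memory has to survive from one row to the next.
\<close>

definition GSc :: com where
  "GSc = For 10 De (Seq
     (For 11 De (Seq
       (SumTo 3 (V 10) (V 11) 12 (V 10) (RMul (RDiv (Cell 4 (V 12) (V 10)) (Cell 4 (V 12) (V 12))) (Cell 3 (V 12) (V 11))))
       (SetA 3 (V 10) (V 11) (RSub (RNat (ISub (INat 1) (IAdd (ISub (V 11) (V 10)) (ISub (V 10) (V 11)))))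
         (Cell 3 (V 10) (V 11))))))
     (For 11 De (SumTo 4 (V 10) (V 11) 12 De (RMul (Cell 2 (V 11) (V 12)) (Cell 3 (V 10) (V 12))))))"

definition slotE :: rexp where
  "slotE = Cell 0 (IAdd (IMul (IAdd (V 6) (V 9)) De) (V 11)) (V 12)"

definition TauC :: com where
  "TauC = Seq (SetA 8 (INat 0) (INat 0) (RReal 0)) (For 10 De (Seq (SetA 9 (INat 0) (INat 0) (RReal 0)) (Seq
     (For 11 De (For 12 De (SetA 9 (INat 0) (INat 0) (RAdd (Cell 9 (INat 0) (INat 0))
       (RMul (RMul (Cell 3 (V 10) (V 11)) slotE) (Cell 3 (V 10) (V 12)))))))
     (SetA 8 (INat 0) (INat 0) (RAdd (Cell 8 (INat 0) (INat 0)) (RDiv (Cell 9 (INat 0) (INat 0)) (Cell 4 (V 10) (V 10))))))))"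

text \<open>Since \<open>p\<close> is fixed, the outer case distinction is made when the program is
  built, not when it runs.\<close>

definition UpdW :: "real \<Rightarrow> com" where
  "UpdW p = (if 2 < p then SetA 6 (V 9) (INat 0) (RMul (RPow (Cell 6 (V 9) (INat 0)) (1 - 2 / p)) (Cell 8 (INat 0) (INat 0)))
     else If (BAnd (BLessR (Cell 8 (INat 0) (INat 0)) (RPow (RDiv (Cell 6 (V 9) (INat 0)) (RReal 2)) (2 / p)))
                   (BLessR (RDiv (RReal 2) (RNat (V 7))) (Cell 6 (V 9) (INat 0))))
       (SetA 6 (V 9) (INat 0) (RDiv (Cell 6 (V 9) (INat 0)) (RReal 2))) Skip)"

definition Qc :: "real \<Rightarrow> com" where
  "Qc p = For 11 De (For 12 De (Seq
     (SumTo 2 (V 11) (V 12) 9 (V 7) (RMul (RPow (Cell 6 (V 9) (INat 0)) (1 - 2 / p)) slotE))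
     (SetA 5 (V 11) (V 12) (RAdd (Cell 5 (V 11) (V 12)) (Cell 2 (V 11) (V 12))))))"

definition roundsE :: iexp where
  "roundsE = IMul (IMul (INat 2) (V 7)) (V 7)"

definition Red :: "real \<Rightarrow> com" where
  "Red p = Seq (For 9 (V 7) (SetA 6 (V 9) (INat 0) (RReal 1))) (Seq (Fill 5 (INat 0) (RReal 0)) (Seq
     (For 8 roundsE (Seq (Qc p) (Seq GSc (For 9 (V 7) (Seq TauC (UpdW p))))))
     (Fill 1 (INat 0) (RDiv (Cell 5 (V 11) (V 12)) (RNat roundsE)))))"

context ram
begin

declare D_eq [symmetric, simp]

text \<open>A snapshot of the Gram-Schmidt loop: \<open>k\<close> rows of both matrices are
  finished, and \<open>g\<close> and \<open>h\<close> entries of the current ones.\<close>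

definition gsmem :: "mats \<Rightarrow> form \<Rightarrow> nat \<Rightarrow> nat \<Rightarrow> nat \<Rightarrow> mats" where
  "gsmem \<mu> Q k g h = (\<lambda>q i j. if q = 3 \<and> j < D \<and> (i < k \<or> i = k \<and> j < g) then gsG D Q i j
     else if q = 4 \<and> j < D \<and> (i < k \<or> i = k \<and> j < h) then gsH D Q i j else \<mu> q i j)"

lemma upd3_upd3 [simp]: "upd3 (upd3 \<mu> q i j v) q i j v' = upd3 \<mu> q i j v'"
  by (auto simp: upd3_def fun_eq_iff)

lemma upd3_same [simp]: "upd3 \<mu> q i j v q i j = v"
  by (simp add: upd3_def)

lemma gsmem_G: "k < D \<Longrightarrow> a < D \<Longrightarrow> upd3 (gsmem \<mu> Q k a 0) 3 k a (gsG D Q k a) = gsmem \<mu> Q k (Suc a) 0"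
  by (auto simp: upd3_def gsmem_def fun_eq_iff less_Suc_eq)

lemma gsmem_H: "k < D \<Longrightarrow> a < D \<Longrightarrow> upd3 (gsmem \<mu> Q k D a) 4 k a (gsH D Q k a) = gsmem \<mu> Q k D (Suc a)"
  by (auto simp: upd3_def gsmem_def fun_eq_iff less_Suc_eq)

lemma gsmem_Suc: "gsmem \<mu> Q k D D = gsmem \<mu> Q (Suc k) 0 0"
  by (auto simp: gsmem_def fun_eq_iff less_Suc_eq)

lemma gsmem_0: "gsmem \<mu> Q 0 0 0 = \<mu>"
  by (auto simp: gsmem_def fun_eq_iff)

lemma wp_GS:
  assumes Q: "\<And>a b. a < D \<Longrightarrow> b < D \<Longrightarrow> \<mu> 2 a b = Q a b"
    and P: "\<And>\<rho>'. agree {10, 11, 12} \<rho> \<rho>' \<Longrightarrow> P \<rho>' (gsmem \<mu> Q D 0 0)"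
  shows "wp GSc P \<rho> \<mu>"
  unfolding GSc_def
proof (rule wp_For[where N = D and I = "\<lambda>k \<rho>' \<mu>'. agree {10, 11, 12} \<rho> \<rho>' \<and> \<mu>' = gsmem \<mu> Q k 0 0"], goal_cases)
  case k: (5 k \<rho>1 \<mu>1)
  have kR: "k < R" using k(1) D_R by simp
  show ?case
  proof (rule wp_Seq, rule wp_For[where N = D and
        I = "\<lambda>a \<rho>' \<mu>'. agree {10, 11, 12} \<rho> \<rho>' \<and> \<rho>' 10 = k \<and> \<mu>' = gsmem \<mu> Q k a 0"], goal_cases)
    case a: (5 a \<rho>2 \<mu>2)
    have d: "real (Suc 0 - (a - k + (k - a))) = (if a = k then 1 else 0)" by auto
    show ?case
    proof (rule wp_Seq, rule wp_SumTo[where N = k and ii = k and jj = a and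
          g = "\<lambda>j. gsH D Q j k / gsH D Q j j * gsG D Q j a"])
      fix j v assume "j < k"
      then show "rok (\<rho>2(12 := j)) (RMul (RDiv (Cell 4 (V 12) (V 10)) (Cell 4 (V 12) (V 12))) (Cell 3 (V 12) (V 11))) \<and>
        re (\<rho>2(12 := j)) (upd3 \<mu>2 3 k a v) (RMul (RDiv (Cell 4 (V 12) (V 10)) (Cell 4 (V 12) (V 12))) (Cell 3 (V 12) (V 11)))
         = gsH D Q j k / gsH D Q j j * gsG D Q j a"
        using a k kR M64 by (simp add: re_Cell upd3_def gsmem_def)
    next
      show "wp (SetA 3 (V 10) (V 11) (RSub (RNat (ISub (INat 1) (IAdd (ISub (V 11) (V 10)) (ISub (V 10) (V 11)))))
         (Cell 3 (V 10) (V 11)))) (\<lambda>\<rho>' \<mu>'. \<rho>' 11 = a \<and> agree {10, 11, 12} \<rho> (\<rho>'(11 := Suc a)) \<and> (\<rho>'(11 := Suc a)) 10 = k \<and>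
          \<mu>' = gsmem \<mu> Q k (Suc a) 0) (\<rho>2(12 := k)) (upd3 \<mu>2 3 k a (\<Sum>j<k. gsH D Q j k / gsH D Q j j * gsG D Q j a))"
        using a k kR M64 gsmem_G[of k a \<mu> Q]
        by (intro wp_SetA) (simp_all add: re_Cell agree_upd d gsG_eq[of D Q k a])
    qed (use a k kR D_W M64 in auto)
  next
    case a: (6 \<rho>2 \<mu>2)
    show ?case
    proof (rule wp_For[where N = D and
        I = "\<lambda>a \<rho>' \<mu>'. agree {10, 11, 12} \<rho> \<rho>' \<and> \<rho>' 10 = k \<and> \<mu>' = gsmem \<mu> Q k D a"], goal_cases)
      case a: (5 a \<rho>3 \<mu>3)
      show ?case
      proof (rule wp_SumTo[where N = D and ii = k and jj = a and g = "\<lambda>b. Q a b * gsG D Q k b"])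
        fix b v assume "b < D"
        then show "rok (\<rho>3(12 := b)) (RMul (Cell 2 (V 11) (V 12)) (Cell 3 (V 10) (V 12))) \<and>
          re (\<rho>3(12 := b)) (upd3 \<mu>3 4 k a v) (RMul (Cell 2 (V 11) (V 12)) (Cell 3 (V 10) (V 12))) = Q a b * gsG D Q k b"
          using a k kR M64 Q D_R by (simp add: re_Cell upd3_def gsmem_def)
      next
        show "(\<rho>3(12 := D)) 11 = a \<and> agree {10, 11, 12} \<rho> ((\<rho>3(12 := D))(11 := Suc a)) \<and>
          ((\<rho>3(12 := D))(11 := Suc a)) 10 = k \<and>
          upd3 \<mu>3 4 k a (\<Sum>b<D. Q a b * gsG D Q k b) = gsmem \<mu> Q k D (Suc a)"
          using a k gsmem_H[of k a \<mu> Q] by (simp add: agree_upd gsH_def)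
      qed (use a k kR D_W M64 in auto)
    qed (use a k D_W M64 in \<open>auto simp: agree_upd gsmem_Suc\<close>)
  qed (use k D_W M64 in \<open>auto simp: agree_upd\<close>)
qed (use P D_W M64 in \<open>auto simp: agree_upd agree_refl gsmem_0\<close>)

definition taumem :: "mats \<Rightarrow> real \<Rightarrow> real \<Rightarrow> mats" where
  "taumem \<mu> t s = upd3 (upd3 \<mu> 9 0 0 t) 8 0 0 s"

lemma taumem_upd: "upd3 (taumem \<mu> t s) 9 0 0 t' = taumem \<mu> t' s" "upd3 (taumem \<mu> t s) 8 0 0 s' = taumem \<mu> t s'"
  by (auto simp: taumem_def upd3_def fun_eq_iff)

lemma taumem_simps: "taumem \<mu> t s 8 0 0 = s" "taumem \<mu> t s 9 0 0 = t" "q \<noteq> 8 \<Longrightarrow> q \<noteq> 9 \<Longrightarrow> taumem \<mu> t s q = \<mu> q"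
  by (auto simp: taumem_def upd3_def fun_eq_iff)

lemma R0: "0 < R" using D0 D_R by simp

lemma wp_Tau:
  assumes G: "\<And>k a. k < D \<Longrightarrow> a < D \<Longrightarrow> \<mu> 3 k a = gsG D Q k a"
    and H: "\<And>k. k < D \<Longrightarrow> \<mu> 4 k k = gsH D Q k k"
    and F: "\<And>a b. a < D \<Longrightarrow> b < D \<Longrightarrow> \<mu> 0 ((\<rho> 6 + \<rho> 9) * D + a) b = F a b"
    and s: "(\<rho> 6 + \<rho> 9) * D + D \<le> R"
    and P: "\<And>\<rho>' t. agree {10, 11, 12} \<rho> \<rho>' \<Longrightarrow> P \<rho>' (taumem \<mu> t (tau D Q F))"
  shows "wp TauC P \<rho> \<mu>"
  unfolding TauC_def
proof (rule wp_Seq, rule wp_SetA)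
  have R: "(\<rho> 6 + \<rho> 9) * D + a < R" "a < R" if "a < D" for a using s that by auto
  let ?T = "\<lambda>k. \<Sum>kk<k. qf D F (gsG D Q kk) / gsH D Q kk kk"
  have slot: "rok \<rho>' slotE" "re \<rho>' (taumem \<mu> t s) slotE = F (\<rho>' 11) (\<rho>' 12)"
    if "agree {10, 11, 12} \<rho> \<rho>'" "\<rho>' 11 < D" "\<rho>' 12 < D" for \<rho>' t s
    using that M64 R F by (simp_all add: slotE_def re_Cell taumem_simps agree_def)
  show "wp (For 10 De (Seq (SetA 9 (INat 0) (INat 0) (RReal 0)) (Seq
     (For 11 De (For 12 De (SetA 9 (INat 0) (INat 0) (RAdd (Cell 9 (INat 0) (INat 0))
       (RMul (RMul (Cell 3 (V 10) (V 11)) slotE) (Cell 3 (V 10) (V 12)))))))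
     (SetA 8 (INat 0) (INat 0) (RAdd (Cell 8 (INat 0) (INat 0)) (RDiv (Cell 9 (INat 0) (INat 0)) (Cell 4 (V 10) (V 10))))))))
     P \<rho> (upd3 \<mu> 8 (iv \<rho> (INat 0)) (iv \<rho> (INat 0)) (re \<rho> \<mu> (RReal 0)))"
  proof (rule wp_For[where N = D and I = "\<lambda>k \<rho>' \<mu>'. agree {10, 11, 12} \<rho> \<rho>' \<and> (\<exists>t. \<mu>' = taumem \<mu> t (?T k))"], goal_cases)
    have "upd3 \<mu> 8 0 0 0 = taumem \<mu> (\<mu> 9 0 0) 0" by (auto simp: taumem_def upd3_def fun_eq_iff)
    then show "agree {10, 11, 12} \<rho> (\<rho>(10 := 0)) \<and>
      (\<exists>t. upd3 \<mu> 8 (iv \<rho> (INat 0)) (iv \<rho> (INat 0)) (re \<rho> \<mu> (RReal 0)) = taumem \<mu> t (?T 0))"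
      by (auto simp: agree_refl agree_upd)
    case k: (5 k \<rho>1 \<mu>1)
    let ?post = "\<lambda>\<rho>' \<mu>'. \<rho>' 10 = k \<and> agree {10, 11, 12} \<rho> (\<rho>'(10 := Suc k)) \<and> (\<exists>t. \<mu>' = taumem \<mu> t (?T (Suc k)))"
    let ?g = "\<lambda>a b. gsG D Q k a * F a b * gsG D Q k b"
    show ?case
    proof (rule wp_Seq, rule wp_SetA, goal_cases)
      case 7
      show ?case
      proof (rule wp_Seq, rule wp_For[where N = D and I = "\<lambda>a \<rho>' \<mu>'. agree {10, 11, 12} \<rho> \<rho>' \<and> \<rho>' 10 = k \<and>
           \<mu>' = taumem \<mu> (\<Sum>a'<a. \<Sum>b<D. ?g a' b) (?T k)"], goal_cases)
        case a: (5 a \<rho>2 \<mu>2)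
        show ?case
        proof (rule wp_For[where N = D and I = "\<lambda>b \<rho>' \<mu>'. agree {10, 11, 12} \<rho> \<rho>' \<and> \<rho>' 10 = k \<and> \<rho>' 11 = a \<and>
           \<mu>' = taumem \<mu> ((\<Sum>a'<a. \<Sum>b<D. ?g a' b) + (\<Sum>b'<b. ?g a b')) (?T k)"], goal_cases)
          case b: (5 b \<rho>3 \<mu>3)
          show ?case
            using a(1) b k(1) slot[of \<rho>3] D0 R0 R(2) M64 G
            by (intro wp_SetA) (simp_all add: re_Cell taumem_upd taumem_simps agree_upd algebra_simps)
        qed (use a k D_W M64 in \<open>auto simp: agree_upd\<close>)
      next
        case a: (6 \<rho>2 \<mu>2)
        have e: "(\<Sum>a'<D. \<Sum>b<D. ?g a' b) = qf D F (gsG D Q k)" by (simp add: qf_def bf_def)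
        show ?case
          using a k(1) D0 R0 R(2) M64 H unfolding e
          by (intro wp_SetA) (auto simp: re_Cell taumem_upd taumem_simps agree_upd)
      qed (use k D_W M64 in \<open>auto simp: agree_upd taumem_upd\<close>)
    qed (use k D0 R0 in auto)
  qed (use P D_W M64 in \<open>auto simp: agree_upd tau_def\<close>)
qed (use D0 R0 in auto)

text \<open>\<open>RPow\<close> takes absolute values; program and \<open>wstep\<close> agree
  because weights are nonnegative.\<close>

lemma wp_UpdW:
  assumes "\<rho> 9 < R" "0 \<le> \<mu> 6 (\<rho> 9) 0" "P \<rho> (upd3 \<mu> 6 (\<rho> 9) 0 (wstep p (\<rho> 7) (\<mu> 6 (\<rho> 9) 0) (\<mu> 8 0 0)))"
  shows "wp (UpdW p) P \<rho> \<mu>"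
proof (cases "2 < p")
  case True
  then show ?thesis
    using assms D0 R0 M64 unfolding UpdW_def by (auto intro!: wp_SetA simp: re_Cell wstep_def)
next
  case False
  have "upd3 \<mu> 6 (\<rho> 9) 0 (\<mu> 6 (\<rho> 9) 0) = \<mu>" by (auto simp: upd3_def fun_eq_iff)
  then show ?thesis
    using assms D0 R0 M64 False unfolding UpdW_def
    by (auto intro!: wp_If wp_SetA wp_Skip simp: re_Cell wstep_def)
qed

definition qmem :: "mats \<Rightarrow> form \<Rightarrow> nat \<Rightarrow> nat \<Rightarrow> mats" where
  "qmem \<mu> Q n k = (\<lambda>q i j. if q = 2 \<and> (i < n \<and> j < D \<or> i = n \<and> j < k) then Q i j
     else if q = 5 \<and> (i < n \<and> j < D \<or> i = n \<and> j < k) then \<mu> 5 i j + Q i j else \<mu> q i j :: real)"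

lemma qmem_0: "qmem \<mu> Q 0 0 = \<mu>"
  by (auto simp: qmem_def fun_eq_iff)

lemma wp_Qc:
  assumes F: "\<And>j a b. j < m \<Longrightarrow> a < D \<Longrightarrow> b < D \<Longrightarrow> \<mu> 0 ((\<rho> 6 + j) * D + a) b = F j a b"
    and w: "\<And>j. j < m \<Longrightarrow> \<mu> 6 j 0 = w j \<and> 0 \<le> w j"
    and m: "\<rho> 7 = m" "(\<rho> 6 + m) * D \<le> R" "m \<le> W"
    and P: "\<And>\<rho>'. agree {9, 11, 12} \<rho> \<rho>' \<Longrightarrow> P \<rho>' (qmem \<mu> (wform p m F w) D 0)"
  shows "wp (Qc p) P \<rho> \<mu>"
  unfolding Qc_def
proof (rule wp_For[where N = D and I = "\<lambda>n \<rho>' \<mu>'. agree {9, 11, 12} \<rho> \<rho>' \<and> \<mu>' = qmem \<mu> (wform p m F w) n 0"], goal_cases)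
  let ?Q = "wform p m F w"
  have R: "(\<rho> 6 + j) * D + a < R" "j < R" if "j < m" "a < D" for j a
  proof -
    have "(\<rho> 6 + j) * D + a < (\<rho> 6 + m) * D" using cell_less[of "\<rho> 6 + j" "\<rho> 6 + m" a D] that by simp
    then show "(\<rho> 6 + j) * D + a < R" using m(2) by simp
    have "j * 1 < (\<rho> 6 + m) * D"
      using that D0 by (intro mult_less_le_imp_less) auto
    then show "j < R" using m(2) by simp
  qed
  case n: (5 n \<rho>1 \<mu>1)
  show ?case
  proof (rule wp_For[where N = D and I = "\<lambda>k \<rho>' \<mu>'. agree {9, 11, 12} \<rho> \<rho>' \<and> \<rho>' 11 = n \<and> \<mu>' = qmem \<mu> ?Q n k"], goal_cases)
    case k: (5 k \<rho>2 \<mu>2)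
    have r: "\<rho>2 7 = m" "\<rho>2 6 = \<rho> 6" using k(2) m(1) by (auto simp: agree_def)
    let ?post = "\<lambda>\<rho>' \<mu>'. \<rho>' 12 = k \<and> agree {9, 11, 12} \<rho> (\<rho>'(12 := Suc k)) \<and> (\<rho>'(12 := Suc k)) 11 = n \<and>
           \<mu>' = qmem \<mu> ?Q n (Suc k)"
    show ?case
    proof (rule wp_Seq, rule wp_SumTo[where N = m and ii = n and jj = k and g = "\<lambda>j. w j powr (1 - 2 / p) * F j n k"])
      fix j v assume j: "j < m"
      show "rok (\<rho>2(9 := j)) (RMul (RPow (Cell 6 (V 9) (INat 0)) (1 - 2 / p)) slotE) \<and>
        re (\<rho>2(9 := j)) (upd3 \<mu>2 2 n k v) (RMul (RPow (Cell 6 (V 9) (INat 0)) (1 - 2 / p)) slotE) = w j powr (1 - 2 / p) * F j n k"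
        using j k n(1) r M64 D0 R[OF j n(1)] w[OF j] F[OF j n(1) k(1)]
        by (simp add: slotE_def re_Cell upd3_def qmem_def)
    next
      have e: "upd3 (upd3 (qmem \<mu> ?Q n k) 2 n k (?Q n k)) 5 n k (\<mu> 5 n k + ?Q n k) = qmem \<mu> ?Q n (Suc k)"
        by (auto simp: upd3_def qmem_def fun_eq_iff less_Suc_eq)
      have e': "(\<Sum>j<m. w j powr (1 - 2 / p) * F j n k) = ?Q n k" by (simp add: wform_def)
      have e'': "upd3 (qmem \<mu> ?Q n k) 2 n k v 5 n k = \<mu> 5 n k" for v by (simp add: upd3_def qmem_def)
      show "wp (SetA 5 (V 11) (V 12) (RAdd (Cell 5 (V 11) (V 12)) (Cell 2 (V 11) (V 12)))) ?post (\<rho>2(9 := m))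
        (upd3 \<mu>2 2 n k (\<Sum>j<m. w j powr (1 - 2 / p) * F j n k))"
        using k n(1) M64 D_R unfolding e'
        by (intro wp_SetA) (simp_all add: re_Cell e e'' agree_upd fun_upd_twist[of 9])
    qed (use k n r D_R M64 m in auto)
  next
    have "qmem \<mu> ?Q n D = qmem \<mu> ?Q (Suc n) 0" by (auto simp: qmem_def fun_eq_iff less_Suc_eq)
    moreover fix \<rho>2 \<mu>2
    assume k: "agree {9, 11, 12} \<rho> \<rho>2 \<and> \<rho>2 11 = n \<and> \<mu>2 = qmem \<mu> ?Q n D" "\<rho>2 12 = D"
    ultimately show "\<rho>2 11 = n \<and> agree {9, 11, 12} \<rho> (\<rho>2(11 := Suc n)) \<and> \<mu>2 = qmem \<mu> ?Q (Suc n) 0"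
      by (auto simp: agree_upd)
  qed (use n D_W in \<open>auto simp: agree_upd\<close>)
qed (use P D_W in \<open>auto simp: agree_upd agree_refl qmem_0\<close>)

lemma wp_Red:
  fixes \<rho> \<mu> and p :: real and m :: nat
  defines "F \<equiv> \<lambda>j a b. \<mu> 0 ((\<rho> 6 + j) * D + a) b"
  assumes p: "1 \<le> p" "p \<noteq> 2" and psdF: "\<And>j. j < m \<Longrightarrow> psd D (F j)"
    and m: "0 < m" "\<rho> 7 = m" "(\<rho> 6 + m) * D \<le> R" "2 * m * m \<le> W"
    and P: "\<And>\<rho>' \<mu>'. agree {8, 9, 10, 11, 12} \<rho> \<rho>' \<Longrightarrow>
      (\<And>q. q \<notin> {1, 2, 3, 4, 5, 6, 8, 9} \<Longrightarrow> \<mu>' q = \<mu> q) \<Longrightarrow>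
      (\<And>a b. a < D \<Longrightarrow> b < D \<Longrightarrow> \<mu>' 1 a b = wavg p D m F a b) \<Longrightarrow> P \<rho>' \<mu>'"
  shows "wp (Red p) P \<rho> \<mu>"
proof -
  interpret merging p D m F
    using p D0 m psdF by unfold_locales auto
  let ?X = "{8, 9, 10, 11, 12} :: nat set" and ?Y = "{1, 2, 3, 4, 5, 6, 8, 9} :: nat set"
  have Rj: "j < R" if "j < m" for j
  proof -
    have "j * 1 < (\<rho> 6 + m) * D" using that D0 by (intro mult_less_le_imp_less) auto
    then show ?thesis using m(3) by simp
  qed
  have RF: "(\<rho> 6 + j) * D + D \<le> R" if "j < m" for j
  proof -
    have "(\<rho> 6 + j) * D + D = (\<rho> 6 + Suc j) * D" by simp
    also have "\<dots> \<le> (\<rho> 6 + m) * D" using that by (intro mult_le_mono1) simp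
    finally show ?thesis using m(3) by simp
  qed
  have "m \<le> 2 * m * m" using m(1) by simp
  then have mW: "m \<le> W" using m(4) by (rule le_trans)
  \<comment> \<open>Invariant of the main loop: after \<open>k\<close> rounds matrix 6 holds the
    weights \<open>w k\<close> and matrix 5 the sum of the first \<open>k\<close> forms.\<close>
  define J where "J k \<rho>' \<mu>' \<longleftrightarrow> agree ?X \<rho> \<rho>' \<and> (\<forall>q. q \<notin> ?Y \<longrightarrow> \<mu>' q = \<mu> q) \<and>
     (\<forall>j<m. \<mu>' 6 j 0 = w k j) \<and> (\<forall>a<D. \<forall>b<D. \<mu>' 5 a b = (\<Sum>l<k. Q l a b))" for k \<rho>' and \<mu>' :: mats
  have body: "wp (Seq (Qc p) (Seq GSc (For 9 (V 7) (Seq TauC (UpdW p)))))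
      (\<lambda>\<rho>' \<mu>'. \<rho>' 8 = k \<and> J (Suc k) (\<rho>'(8 := Suc k)) \<mu>') \<rho>1 \<mu>1"
    if k: "J k \<rho>1 \<mu>1" "\<rho>1 8 = k" for k \<rho>1 \<mu>1
  proof (rule wp_Seq, rule wp_Qc[where m = m and F = F and w = "w k"])
    have r1: "\<rho>1 6 = \<rho> 6" "\<rho>1 7 = m" using k m by (auto simp: J_def agree_def)
    show "\<mu>1 0 ((\<rho>1 6 + j) * D + a) b = F j a b" for j a b
      using k r1 by (simp add: J_def F_def)
    show "\<mu>1 6 j 0 = w k j \<and> 0 \<le> w k j" if "j < m" for j
      using k that weight_nonneg[OF p(2)] by (simp add: J_def)
    show "\<rho>1 7 = m" "(\<rho>1 6 + m) * D \<le> R" "m \<le> W" using r1 m mW by auto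
    fix \<rho>2
    assume \<rho>2: "agree {9, 11, 12} \<rho>1 \<rho>2"
    define \<mu>2 where "\<mu>2 = qmem \<mu>1 (Q k) D 0"
    show "wp (Seq GSc (For 9 (V 7) (Seq TauC (UpdW p)))) (\<lambda>\<rho>' \<mu>'. \<rho>' 8 = k \<and> J (Suc k) (\<rho>'(8 := Suc k)) \<mu>')
       \<rho>2 (qmem \<mu>1 (Q k) D 0)"
      unfolding \<mu>2_def[symmetric]
    proof (rule wp_Seq, rule wp_GS[where Q = "Q k"])
      show "\<mu>2 2 a b = Q k a b" if "a < D" "b < D" for a b
        using that by (simp add: \<mu>2_def qmem_def)
      fix \<rho>3
      assume \<rho>3: "agree {10, 11, 12} \<rho>2 \<rho>3"
      define \<mu>3 where "\<mu>3 = gsmem \<mu>2 (Q k) D 0 0"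
      have r3: "\<rho>3 6 = \<rho> 6" "\<rho>3 7 = m" "\<rho>3 8 = k" "agree ?X \<rho> \<rho>3"
        using k r1 \<rho>2 \<rho>3 unfolding J_def agree_def by auto
      have G3: "\<mu>3 3 i a = gsG D (Q k) i a" "\<mu>3 4 i a = gsH D (Q k) i a" if "i < D" "a < D" for i a
        using that by (simp_all add: \<mu>3_def gsmem_def)
      have o3: "\<mu>3 q = \<mu>1 q" if "q \<notin> {2, 3, 4, 5}" for q
        using that by (auto simp: \<mu>3_def gsmem_def \<mu>2_def qmem_def fun_eq_iff)
      have A3: "\<mu>3 5 a b = (\<Sum>l<Suc k. Q l a b)" if "a < D" "b < D" for a b
        using that k(1) by (simp add: \<mu>3_def gsmem_def \<mu>2_def qmem_def J_def)
      show "wp (For 9 (V 7) (Seq TauC (UpdW p))) (\<lambda>\<rho>' \<mu>'. \<rho>' 8 = k \<and> J (Suc k) (\<rho>'(8 := Suc k)) \<mu>')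
         \<rho>3 (gsmem \<mu>2 (Q k) D 0 0)"
        unfolding \<mu>3_def[symmetric]
      \<comment> \<open>The weights are overwritten one by one, so new and old ones coexist. All
        scores nevertheless refer to \<open>Q k\<close>, since its basis was computed before this
        loop and is left untouched.\<close>
      proof (rule wp_For[where N = m and I = "\<lambda>j \<rho>' \<mu>'. agree {9, 10, 11, 12} \<rho>3 \<rho>' \<and>
          (\<forall>q. q \<notin> {6, 8, 9} \<longrightarrow> \<mu>' q = \<mu>3 q) \<and> (\<forall>i<m. \<mu>' 6 i 0 = (if i < j then w (Suc k) i else w k i))"], goal_cases)
        show "agree {9, 10, 11, 12} \<rho>3 (\<rho>3(9 := 0)) \<and> (\<forall>q. q \<notin> {6, 8, 9} \<longrightarrow> \<mu>3 q = \<mu>3 q) \<and>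
            (\<forall>i<m. \<mu>3 6 i 0 = (if i < 0 then w (Suc k) i else w k i))"
          using k(1) o3[of 6] by (auto simp: agree_upd agree_refl J_def)
        case j: (5 j \<rho>4 \<mu>4)
        have r4: "\<rho>4 6 = \<rho> 6" "\<rho>4 7 = m" using j r3 by (auto simp: agree_def)
        show ?case
        proof (rule wp_Seq, rule wp_Tau[where Q = "Q k" and F = "F j"])
          show "\<mu>4 3 i a = gsG D (Q k) i a" if "i < D" "a < D" for i a using j G3 that by simp
          show "\<mu>4 4 i i = gsH D (Q k) i i" if "i < D" for i using j G3 that by simp
          show "\<mu>4 0 ((\<rho>4 6 + \<rho>4 9) * D + a) b = F j a b" for a b
            using j r4 o3[of 0] k(1) by (simp add: F_def J_def)
          show "(\<rho>4 6 + \<rho>4 9) * D + D \<le> R" using RF[OF j(1)] j r4 by simp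
          fix \<rho>5 t
          assume \<rho>5: "agree {10, 11, 12} \<rho>4 \<rho>5"
          have r5: "\<rho>5 9 = j" "\<rho>5 7 = m" "agree {9, 10, 11, 12} \<rho>3 \<rho>5"
            using \<rho>5 j r4 by (auto simp: agree_def)
          let ?\<mu> = "taumem \<mu>4 t (tau D (Q k) (F j))"
          have w5: "?\<mu> 6 j 0 = w k j" using j by (simp add: taumem_simps)
          have ws: "wstep p m (w k j) (tau D (Q k) (F j)) = w (Suc k) j" by (simp add: wseq.simps(2))
          show "wp (UpdW p) (\<lambda>\<rho>' \<mu>'. \<rho>' 9 = j \<and> agree {9, 10, 11, 12} \<rho>3 (\<rho>'(9 := Suc j)) \<and>
             (\<forall>q. q \<notin> {6, 8, 9} \<longrightarrow> \<mu>' q = \<mu>3 q) \<and>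
             (\<forall>i<m. \<mu>' 6 i 0 = (if i < Suc j then w (Suc k) i else w k i))) \<rho>5 ?\<mu>"
          proof (rule wp_UpdW)
            show "\<rho>5 9 < R" "0 \<le> ?\<mu> 6 (\<rho>5 9) 0"
              using r5 w5 Rj[OF j(1)] weight_nonneg[OF p(2) j(1)] by auto
            show "\<rho>5 9 = j \<and> agree {9, 10, 11, 12} \<rho>3 (\<rho>5(9 := Suc j)) \<and>
             (\<forall>q. q \<notin> {6, 8, 9} \<longrightarrow> upd3 ?\<mu> 6 (\<rho>5 9) 0 (wstep p (\<rho>5 7) (?\<mu> 6 (\<rho>5 9) 0) (?\<mu> 8 0 0)) q = \<mu>3 q) \<and>
             (\<forall>i<m. upd3 ?\<mu> 6 (\<rho>5 9) 0 (wstep p (\<rho>5 7) (?\<mu> 6 (\<rho>5 9) 0) (?\<mu> 8 0 0)) 6 i 0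
                = (if i < Suc j then w (Suc k) i else w k i))"
              unfolding r5 w5 taumem_simps(1) ws
            proof (intro conjI allI impI)
              fix q :: nat assume "q \<notin> {6, 8, 9}"
              then show "upd3 ?\<mu> 6 j 0 (w (Suc k) j) q = \<mu>3 q"
                using j by (simp add: upd3_def taumem_simps)
            next
              fix i assume "i < m"
              then show "upd3 ?\<mu> 6 j 0 (w (Suc k) j) 6 i 0 = (if i < Suc j then w (Suc k) i else w k i)"
                using j by (simp add: upd3_def taumem_simps)
            qed (use r5 in \<open>auto simp: agree_upd\<close>)
          qed
        qed
      next
        fix \<rho>4 \<mu>4
        assume j: "agree {9, 10, 11, 12} \<rho>3 \<rho>4 \<and>
          (\<forall>q. q \<notin> {6, 8, 9} \<longrightarrow> \<mu>4 q = \<mu>3 q) \<and> (\<forall>i<m. \<mu>4 6 i 0 = (if i < m then w (Suc k) i else w k i))" "\<rho>4 9 = m"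
        have "agree ?X \<rho> \<rho>4" using j r3(4) by (auto elim: agree_trans)
        moreover have "\<rho>4 8 = k" using j r3 by (simp add: agree_def)
        moreover have "\<mu>4 q = \<mu> q" if "q \<notin> ?Y" for q
          using that j o3[of q] k(1) by (simp add: J_def)
        moreover have "\<mu>4 5 a b = (\<Sum>l<Suc k. Q l a b)" if "a < D" "b < D" for a b
          using that j A3 by simp
        ultimately show "\<rho>4 8 = k \<and> J (Suc k) (\<rho>4(8 := Suc k)) \<mu>4"
          using j unfolding J_def by (simp add: agree_upd)
      qed (use mW M64 r3 in \<open>auto simp: agree_def\<close>)
    qed
  qed
  show ?thesis
    unfolding Red_def
  proof (rule wp_Seq, rule wp_For[where N = m and I = "\<lambda>j \<rho>' \<mu>'. agree ?X \<rho> \<rho>' \<and> (\<forall>q. q \<noteq> 6 \<longrightarrow> \<mu>' q = \<mu> q) \<and>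
      (\<forall>i<j. \<mu>' 6 i 0 = 1)"], goal_cases)
    case j: (5 j \<rho>1 \<mu>1)
    then show ?case
      using Rj[OF j(1)] D0 M64 by (intro wp_SetA) (auto simp: agree_upd upd3_def fun_eq_iff less_Suc_eq)
  next
    case 1: (6 \<rho>1 \<mu>1)
    show ?case
    proof (rule wp_Seq, rule wp_Fill[where b = 0 and g = "\<lambda>_ _. 0"], goal_cases)
      case 2: (5 \<rho>2)
      have r2: "agree ?X \<rho> \<rho>2" using 1 2 by (auto elim: agree_trans)
      show ?case
      proof (rule wp_Seq, rule wp_For[where N = "2 * m * m" and I = J], goal_cases)
        show "J 0 (\<rho>2(8 := 0)) (fillmem \<mu>1 5 0 (\<lambda>_ _. 0) D 0)"
          using r2 1 by (auto simp: J_def agree_upd fillmem_def)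
      next
        fix k \<rho>3 \<mu>3 assume "J k \<rho>3 \<mu>3" "\<rho>3 8 = k"
        then show "wp (Seq (Qc p) (Seq GSc (For 9 (V 7) (Seq TauC (UpdW p)))))
          (\<lambda>\<rho>' \<mu>'. \<rho>' 8 = k \<and> J (Suc k) (\<rho>'(8 := Suc k)) \<mu>') \<rho>3 \<mu>3" by (rule body)
      next
        case 3: (6 \<rho>3 \<mu>3)
        then have r3: "agree ?X \<rho> \<rho>3" by (simp add: J_def)
        show ?case
        proof (rule wp_Fill[where b = 0 and g = "wavg p D m F"])
          fix \<rho>4 a b
          assume 4: "agree {11, 12} \<rho>3 \<rho>4" "a < D" "b < D" "\<rho>4 11 = a" "\<rho>4 12 = b"
          then have "\<rho>4 7 = m" using r3 m(2) by (simp add: agree_def)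
          moreover have "a < R" using 4 D_R by simp
          ultimately show "rok \<rho>4 (RDiv (Cell 5 (V 11) (V 12)) (RNat roundsE)) \<and>
            re \<rho>4 (fillmem \<mu>3 1 0 (wavg p D m F) a b) (RDiv (Cell 5 (V 11) (V 12)) (RNat roundsE)) = wavg p D m F a b"
            using 4 3 M64 by (simp add: re_Cell fillmem_def J_def wavg_def roundsE_def)
        next
          fix \<rho>4 assume 4: "agree {11, 12} \<rho>3 \<rho>4"
          show "P \<rho>4 (fillmem \<mu>3 1 0 (wavg p D m F) D 0)"
          proof (rule P)
            show "agree ?X \<rho> \<rho>4" using r3 4 by (auto elim: agree_trans)
            show "fillmem \<mu>3 1 0 (wavg p D m F) D 0 q = \<mu> q" if "q \<notin> ?Y" for q
              using that 3 by (simp add: fillmem_def J_def)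
          qed (simp add: fillmem_def)
        qed (use D_R in auto)
      qed (use m M64 in \<open>auto simp: J_def agree_def roundsE_def\<close>)
    qed (use D_R in auto)
  qed (use m mW M64 in \<open>auto simp: agree_def\<close>)
qed

end

section \<open>Inserting a row\<close>

definition slot :: "nat \<Rightarrow> mats \<Rightarrow> nat \<Rightarrow> form" where
  "slot D \<mu> i = (\<lambda>a b. \<mu> 0 (i * D + a) b)"

definition dotp :: "nat \<Rightarrow> real list \<Rightarrow> (nat \<Rightarrow> real) \<Rightarrow> real" where
  "dotp D r x = (\<Sum>a<D. r ! a * x a)"

text \<open>At a vector \<open>(x, -1)\<close> this is the \<open>p\<close>-th power of the residual
  norm; see \<open>lp_norm_Phi\<close>.\<close>

definition Phi :: "real \<Rightarrow> nat \<Rightarrow> real list list \<Rightarrow> (nat \<Rightarrow> real) \<Rightarrow> real" where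
  "Phi p D Rs x = (\<Sum>r\<leftarrow>Rs. \<bar>dotp D r x\<bar> powr p)"

definition lam :: "real \<Rightarrow> nat \<Rightarrow> real" where
  "lam p D = real (D + 1) powr (5 + p)"

definition approx :: "real \<Rightarrow> real \<Rightarrow> real \<Rightarrow> bool" where
  "approx K u v \<longleftrightarrow> u \<le> K * v \<and> v \<le> K * u"

lemma approx_add: "approx K u v \<Longrightarrow> approx K u' v' \<Longrightarrow> approx K (u + u') (v + v')"
  by (simp add: approx_def distrib_left)

lemma approx_trans:
  assumes "approx K w u" "approx K' u v" "0 \<le> K" "0 \<le> K'"
  shows "approx (K * K') w v"
proof -
  have "w \<le> K * u" "u \<le> K' * v" "u \<le> K * w" "v \<le> K' * u" using assms by (auto simp: approx_def)
  moreover have "K * u \<le> K * (K' * v)" "K' * u \<le> K' * (K * w)"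
    using calculation assms by (auto intro: mult_left_mono)
  ultimately show ?thesis by (simp add: approx_def mult_ac)
qed

lemma approx_mono:
  assumes "approx K u v" "K \<le> K'" "0 \<le> u" "0 \<le> v"
  shows "approx K' u v"
  using assms mult_right_mono[of K K' u] mult_right_mono[of K K' v] by (auto simp: approx_def)

lemma lam_ge1: "1 \<le> p \<Longrightarrow> 1 \<le> lam p D"
  unfolding lam_def by (intro ge_one_powr_ge_zero) auto

lemma wavg_approx:
  assumes "merging p D m F" "p \<noteq> 2"
  shows "approx (lam p D) (qf D (wavg p D m F) x powr (p / 2)) (\<Sum>j<m. qf D (F j) x powr (p / 2))"
  unfolding approx_def lam_def using merging.wavg_bounds[OF assms] by auto

text \<open>Free slots must contain the zero form, since the query merges all slots, occupied or
  not. A form on level \<open>l\<close> has been through \<open>l\<close> merges, whence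
  \<open>lam p D ^ l\<close>.\<close>

definition good_level :: "real \<Rightarrow> nat \<Rightarrow> nat \<Rightarrow> mats \<Rightarrow> nat \<Rightarrow> nat \<Rightarrow> ((nat \<Rightarrow> real) \<Rightarrow> real) \<Rightarrow> bool" where
  "good_level p D B \<mu> l c \<psi> \<longleftrightarrow> c < B \<and> \<mu> 7 l 0 = real c \<and> (\<forall>i<B. psd D (slot D \<mu> (l * B + i))) \<and>
     (\<forall>i<B. c \<le> i \<longrightarrow> (\<forall>x. qf D (slot D \<mu> (l * B + i)) x = 0)) \<and>
     (\<forall>x. approx (lam p D ^ l) (\<Sum>i<B. qf D (slot D \<mu> (l * B + i)) x powr (p / 2)) (\<psi> x))"

text \<open>Level \<open>l\<close> holds at most \<open>B - 1\<close> forms, each of which stands for \<open>B ^ l\<close> rows; \<open>\<psi> l\<close> is the part of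
  the objective that these rows contribute.\<close>

definition levels_ok :: "real \<Rightarrow> nat \<Rightarrow> nat \<Rightarrow> nat \<Rightarrow> mats \<Rightarrow> nat \<Rightarrow> ((nat \<Rightarrow> real) \<Rightarrow> real) \<Rightarrow> bool" where
  "levels_ok p D B L \<mu> N \<phi> \<longleftrightarrow> (\<exists>cnt \<psi>. (\<forall>l<L. good_level p D B \<mu> l (cnt l) (\<psi> l)) \<and>
     (\<Sum>l<L. cnt l * B ^ l) = N \<and> (\<forall>x. (\<Sum>l<L. \<psi> l x) = \<phi> x))"

text \<open>For \<open>B < D\<close> the single slot is the exact Gram matrix; the loss of replacing
  \<open>\<ell>_p\<close> by \<open>\<ell>_2\<close> is booked later, in
  \<open>state_approx\<close>.\<close>

definition state_ok :: "real \<Rightarrow> nat \<Rightarrow> nat \<Rightarrow> nat \<Rightarrow> real list list \<Rightarrow> mats \<Rightarrow> bool" where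
  "state_ok p D B L Rs \<mu> \<longleftrightarrow>
     (if B < D then psd D (slot D \<mu> 0) \<and> (\<forall>x. qf D (slot D \<mu> 0) x = (\<Sum>r\<leftarrow>Rs. (dotp D r x)\<^sup>2))
      else levels_ok p D B L \<mu> (length Rs) (Phi p D Rs))"

section \<open>Effect of memory updates on the levels of the counter\<close>

lemma good_level_cong:
  assumes "good_level p D B \<mu> l c \<psi>" "\<mu>' 7 l 0 = \<mu> 7 l 0"
    "\<And>i a b. i < B \<Longrightarrow> a < D \<Longrightarrow> b < D \<Longrightarrow> slot D \<mu>' (l * B + i) a b = slot D \<mu> (l * B + i) a b"
  shows "good_level p D B \<mu>' l c \<psi>"
proof -
  have "psd D (slot D \<mu>' (l * B + i)) = psd D (slot D \<mu> (l * B + i))"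
    "qf D (slot D \<mu>' (l * B + i)) x = qf D (slot D \<mu> (l * B + i)) x" if "i < B" for i x
    using assms(3) that by (auto intro!: psd_cong qf_cong)
  then show ?thesis using assms(1,2) by (simp add: good_level_def)
qed

lemma slot_index:
  fixes B :: nat
  assumes "i < B" "i' < B" "a < D" "a' < D" "(l * B + i) * D + a = (l' * B + i') * D + a'"
  shows "l = l' \<and> i = i' \<and> a = a'"
proof -
  have "((l * B + i) * D + a) div D = l * B + i" "((l' * B + i') * D + a') div D = l' * B + i'"
    using assms(3,4) by auto
  with assms(5) have 1: "l * B + i = l' * B + i'" by metis
  with assms(5) have "a = a'" by simp
  have "(l * B + i) div B = l" "(l' * B + i') div B = l'" using assms(1,2) by auto
  with 1 have "l = l'" by metis
  with 1 \<open>a = a'\<close> show ?thesis by simp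
qed

definition put :: "nat \<Rightarrow> mats \<Rightarrow> nat \<Rightarrow> form \<Rightarrow> mats" where
  "put D \<mu> i F = (\<lambda>q i' j'. if q = 0 \<and> i * D \<le> i' \<and> i' < i * D + D \<and> j' < D then F (i' - i * D) j' else \<mu> q i' j')"

lemma slot_put:
  assumes "a < D" "b < D"
  shows "slot D (put D \<mu> i F) i' a b = (if i' = i then F a b else slot D \<mu> i' a b)"
proof (cases "i' = i")
  case False
  have "\<not> (i * D \<le> i' * D + a \<and> i' * D + a < i * D + D)"
  proof
    assume "i * D \<le> i' * D + a \<and> i' * D + a < i * D + D"
    then have "i' * D < Suc i * D" "i * D < Suc i' * D" using assms by auto
    then have "i' < Suc i" "i < Suc i'" using mult_less_cancel2 by blast+
    with False show False by simp
  qed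
  then show ?thesis using False by (auto simp: slot_def put_def)
qed (use assms in \<open>simp add: slot_def put_def\<close>)

lemma slot_put_forms:
  "psd D (slot D (put D \<mu> i F) i') = psd D (if i' = i then F else slot D \<mu> i')"
  "qf D (slot D (put D \<mu> i F) i') x = qf D (if i' = i then F else slot D \<mu> i') x"
  by (auto intro!: psd_cong qf_cong simp: slot_put)

lemma put_other: "q \<noteq> 0 \<Longrightarrow> put D \<mu> i F q = \<mu> q"
  by (auto simp: put_def fun_eq_iff)

lemma level_index_eq: "i < (B::nat) \<Longrightarrow> i' < B \<Longrightarrow> (l * B + i = l' * B + i') = (l = l' \<and> i = i')"
  using slot_index[of i B i' 0 1 0 l l'] by auto

text \<open>Slot \<open>c\<close> is free and held the zero form, so overwriting it simply adds a
  term.\<close>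

lemma put_sum:
  assumes g: "good_level p D B \<mu> l c \<psi>"
  shows "(\<Sum>i<B. qf D (slot D (put D \<mu> (l * B + c) F) (l * B + i)) x powr (p / 2))
     = (\<Sum>i<B. qf D (slot D \<mu> (l * B + i)) x powr (p / 2)) + qf D F x powr (p / 2)"
proof -
  have c: "c < B" "qf D (slot D \<mu> (l * B + c)) x = 0" using g by (auto simp: good_level_def)
  have "(\<Sum>i<B. qf D (slot D (put D \<mu> (l * B + c) F) (l * B + i)) x powr (p / 2))
     = (\<Sum>i<B. qf D (slot D \<mu> (l * B + i)) x powr (p / 2) + (if i = c then qf D F x powr (p / 2) else 0))"
    using c by (intro sum.cong) (auto simp: slot_put_forms)
  then show ?thesis using c(1) by (simp add: sum.distrib)
qed

lemma good_level_put:
  assumes g: "good_level p D B \<mu> l c \<psi>" and F: "psd D F" "\<And>x. approx (lam p D ^ l) (qf D F x powr (p / 2)) (\<psi>X x)"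
    and c: "Suc c < B"
    and \<mu>': "\<mu>' 0 = put D \<mu> (l * B + c) F 0" "\<mu>' 7 l 0 = real (Suc c)"
  shows "good_level p D B \<mu>' l (Suc c) (\<lambda>x. \<psi> x + \<psi>X x)"
proof -
  have s: "slot D \<mu>' = slot D (put D \<mu> (l * B + c) F)" using \<mu>' by (simp add: slot_def fun_eq_iff)
  show ?thesis
    unfolding good_level_def s put_sum[OF g]
    using g F c \<mu>' by (auto simp: good_level_def slot_put_forms intro: approx_add)
qed

lemma good_level_other:
  assumes g: "good_level p D B \<mu> l' c' \<psi>" and "l' \<noteq> l" "c < B"
    and \<mu>': "\<mu>' 0 = put D \<mu> (l * B + c) F 0" "\<mu>' 7 l' 0 = \<mu> 7 l' 0"
  shows "good_level p D B \<mu>' l' c' \<psi>"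
proof (rule good_level_cong[OF g])
  show "\<mu>' 7 l' 0 = \<mu> 7 l' 0" by (rule \<mu>'(2))
  fix i a b :: nat assume "i < B" "a < D" "b < D"
  then show "slot D \<mu>' (l' * B + i) a b = slot D \<mu> (l' * B + i) a b"
    using slot_put[of a D b \<mu> "l * B + c" F "l' * B + i"] level_index_eq[of i B c l' l] assms
    by (simp add: slot_def)
qed

lemma good_level_zero:
  assumes "0 < B" "\<mu> 7 l 0 = 0" "\<And>i a b. i < B \<Longrightarrow> a < D \<Longrightarrow> b < D \<Longrightarrow> slot D \<mu> (l * B + i) a b = 0"
  shows "good_level p D B \<mu> l 0 (\<lambda>_. 0)"
proof -
  have "psd D (slot D \<mu> (l * B + i))" "qf D (slot D \<mu> (l * B + i)) x = 0" if "i < B" for i x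
    using assms(3) that by (auto intro!: psd_zero_form qf_zero_form)
  then show ?thesis using assms(1,2) by (simp add: good_level_def approx_def)
qed

definition slotBase :: iexp where
  "slotBase = IMul (IAdd (IMul (V 3) (V 1)) (V 5)) De"

text \<open>The number of occupied slots is stored as a real, and the machine has no conversion from
  reals to naturals; it is recovered by counting up.\<close>

definition CountC :: com where
  "CountC = Seq (SetI 5 (INat 0)) (While (BLessR (RNat (V 5)) (Cell 7 (V 3) (INat 0))) (SetI 5 (IAdd (V 5) (INat 1))))"

definition ClearC :: com where
  "ClearC = For 5 (V 1) (Fill 0 slotBase (RReal 0))"

text \<open>The carry is stored before the level is tested for being full. The last of the
  \<open>B\<close> slots is therefore occupied only just before a merge, which then takes all
  \<open>B\<close> slots of the level.\<close>

definition LevelC :: "real \<Rightarrow> com" where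
  "LevelC p = Seq CountC (Seq (Fill 0 slotBase (Cell 1 (V 11) (V 12)))
     (If (BLessI (IAdd (V 5) (INat 1)) (V 1))
       (Seq (SetA 7 (V 3) (INat 0) (RNat (IAdd (V 5) (INat 1)))) (SetI 4 (INat 0)))
       (Seq (SetI 6 (IMul (V 3) (V 1))) (Seq (SetI 7 (V 1)) (Seq (Red p)
         (Seq (SetA 7 (V 3) (INat 0) (RReal 0)) ClearC))))))"

definition rowformE :: rexp where
  "rowformE = RMul (Cell 10 (INat 0) (V 11)) (Cell 10 (INat 0) (V 12))"

definition InsC :: "real \<Rightarrow> nat \<Rightarrow> com" where
  "InsC p L = If (BLessI (V 1) De)
     (Fill 0 (INat 0) (RAdd (Cell 0 (V 11) (V 12)) rowformE))
     (Seq (Fill 1 (INat 0) rowformE) (Seq (SetI 4 (INat 1))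
       (For 3 (INat L) (If (BLessI (INat 0) (V 4)) (LevelC p) Skip))))"

text \<open>\<open>B_eq\<close> is the value found by the search in \<open>PrmC\<close>, and
  \<open>NS\<close> slots of \<open>D\<close> rows are stacked in matrix 0, hence
  \<open>R = NS * D\<close>. The bounds on \<open>W\<close> cover the merging rounds, the search,
  the levels and the loading of a summary.\<close>

locale summary = ram +
  fixes p :: real and B L NS :: nat
  assumes p1: "1 \<le> p" and p2: "p \<noteq> 2" and L0: "0 < L" and B_eq: "B = (LEAST B. rows_of \<iota> < B ^ L)"
    and NS: "NS = (if B < D then 1 else L * B)" and R_eq: "R = NS * D"
    and W1: "2 * NS * NS \<le> W" and W2: "B \<le> W" and W3: "L \<le> W" and W4: "16 * (R * D) \<le> W"
begin

lemma n_less: "rows_of \<iota> < B ^ L"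
proof -
  have "Suc (rows_of \<iota>) ^ 1 \<le> Suc (rows_of \<iota>) ^ L" using L0 by (intro power_increasing) auto
  then have "rows_of \<iota> < Suc (rows_of \<iota>) ^ L" by simp
  then show ?thesis unfolding B_eq by (rule LeastI)
qed

lemma n_ge: "k < B \<Longrightarrow> \<not> rows_of \<iota> < k ^ L"
  unfolding B_eq by (rule not_less_Least)

lemma B0: "0 < B"
  using n_less L0 by (cases B) (auto simp: zero_power)

lemma fillmem_put: "fillmem \<mu> 0 (i * D) F D 0 = put D \<mu> i F"
  by (auto simp: fillmem_def put_def fun_eq_iff)

lemma level_rows:
  assumes "\<not> B < D" "l < L"
  shows "(l * B + B) * D \<le> R" "l < R" "c < B \<Longrightarrow> (l * B + c) * D + D \<le> R"
proof -
  have "l * B + B = Suc l * B" by simp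
  also have "\<dots> \<le> L * B" using assms(2) by (intro mult_le_mono1) simp
  also have "\<dots> = NS" using assms(1) NS by simp
  finally have 1: "l * B + B \<le> NS" .
  then show "(l * B + B) * D \<le> R" unfolding R_eq by (rule mult_le_mono1)
  have "l * 1 < Suc l * B" using B0 by (intro mult_less_le_imp_less) auto
  then have "l < NS" using 1 by simp
  then have "l * 1 < NS * D" using D0 by (intro mult_less_le_imp_less) auto
  then show "l < R" unfolding R_eq by simp
  assume "c < B"
  then have "Suc (l * B + c) \<le> NS" using 1 by simp
  then have "Suc (l * B + c) * D \<le> NS * D" by (rule mult_le_mono1)
  then show "(l * B + c) * D + D \<le> R" unfolding R_eq by simp
qed

text \<open>The state between two levels. A pending form in matrix 1 stands for \<open>B ^ l\<close>
  rows and the part \<open>\<psi>X\<close> of the objective, which the levels therefore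
  lack.\<close>

definition carry_ok where
  "carry_ok l f \<mu> N \<phi> \<longleftrightarrow> (if f = (0::nat) then levels_ok p D B L \<mu> N \<phi>
     else f = 1 \<and> (\<exists>\<psi>X M. psd D (\<mu> 1) \<and> (\<forall>x. approx (lam p D ^ l) (qf D (\<mu> 1) x powr (p / 2)) (\<psi>X x)) \<and>
       levels_ok p D B L \<mu> M (\<lambda>x. \<phi> x - \<psi>X x) \<and> N = M + B ^ l))"

lemma carry_okI:
  assumes "psd D (\<mu> 1)" "\<And>x. approx (lam p D ^ l) (qf D (\<mu> 1) x powr (p / 2)) (\<psi> x)"
    "levels_ok p D B L \<mu> M' (\<lambda>x. \<phi> x - \<psi> x)" "N = M' + B ^ l"
  shows "carry_ok l 1 \<mu> N \<phi>"
  unfolding carry_ok_def using assms by (simp only: one_neq_zero if_False) blast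

lemma wp_Count:
  assumes "\<rho> 3 < R" "\<mu> 7 (\<rho> 3) 0 = real c" "c < B" "P (\<rho>(5 := c)) \<mu>"
  shows "wp CountC P \<rho> \<mu>"
  unfolding CountC_def
proof (rule wp_Seq, rule wp_SetI)
  show "wp (While (BLessR (RNat (V 5)) (Cell 7 (V 3) (INat 0))) (SetI 5 (IAdd (V 5) (INat 1)))) P (\<rho>(5 := iv \<rho> (INat 0))) \<mu>"
  proof (rule wp_While[where N = c and I = "\<lambda>k \<rho>' \<mu>'. \<rho>' = \<rho>(5 := k) \<and> \<mu>' = \<mu>"])
    fix k \<rho>1 \<mu>1 assume "k < c" "\<rho>1 = \<rho>(5 := k) \<and> \<mu>1 = \<mu>"
    then show "bok \<rho>1 (BLessR (RNat (V 5)) (Cell 7 (V 3) (INat 0))) \<and> be \<rho>1 \<mu>1 (BLessR (RNat (V 5)) (Cell 7 (V 3) (INat 0))) \<and>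
        wp (SetI 5 (IAdd (V 5) (INat 1))) (\<lambda>\<rho>' \<mu>'. \<rho>' = \<rho>(5 := Suc k) \<and> \<mu>' = \<mu>) \<rho>1 \<mu>1"
      using assms M64 D0 by (auto intro!: wp_SetI simp: re_Cell)
  qed (use assms M64 D0 W2 in \<open>auto simp: re_Cell\<close>)
qed (use M64 in auto)

lemma wp_Clear:
  assumes l: "\<rho> 3 = l" "l < L" "\<rho> 1 = B" "\<not> B < D"
    and P: "\<And>\<rho>' \<mu>'. agree {5, 11, 12} \<rho> \<rho>' \<Longrightarrow> (\<And>q. q \<noteq> 0 \<Longrightarrow> \<mu>' q = \<mu> q) \<Longrightarrow>
      (\<And>l' i a b. i < B \<Longrightarrow> a < D \<Longrightarrow> b < D \<Longrightarrow>
         slot D \<mu>' (l' * B + i) a b = (if l' = l then 0 else slot D \<mu> (l' * B + i) a b)) \<Longrightarrow> P \<rho>' \<mu>'"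
  shows "wp ClearC P \<rho> \<mu>"
  unfolding ClearC_def
proof (rule wp_For[where N = B and I = "\<lambda>c \<rho>' \<mu>'. agree {5, 11, 12} \<rho> \<rho>' \<and> (\<forall>q. q \<noteq> 0 \<longrightarrow> \<mu>' q = \<mu> q) \<and>
    (\<forall>l' i a b. i < B \<longrightarrow> a < D \<longrightarrow> b < D \<longrightarrow>
         slot D \<mu>' (l' * B + i) a b = (if l' = l \<and> i < c then 0 else slot D \<mu> (l' * B + i) a b))"], goal_cases)
  case c: (5 c \<rho>1 \<mu>1)
  show ?case
  proof (rule wp_Fill[where b = "(l * B + c) * D" and g = "\<lambda>_ _. 0"])
    show "(l * B + c) * D + D \<le> R" using level_rows(3)[OF l(4,2) c(1)] .
    fix \<rho>2 assume 2: "agree {11, 12} \<rho>1 \<rho>2"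
    then show "iv \<rho>2 slotBase = (l * B + c) * D \<and> isp \<rho>2 slotBase \<le> M"
      using l c M64 by (simp add: slotBase_def agree_def)
    show "\<rho>2 5 = c \<and> agree {5, 11, 12} \<rho> (\<rho>2(5 := Suc c)) \<and> (\<forall>q. q \<noteq> 0 \<longrightarrow> fillmem \<mu>1 0 ((l * B + c) * D) (\<lambda>_ _. 0) D 0 q = \<mu> q) \<and>
      (\<forall>l' i a b. i < B \<longrightarrow> a < D \<longrightarrow> b < D \<longrightarrow>
         slot D (fillmem \<mu>1 0 ((l * B + c) * D) (\<lambda>_ _. 0) D 0) (l' * B + i) a b
           = (if l' = l \<and> i < Suc c then 0 else slot D \<mu> (l' * B + i) a b))"
    proof (intro conjI allI impI)
      show "\<rho>2 5 = c" using 2 c by (simp add: agree_def)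
      show "agree {5, 11, 12} \<rho> (\<rho>2(5 := Suc c))" using 2 c by (auto simp: agree_def)
      show "fillmem \<mu>1 0 ((l * B + c) * D) (\<lambda>_ _. 0) D 0 q = \<mu> q" if "q \<noteq> 0" for q
        unfolding fillmem_put using that c by (simp add: put_other)
      fix l' i a b :: nat assume i: "i < B" "a < D" "b < D"
      then show "slot D (fillmem \<mu>1 0 ((l * B + c) * D) (\<lambda>_ _. 0) D 0) (l' * B + i) a b
           = (if l' = l \<and> i < Suc c then 0 else slot D \<mu> (l' * B + i) a b)"
        unfolding fillmem_put using c level_index_eq[of i B c l' l]
        by (auto simp: slot_put less_Suc_eq)
    qed
  qed auto
qed (use l P W2 M64 in \<open>auto simp: agree_def\<close>)

lemma wp_Level:
  assumes l: "\<rho> 3 = l" "l < L" "\<rho> 1 = B" "\<not> B < D"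
    and c: "carry_ok l 1 \<mu> N \<phi>" "\<rho> 4 = 1"
    and P: "\<And>\<rho>' \<mu>'. agree {4, 5, 6, 7, 8, 9, 10, 11, 12} \<rho> \<rho>' \<Longrightarrow> carry_ok (Suc l) (\<rho>' 4) \<mu>' N \<phi> \<Longrightarrow> P \<rho>' \<mu>'"
  shows "wp (LevelC p) P \<rho> \<mu>"
proof -
  let ?X = "{4, 5, 6, 7, 8, 9, 10, 11, 12} :: nat set"
  obtain \<psi>X cnt \<psi> where X: "psd D (\<mu> 1)" "\<And>x. approx (lam p D ^ l) (qf D (\<mu> 1) x powr (p / 2)) (\<psi>X x)"
    and g: "\<And>l. l < L \<Longrightarrow> good_level p D B \<mu> l (cnt l) (\<psi> l)"
    and N: "N = (\<Sum>l<L. cnt l * B ^ l) + B ^ l" and \<psi>: "\<And>x. (\<Sum>l<L. \<psi> l x) = \<phi> x - \<psi>X x"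
    using c(1) unfolding carry_ok_def levels_ok_def by auto
  define cl where "cl = cnt l"
  have gl: "good_level p D B \<mu> l cl (\<psi> l)" using g l by (simp add: cl_def)
  have cl: "cl < B" "\<mu> 7 l 0 = real cl" using gl by (auto simp: good_level_def)
  have lR: "l < R" using level_rows[OF l(4,2)] by blast
  define \<mu>1 where "\<mu>1 = put D \<mu> (l * B + cl) (\<mu> 1)"
  have other1: "\<mu>1 q = \<mu> q" if "q \<noteq> 0" for q using that by (simp add: \<mu>1_def put_other)
  show ?thesis
    unfolding LevelC_def
  proof (rule wp_Seq, rule wp_Count[where c = cl])
    show "wp (Seq (Fill 0 slotBase (Cell 1 (V 11) (V 12)))
     (If (BLessI (IAdd (V 5) (INat 1)) (V 1))
       (Seq (SetA 7 (V 3) (INat 0) (RNat (IAdd (V 5) (INat 1)))) (SetI 4 (INat 0)))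
       (Seq (SetI 6 (IMul (V 3) (V 1))) (Seq (SetI 7 (V 1)) (Seq (Red p)
         (Seq (SetA 7 (V 3) (INat 0) (RReal 0)) ClearC)))))) P (\<rho>(5 := cl)) \<mu>"
    proof (rule wp_Seq, rule wp_Fill[where b = "(l * B + cl) * D" and g = "\<mu> 1"])
      show "(l * B + cl) * D + D \<le> R" using level_rows(3)[OF l(4,2) cl(1)] .
      fix \<rho>1 assume \<rho>1: "agree {11, 12} (\<rho>(5 := cl)) \<rho>1"
      then show "iv \<rho>1 slotBase = (l * B + cl) * D \<and> isp \<rho>1 slotBase \<le> M"
        using l M64 by (simp add: slotBase_def agree_def)
      show "rok \<rho>1 (Cell 1 (V 11) (V 12)) \<and> re \<rho>1 (fillmem \<mu> 0 ((l * B + cl) * D) (\<mu> 1) n k) (Cell 1 (V 11) (V 12)) = \<mu> 1 n k"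
        if "n < D" "k < D" "\<rho>1 11 = n" "\<rho>1 12 = k" for n k
        using that M64 D_R by (simp add: re_Cell fillmem_def)
      have r1: "\<rho>1 3 = l" "\<rho>1 1 = B" "\<rho>1 5 = cl" "agree ?X \<rho> \<rho>1" "\<rho>1 4 = 1" using \<rho>1 l c(2) by (auto simp: agree_def)
      show "wp (If (BLessI (IAdd (V 5) (INat 1)) (V 1))
       (Seq (SetA 7 (V 3) (INat 0) (RNat (IAdd (V 5) (INat 1)))) (SetI 4 (INat 0)))
       (Seq (SetI 6 (IMul (V 3) (V 1))) (Seq (SetI 7 (V 1)) (Seq (Red p)
         (Seq (SetA 7 (V 3) (INat 0) (RReal 0)) ClearC))))) P \<rho>1 (fillmem \<mu> 0 ((l * B + cl) * D) (\<mu> 1) D 0)"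
        unfolding fillmem_put \<mu>1_def[symmetric]
      proof (rule wp_If)
        show "bok \<rho>1 (BLessI (IAdd (V 5) (INat 1)) (V 1))" using M64 by simp
        assume "be \<rho>1 \<mu>1 (BLessI (IAdd (V 5) (INat 1)) (V 1))"
        then have cB: "Suc cl < B" using r1 by simp
        let ?\<mu> = "upd3 \<mu>1 7 l 0 (real (Suc cl))"
        let ?cnt = "cnt(l := Suc cl)" and ?\<psi> = "\<psi>(l := \<lambda>x. \<psi> l x + \<psi>X x)"
        have "good_level p D B ?\<mu> l' (?cnt l') (?\<psi> l')" if "l' < L" for l'
        proof (cases "l' = l")
          case True
          have "good_level p D B ?\<mu> l (Suc cl) (\<lambda>x. \<psi> l x + \<psi>X x)"
            by (rule good_level_put[OF gl X cB]) (simp_all add: upd3_def \<mu>1_def fun_eq_iff)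
          with True show ?thesis by simp
        next
          case False
          have "good_level p D B ?\<mu> l' (cnt l') (\<psi> l')"
            by (rule good_level_other[OF g[OF that] False cl(1), where F = "\<mu> 1"])
              (use False in \<open>simp_all add: upd3_def \<mu>1_def fun_eq_iff put_other\<close>)
          with False show ?thesis by simp
        qed
        moreover have "(\<Sum>l'<L. ?cnt l' * B ^ l') = N"
        proof -
          have "(\<Sum>l'<L. ?cnt l' * B ^ l') = (\<Sum>l'<L. cnt l' * B ^ l' + (if l' = l then B ^ l else 0))"
            by (intro sum.cong) (auto simp: cl_def)
          then show ?thesis using l(2) N by (simp add: sum.distrib)
        qed
        moreover have "(\<Sum>l'<L. ?\<psi> l' x) = \<phi> x" for x
        proof -
          have "(\<Sum>l'<L. ?\<psi> l' x) = (\<Sum>l'<L. \<psi> l' x + (if l' = l then \<psi>X x else 0))"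
            by (intro sum.cong) auto
          then show ?thesis using l(2) \<psi>[of x] by (simp add: sum.distrib)
        qed
        ultimately have "levels_ok p D B L ?\<mu> N \<phi>" unfolding levels_ok_def by blast
        then have "P (\<rho>1(4 := 0)) ?\<mu>" using r1(4) by (intro P) (auto simp: carry_ok_def agree_upd)
        then show "wp (Seq (SetA 7 (V 3) (INat 0) (RNat (IAdd (V 5) (INat 1)))) (SetI 4 (INat 0))) P \<rho>1 \<mu>1"
          using r1 lR D0 M64 by (intro wp_Seq wp_SetA wp_SetI) auto
      next
        assume "\<not> be \<rho>1 \<mu>1 (BLessI (IAdd (V 5) (INat 1)) (V 1))"
        then have cB: "Suc cl = B" using r1 cl by simp
        let ?F = "\<lambda>j. slot D \<mu>1 (l * B + j)"
        let ?\<rho> = "\<rho>1(6 := l * B, 7 := B)"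
        have psdF: "psd D (?F j)" if "j < B" for j
          using gl X(1) that by (simp add: \<mu>1_def slot_put_forms good_level_def)
        have mF: "merging p D B ?F" using p1 D0 B0 psdF by unfold_locales
        have BW: "2 * B * B \<le> W"
        proof -
          have "B \<le> NS" using NS l by simp
          then have "2 * B * B \<le> 2 * NS * NS" by (intro mult_le_mono) auto
          then show ?thesis using W1 by simp
        qed
        have sF: "(\<lambda>j a b. \<mu>1 0 ((?\<rho> 6 + j) * D + a) b) = ?F" by (simp add: slot_def)
        have "wp (Red p) (\<lambda>\<rho>' \<mu>'. wp (Seq (SetA 7 (V 3) (INat 0) (RReal 0)) ClearC) P \<rho>' \<mu>') ?\<rho> \<mu>1"
        proof (rule wp_Red[where m = B and \<rho> = ?\<rho> and \<mu> = \<mu>1, unfolded sF])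
          show "(?\<rho> 6 + B) * D \<le> R" using level_rows(1)[OF l(4,2)] by simp
          fix \<rho>2 \<mu>2
          assume \<rho>2: "agree {8, 9, 10, 11, 12} ?\<rho> \<rho>2"
            and \<mu>2: "\<And>q. q \<notin> {1, 2, 3, 4, 5, 6, 8, 9} \<Longrightarrow> \<mu>2 q = \<mu>1 q"
            and X2: "\<And>a b. a < D \<Longrightarrow> b < D \<Longrightarrow> \<mu>2 1 a b = wavg p D B ?F a b"
          have r2: "\<rho>2 3 = l" "\<rho>2 1 = B" "\<rho>2 4 = 1" "agree ?X \<rho> \<rho>2"
            using \<rho>2 r1 by (auto simp: agree_def)
          show "wp (Seq (SetA 7 (V 3) (INat 0) (RReal 0)) ClearC) P \<rho>2 \<mu>2"
          proof (rule wp_Seq, rule wp_SetA, goal_cases)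
            case 7
            show ?case
            proof (rule wp_Clear[OF _ l(2) _ l(4)])
              fix \<rho>3 \<mu>3
              assume \<rho>3: "agree {5, 11, 12} \<rho>2 \<rho>3"
                and \<mu>3: "\<And>q. q \<noteq> 0 \<Longrightarrow> \<mu>3 q = upd3 \<mu>2 7 (iv \<rho>2 (V 3)) (iv \<rho>2 (INat 0)) (re \<rho>2 \<mu>2 (RReal 0)) q"
                and s3: "\<And>l' i a b. i < B \<Longrightarrow> a < D \<Longrightarrow> b < D \<Longrightarrow>
                   slot D \<mu>3 (l' * B + i) a b = (if l' = l then 0 else
                     slot D (upd3 \<mu>2 7 (iv \<rho>2 (V 3)) (iv \<rho>2 (INat 0)) (re \<rho>2 \<mu>2 (RReal 0))) (l' * B + i) a b)"
              have r3: "\<rho>3 4 = 1" "agree ?X \<rho> \<rho>3" using \<rho>3 r2 by (auto simp: agree_def)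
              have s3': "slot D \<mu>3 (l' * B + i) a b = (if l' = l then 0 else slot D \<mu> (l' * B + i) a b)"
                if "i < B" "a < D" "b < D" for l' i a b
                using s3[OF that, of l'] that \<mu>2[of 0] slot_put[of a D b \<mu> "l * B + cl" "\<mu> 1" "l' * B + i"]
                  level_index_eq[OF that(1) cl(1), of l' l]
                by (auto simp: slot_def upd3_def \<mu>1_def)
              have \<mu>37: "\<mu>3 7 l' 0 = (if l' = l then 0 else \<mu> 7 l' 0)" for l'
                using \<mu>3[of 7] \<mu>2[of 7] other1[of 7] r2 by (simp add: upd3_def)
              let ?cnt = "cnt(l := 0)" and ?\<psi> = "\<psi>(l := \<lambda>_. 0)"
              have "good_level p D B \<mu>3 l' (?cnt l') (?\<psi> l')" if "l' < L" for l'
              proof (cases "l' = l")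
                case True
                then show ?thesis using B0 \<mu>37[of l] s3'[of _ _ _ l] by (auto intro!: good_level_zero)
              next
                case False
                have "good_level p D B \<mu>3 l' (cnt l') (\<psi> l')"
                  by (rule good_level_cong[OF g[OF that]]) (use False \<mu>37 s3' in auto)
                with False show ?thesis by simp
              qed
              moreover have "(\<Sum>l'<L. \<psi> l' x) = (\<Sum>l'<L. ?\<psi> l' x) + \<psi> l x" for x
              proof -
                have "(\<Sum>l'<L. \<psi> l' x) = (\<Sum>l'<L. ?\<psi> l' x + (if l' = l then \<psi> l x else 0))"
                  by (intro sum.cong) auto
                then show ?thesis using l(2) by (simp add: sum.distrib)
              qed
              then have "\<forall>x. (\<Sum>l'<L. ?\<psi> l' x) = \<phi> x - (\<psi> l x + \<psi>X x)" using \<psi> by (metis add_diff_cancel_right' diff_diff_add diff_diff_eq2 add.commute)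
              ultimately have lev: "levels_ok p D B L \<mu>3 (\<Sum>l'<L. ?cnt l' * B ^ l') (\<lambda>x. \<phi> x - (\<psi> l x + \<psi>X x))"
                unfolding levels_ok_def by blast
              \<comment> \<open>Carry arithmetic: \<open>B - 1\<close> stored forms and the carry,
                each for \<open>B ^ l\<close> rows, become one form for \<open>B ^ Suc l\<close>
                rows.\<close>
              have cnt: "N = (\<Sum>l'<L. ?cnt l' * B ^ l') + B ^ Suc l"
              proof -
                have "(\<Sum>l'<L. cnt l' * B ^ l') = (\<Sum>l'<L. ?cnt l' * B ^ l' + (if l' = l then cl * B ^ l else 0))"
                  by (intro sum.cong) (auto simp: cl_def)
                then have "N = (\<Sum>l'<L. ?cnt l' * B ^ l') + (cl * B ^ l + B ^ l)"
                  using l(2) N by (simp add: sum.distrib)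
                also have "cl * B ^ l + B ^ l = Suc cl * B ^ l" by simp
                finally show ?thesis unfolding cB by simp
              qed
              have X3: "\<mu>3 1 a b = wavg p D B ?F a b" if "a < D" "b < D" for a b
                using \<mu>3[of 1] X2[OF that] by (simp add: upd3_def)
              have "psd D (\<mu>3 1)"
                using psd_cong[of D "\<mu>3 1" "wavg p D B ?F"] X3 merging.psd_wavg[OF mF] by blast
              moreover have "approx (lam p D ^ Suc l) (qf D (\<mu>3 1) x powr (p / 2)) (\<psi> l x + \<psi>X x)" for x
              proof -
                have "qf D (\<mu>3 1) x = qf D (wavg p D B ?F) x" using X3 by (intro qf_cong) auto
                then have 1: "approx (lam p D) (qf D (\<mu>3 1) x powr (p / 2)) (\<Sum>j<B. qf D (?F j) x powr (p / 2))"
                  using wavg_approx[OF mF p2] by simp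
                \<comment> \<open>The level with the carry included is accurate up to
                  \<open>lam ^ l\<close>; the merge costs one further factor.\<close>
                have "approx (lam p D ^ l) (\<Sum>j<B. qf D (?F j) x powr (p / 2)) (\<psi> l x + \<psi>X x)"
                  unfolding \<mu>1_def put_sum[OF gl] using gl X(2) by (auto simp: good_level_def intro!: approx_add)
                from approx_trans[OF 1 this] show ?thesis using lam_ge1[OF p1, of D] by simp
              qed
              ultimately have "carry_ok (Suc l) 1 \<mu>3 N \<phi>" by (rule carry_okI[OF _ _ lev cnt])
              then show "P \<rho>3 \<mu>3" using r3 by (intro P) simp_all
            qed (use r2 in auto)
          qed (use r2 lR D0 M64 in auto)
        qed (use p1 p2 B0 psdF[unfolded slot_def] BW in auto)
        then show "wp (Seq (SetI 6 (IMul (V 3) (V 1))) (Seq (SetI 7 (V 1)) (Seq (Red p)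
         (Seq (SetA 7 (V 3) (INat 0) (RReal 0)) ClearC)))) P \<rho>1 \<mu>1"
          using r1 M64 by (intro wp_Seq wp_SetI) auto
      qed
    qed auto
  qed (use l cl lR in auto)
qed

lemma wp_Ins:
  assumes \<rho>: "\<rho> 1 = B" and ok: "state_ok p D B L Rs \<mu>" and row: "\<And>a. a < D \<Longrightarrow> \<mu> 10 0 a = r ! a"
    and len: "length Rs < rows_of \<iota>"
    and P: "\<And>\<rho>' \<mu>'. agree {3, 4, 5, 6, 7, 8, 9, 10, 11, 12} \<rho> \<rho>' \<Longrightarrow> state_ok p D B L (Rs @ [r]) \<mu>' \<Longrightarrow> P \<rho>' \<mu>'"
  shows "wp (InsC p L) P \<rho> \<mu>"
  unfolding InsC_def
proof (rule wp_If)
  have R0': "0 < R" by (rule R0)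
  show "bok \<rho> (BLessI (V 1) De)" using M64 by simp
  assume "be \<rho> \<mu> (BLessI (V 1) De)"
  then have BD: "B < D" using \<rho> by simp
  let ?g = "\<lambda>a b. slot D \<mu> 0 a b + r ! a * r ! b"
  show "wp (Fill 0 (INat 0) (RAdd (Cell 0 (V 11) (V 12)) rowformE)) P \<rho> \<mu>"
  proof (rule wp_Fill[where b = 0 and g = ?g])
    fix \<rho>1 n k assume "agree {11, 12} \<rho> \<rho>1" "n < D" "k < D" "\<rho>1 11 = n" "\<rho>1 12 = k"
    then show "rok \<rho>1 (RAdd (Cell 0 (V 11) (V 12)) rowformE) \<and>
      re \<rho>1 (fillmem \<mu> 0 0 ?g n k) (RAdd (Cell 0 (V 11) (V 12)) rowformE) = ?g n k"
      using row D_R R0' M64 by (simp add: rowformE_def re_Cell fillmem_def slot_def)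
  next
    fix \<rho>1 assume 1: "agree {11, 12} \<rho> \<rho>1"
    have s: "slot D (fillmem \<mu> 0 0 ?g D 0) 0 a b = slot D \<mu> 0 a b + r ! a * r ! b" if "a < D" "b < D" for a b
      using that by (simp add: slot_def fillmem_def)
    have "psd D (slot D (fillmem \<mu> 0 0 ?g D 0) 0) = psd D ?g" by (rule psd_cong) (rule s)
    moreover have "psd D ?g" using ok BD by (intro psd_add_form psd_rank1) (simp add: state_ok_def)
    moreover have "qf D (slot D (fillmem \<mu> 0 0 ?g D 0) 0) x = (\<Sum>r\<leftarrow>Rs @ [r]. (dotp D r x)\<^sup>2)" for x
    proof -
      have "qf D (slot D (fillmem \<mu> 0 0 ?g D 0) 0) x = qf D ?g x" by (rule qf_cong) (simp_all add: s)
      also have "\<dots> = qf D (slot D \<mu> 0) x + (dotp D r x)\<^sup>2"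
        by (simp add: qf_add_form qf_rank1 dotp_def)
      finally show ?thesis using ok BD by (simp add: state_ok_def)
    qed
    ultimately have "state_ok p D B L (Rs @ [r]) (fillmem \<mu> 0 0 ?g D 0)"
      using BD by (simp add: state_ok_def)
    then show "P \<rho>1 (fillmem \<mu> 0 0 ?g D 0)" using 1 by (intro P) (auto simp: agree_def)
  qed (use D_R in auto)
next
  have R0': "0 < R" by (rule R0)
  assume "\<not> be \<rho> \<mu> (BLessI (V 1) De)"
  then have BD: "\<not> B < D" using \<rho> by simp
  let ?g = "\<lambda>a b. r ! a * r ! b"
  let ?N = "length (Rs @ [r])" and ?\<phi> = "Phi p D (Rs @ [r])"
  let ?X = "{3, 4, 5, 6, 7, 8, 9, 10, 11, 12} :: nat set"
  show "wp (Seq (Fill 1 (INat 0) rowformE) (Seq (SetI 4 (INat 1))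
       (For 3 (INat L) (If (BLessI (INat 0) (V 4)) (LevelC p) Skip)))) P \<rho> \<mu>"
  proof (rule wp_Seq, rule wp_Fill[where b = 0 and g = ?g])
    fix \<rho>1 n k assume "agree {11, 12} \<rho> \<rho>1" "n < D" "k < D" "\<rho>1 11 = n" "\<rho>1 12 = k"
    then show "rok \<rho>1 rowformE \<and> re \<rho>1 (fillmem \<mu> 1 0 ?g n k) rowformE = ?g n k"
      using row D_R R0' M64 by (simp add: rowformE_def re_Cell fillmem_def)
  next
    fix \<rho>1 assume 1: "agree {11, 12} \<rho> \<rho>1"
    let ?\<mu> = "fillmem \<mu> 1 0 ?g D 0"
    have X: "?\<mu> 1 a b = r ! a * r ! b" if "a < D" "b < D" for a b using that by (simp add: fillmem_def)
    have psdX: "psd D (?\<mu> 1)" using psd_cong[of D "?\<mu> 1" ?g] X psd_rank1 by blast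
    have qX: "qf D (?\<mu> 1) x powr (p / 2) = \<bar>dotp D r x\<bar> powr p" for x
    proof -
      have "qf D (?\<mu> 1) x = (dotp D r x)\<^sup>2"
        using qf_cong[of D x x "?\<mu> 1" ?g] X by (simp add: qf_rank1 dotp_def)
      also have "\<dots> = \<bar>dotp D r x\<bar> powr 2" by (cases "dotp D r x = 0") simp_all
      finally have e: "qf D (?\<mu> 1) x = \<bar>dotp D r x\<bar> powr 2" .
      show ?thesis unfolding e by (simp only: powr_powr) simp
    qed
    have lev: "levels_ok p D B L \<mu> (length Rs) (Phi p D Rs)" using ok BD by (simp add: state_ok_def)
    have "levels_ok p D B L ?\<mu> (length Rs) (Phi p D Rs)"
    proof -
      obtain cnt \<psi> where g: "\<And>l. l < L \<Longrightarrow> good_level p D B \<mu> l (cnt l) (\<psi> l)"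
        and o: "(\<Sum>l<L. cnt l * B ^ l) = length Rs" "\<forall>x. (\<Sum>l<L. \<psi> l x) = Phi p D Rs x"
        using lev unfolding levels_ok_def by blast
      have "good_level p D B ?\<mu> l (cnt l) (\<psi> l)" if "l < L" for l
        by (rule good_level_cong[OF g[OF that]]) (simp_all add: slot_def fillmem_def)
      with o show ?thesis unfolding levels_ok_def by blast
    qed
    \<comment> \<open>The new row is a carry into level \<open>0\<close>, represented exactly since
      \<open>lam ^ 0 = 1\<close>.\<close>
    then have start: "carry_ok 0 1 ?\<mu> ?N ?\<phi>"
    proof -
      have "(\<lambda>x. ?\<phi> x - \<bar>dotp D r x\<bar> powr p) = Phi p D Rs" by (simp add: Phi_def fun_eq_iff)
      then have "levels_ok p D B L ?\<mu> (length Rs) (\<lambda>x. ?\<phi> x - \<bar>dotp D r x\<bar> powr p)"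
        using \<open>levels_ok p D B L ?\<mu> (length Rs) (Phi p D Rs)\<close> by simp
      moreover have "\<forall>x. approx (lam p D ^ 0) (qf D (?\<mu> 1) x powr (p / 2)) (\<bar>dotp D r x\<bar> powr p)"
        unfolding qX by (simp add: approx_def)
      moreover have "?N = length Rs + B ^ 0" by simp
      ultimately show ?thesis unfolding carry_ok_def using psdX by auto
    qed
    show "wp (Seq (SetI 4 (INat 1)) (For 3 (INat L) (If (BLessI (INat 0) (V 4)) (LevelC p) Skip))) P \<rho>1 ?\<mu>"
    proof (rule wp_Seq, rule wp_SetI)
      show "wp (For 3 (INat L) (If (BLessI (INat 0) (V 4)) (LevelC p) Skip)) P (\<rho>1(4 := iv \<rho>1 (INat 1))) ?\<mu>"
      proof (rule wp_For[where N = L and I = "\<lambda>l \<rho>' \<mu>'. agree ?X \<rho> \<rho>' \<and> carry_ok l (\<rho>' 4) \<mu>' ?N ?\<phi>"], goal_cases)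
        case l: (5 l \<rho>2 \<mu>2)
        have r2: "\<rho>2 1 = B" using l \<rho> by (simp add: agree_def)
        show ?case
        proof (rule wp_If)
          assume "be \<rho>2 \<mu>2 (BLessI (INat 0) (V 4))"
          then have f: "\<rho>2 4 = 1" using l by (auto simp: carry_ok_def)
          show "wp (LevelC p) (\<lambda>\<rho>' \<mu>'. \<rho>' 3 = l \<and> agree ?X \<rho> (\<rho>'(3 := Suc l)) \<and>
            carry_ok (Suc l) ((\<rho>'(3 := Suc l)) 4) \<mu>' ?N ?\<phi>) \<rho>2 \<mu>2"
          proof (rule wp_weaken[OF wp_Level[OF l(3,1) r2 BD _ f,
                where P = "\<lambda>\<rho>' \<mu>'. agree {4, 5, 6, 7, 8, 9, 10, 11, 12} \<rho>2 \<rho>' \<and> carry_ok (Suc l) (\<rho>' 4) \<mu>' ?N ?\<phi>"]])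
            show "carry_ok l 1 \<mu>2 ?N ?\<phi>" using l f by simp
          next
            fix \<rho>3 \<mu>3 assume "agree {4, 5, 6, 7, 8, 9, 10, 11, 12} \<rho>2 \<rho>3" "carry_ok (Suc l) (\<rho>3 4) \<mu>3 ?N ?\<phi>"
            then show "agree {4, 5, 6, 7, 8, 9, 10, 11, 12} \<rho>2 \<rho>3 \<and> carry_ok (Suc l) (\<rho>3 4) \<mu>3 ?N ?\<phi>"
              by simp
          next
            fix \<rho>3 \<mu>3 assume "agree {4, 5, 6, 7, 8, 9, 10, 11, 12} \<rho>2 \<rho>3 \<and> carry_ok (Suc l) (\<rho>3 4) \<mu>3 ?N ?\<phi>"
            with l show "\<rho>3 3 = l \<and> agree ?X \<rho> (\<rho>3(3 := Suc l)) \<and>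
                carry_ok (Suc l) ((\<rho>3(3 := Suc l)) 4) \<mu>3 ?N ?\<phi>"
              by (auto simp: agree_def)
          qed
        next
          assume "\<not> be \<rho>2 \<mu>2 (BLessI (INat 0) (V 4))"
          then show "wp Skip (\<lambda>\<rho>' \<mu>'. \<rho>' 3 = l \<and> agree ?X \<rho> (\<rho>'(3 := Suc l)) \<and>
            carry_ok (Suc l) ((\<rho>'(3 := Suc l)) 4) \<mu>' ?N ?\<phi>) \<rho>2 \<mu>2"
            using l by (intro wp_Skip) (auto simp: carry_ok_def agree_upd)
        qed (use M64 in auto)
      next
        fix \<rho>2 \<mu>2
        assume 2: "agree ?X \<rho> \<rho>2 \<and> carry_ok L (\<rho>2 4) \<mu>2 ?N ?\<phi>"
        \<comment> \<open>A carry out of the top level would stand for \<open>B ^ L\<close> rows,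
          more than the input has.\<close>
        have "\<rho>2 4 = 0"
        proof (rule ccontr)
          assume "\<rho>2 4 \<noteq> 0"
          then have "B ^ L \<le> ?N" using 2 unfolding carry_ok_def by auto
          then show False using n_less len by simp
        qed
        then have "state_ok p D B L (Rs @ [r]) \<mu>2" using 2 BD by (simp add: carry_ok_def state_ok_def)
        then show "P \<rho>2 \<mu>2" using 2 by (intro P) auto
      qed (use 1 start W3 in \<open>auto simp: agree_def\<close>)
    qed (use M64 in auto)
  qed (use D_R in auto)
qed

end

section \<open>The streaming and distributed programs\<close>

fun ipow :: "iexp \<Rightarrow> nat \<Rightarrow> iexp" where
  "ipow e 0 = INat 1"
| "ipow e (Suc k) = IMul e (ipow e k)"

text \<open>\<open>B\<close> is found by linear search and afresh in every run, since only real
  cells are carried over. The exponent \<open>L\<close> depends on \<open>\<gamma>\<close> alone and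
  is built into the program.\<close>

definition PrmC :: "nat \<Rightarrow> com" where
  "PrmC L = Seq (SetI 1 (INat 0)) (Seq
     (While (BNot (BLessI IRows (ipow (V 1) L))) (SetI 1 (IAdd (V 1) (INat 1))))
     (If (BLessI (V 1) De) (SetI 2 (INat 1)) (SetI 2 (IMul (INat L) (V 1)))))"

definition RowC :: "iexp \<Rightarrow> iexp \<Rightarrow> com" where
  "RowC i off = For 11 De (SetA 10 (INat 0) (V 11) (RMsg i (IAdd off (V 11))))"

definition sizeE :: iexp where
  "sizeE = IMul (INat 16) (IMul (IMul (V 2) De) De)"

text \<open>Reading a missing message yields \<open>0\<close>, so without any message this produces
  the state of the empty input.\<close>

definition LoadC :: com where
  "LoadC = For 14 sizeE (AssignR (V 14) (RMsg (INat 0) (V 14)))"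

text \<open>All slots of all levels are merged into one form. The minimiser among vectors with last
  coordinate \<open>1\<close> is the last row of \<open>gsG\<close>; it is negated because the
  residual \<open>A x - b\<close> belongs to the vector \<open>(x, -1)\<close>.\<close>

definition FinC :: "real \<Rightarrow> com" where
  "FinC p = Seq
     (Seq (SetI 6 (INat 0)) (Seq (SetI 7 (V 2)) (Seq (Red p) (Seq (Fill 2 (INat 0) (Cell 1 (V 11) (V 12))) GSc))))
     (For 11 ICols (AssignR (V 11) (RSub (RReal 0) (Cell 3 ICols (V 11)))))"

definition UpdC :: "real \<Rightarrow> nat \<Rightarrow> com" where
  "UpdC p L = Seq (PrmC L) (Seq (RowC (INat 0) (INat 0)) (InsC p L))"

definition QrySC :: "real \<Rightarrow> nat \<Rightarrow> com" where
  "QrySC p L = Seq (PrmC L) (FinC p)"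

definition QryDC :: "real \<Rightarrow> nat \<Rightarrow> com" where
  "QryDC p L = Seq (Seq (PrmC L) LoadC) (FinC p)"

text \<open>Message 0 is a memory image and message 1 a flattened block of rows. The rows are
  inserted into the loaded state one after the other, and the new memory image is sent on.\<close>

definition MrgC :: "real \<Rightarrow> nat \<Rightarrow> com" where
  "MrgC p L = Seq (PrmC L) (Seq LoadC (Seq (SetI 13 (INat 0)) (Seq
     (While (BLessI (V 13) (IMsgLen (INat 1)))
       (Seq (RowC (INat 1) (V 13)) (Seq (InsC p L) (SetI 13 (IAdd (V 13) De)))))
     (SetI 0 sizeE))))"

text \<open>A leaf only forwards its rows, which fit the storage bound because a block has at most
  \<open>n powr \<gamma>\<close> of them. All reduction is left to the parent.\<close>

definition LeafC :: com where
  "LeafC = Seq (For 13 IMsgs (For 14 De (AssignR (IAdd (IMul (V 13) De) (V 14)) (RMsg (V 13) (V 14)))))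
     (SetI 0 (IMul IMsgs De))"

lemma cell_size:
  fixes D :: nat
  assumes "i < R" "j < D" "q < 16"
  shows "16 * (i * D + j) + q < 16 * (R * D)"
proof -
  have "16 * x + q < 16 * y" if "x < y" for x y :: nat using that assms(3) by linarith
  then show ?thesis using cell_less[OF assms(1,2)] by blast
qed

lemma less_cell: "k < y \<Longrightarrow> k \<noteq> 16 * (y + a) + q" for k y :: nat
  by simp

lemma concat_nth_uniform:
  assumes "\<And>r. r \<in> set rs \<Longrightarrow> length r = D" "k < length rs" "a < D"
  shows "concat rs ! (k * D + a) = rs ! k ! a \<and> k * D + a < length (concat rs)"
  using assms
proof (induction rs arbitrary: k)
  case (Cons r rs)
  then have "length r = D" by simp
  with Cons show ?case
    by (cases k) (auto simp: nth_append add.assoc)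
qed simp

lemma length_concat_uniform: "(\<And>r. r \<in> set rs \<Longrightarrow> length r = D) \<Longrightarrow> length (concat rs) = length rs * D"
  by (induction rs) auto

lemma state_ok_cong: "\<mu>' 0 = \<mu> 0 \<Longrightarrow> \<mu>' 7 = \<mu> 7 \<Longrightarrow> state_ok p D B L Rs \<mu>' = state_ok p D B L Rs \<mu>"
  by (simp add: state_ok_def levels_ok_def good_level_def slot_def)

lemma state_ok_Nil:
  assumes "0 < B"
  shows "state_ok p D B L [] (\<lambda>_ _ _. 0)"
proof -
  have "good_level p D B (\<lambda>_ _ _. 0) l 0 (\<lambda>_. 0)" for l
    using assms by (intro good_level_zero) (simp_all add: slot_def)
  then have "levels_ok p D B L (\<lambda>_ _ _. 0) 0 (\<lambda>_. 0)"
    unfolding levels_ok_def by (intro exI[of _ "\<lambda>_. 0"] exI[of _ "\<lambda>_ _. 0"]) simp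
  moreover have "psd D (slot D (\<lambda>_ _ _. 0) 0)" "qf D (slot D (\<lambda>_ _ _. 0) 0) x = 0" for x
    by (auto intro!: psd_zero_form qf_zero_form simp: slot_def)
  ultimately show ?thesis by (simp add: state_ok_def Phi_def[abs_def])
qed

lemma state_psd:
  assumes "state_ok p D B L Rs \<mu>" "i < (if B < D then 1 else L * B)"
  shows "psd D (slot D \<mu> i)"
proof (cases "B < D")
  case False
  then obtain cnt \<psi> where g: "\<And>l. l < L \<Longrightarrow> good_level p D B \<mu> l (cnt l) (\<psi> l)"
    using assms unfolding state_ok_def levels_ok_def by auto
  have i: "i < L * B" using assms False by simp
  then have "B \<noteq> 0" by (cases B) auto
  then have "i div B < L" "i mod B < B" using i by (simp_all add: less_mult_imp_div_less)
  then have "psd D (slot D \<mu> (i div B * B + i mod B))" using g unfolding good_level_def by blast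
  then show ?thesis by simp
qed (use assms in \<open>auto simp: state_ok_def\<close>)

context summary
begin

lemma iv_ipow [simp]: "iv \<rho> (ipow e k) = iv \<rho> e ^ k"
  by (induction k) simp_all

lemma isp_ipow: "isp \<rho> (ipow e k) \<le> isp \<rho> e"
  by (induction k) simp_all

lemma wp_Prm:
  assumes "\<And>\<rho>'. agree {1, 2} \<rho> \<rho>' \<Longrightarrow> \<rho>' 1 = B \<Longrightarrow> \<rho>' 2 = NS \<Longrightarrow> P \<rho>' \<mu>"
  shows "wp (PrmC L) P \<rho> \<mu>"
  unfolding PrmC_def
proof (rule wp_Seq, rule wp_SetI)
  have isp: "isp \<rho>' (ipow (V 1) L) \<le> M" for \<rho>'
    using isp_ipow[of \<rho>' "V 1" L] M64 by simp
  show "wp (Seq (While (BNot (BLessI IRows (ipow (V 1) L))) (SetI 1 (IAdd (V 1) (INat 1))))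
     (If (BLessI (V 1) De) (SetI 2 (INat 1)) (SetI 2 (IMul (INat L) (V 1))))) P (\<rho>(1 := iv \<rho> (INat 0))) \<mu>"
  proof (rule wp_Seq, rule wp_While[where N = B and I = "\<lambda>k \<rho>' \<mu>'. agree {1, 2} \<rho> \<rho>' \<and> \<mu>' = \<mu> \<and> \<rho>' 1 = k"])
    fix k \<rho>1 \<mu>1 assume k: "k < B" "agree {1, 2} \<rho> \<rho>1 \<and> \<mu>1 = \<mu> \<and> \<rho>1 1 = k"
    then show "bok \<rho>1 (BNot (BLessI IRows (ipow (V 1) L))) \<and> be \<rho>1 \<mu>1 (BNot (BLessI IRows (ipow (V 1) L))) \<and>
       wp (SetI 1 (IAdd (V 1) (INat 1))) (\<lambda>\<rho>' \<mu>'. agree {1, 2} \<rho> \<rho>' \<and> \<mu>' = \<mu> \<and> \<rho>' 1 = Suc k) \<rho>1 \<mu>1"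
      using n_ge[OF k(1)] isp M64 by (auto intro!: wp_SetI simp: agree_upd)
  next
    fix \<rho>1 \<mu>1 assume k: "agree {1, 2} \<rho> \<rho>1 \<and> \<mu>1 = \<mu> \<and> \<rho>1 1 = B"
    moreover have "wp (If (BLessI (V 1) De) (SetI 2 (INat 1)) (SetI 2 (IMul (INat L) (V 1)))) P \<rho>1 \<mu>1"
      using k NS M64 by (intro wp_If wp_SetI) (auto intro!: assms simp: agree_upd)
    ultimately show "bok \<rho>1 (BNot (BLessI IRows (ipow (V 1) L))) \<and> \<not> be \<rho>1 \<mu>1 (BNot (BLessI IRows (ipow (V 1) L))) \<and>
       wp (If (BLessI (V 1) De) (SetI 2 (INat 1)) (SetI 2 (IMul (INat L) (V 1)))) P \<rho>1 \<mu>1"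
      using n_less isp by simp
  qed (use W2 in \<open>auto simp: agree_def\<close>)
qed (use M64 in auto)

lemma wp_Row:
  assumes sp: "isp \<rho> i \<le> M" "isp \<rho> off \<le> M"
    and cst: "\<And>k. iv (\<rho>(11 := k)) i = iv \<rho> i" "\<And>k. iv (\<rho>(11 := k)) off = iv \<rho> off"
      "\<And>k. isp (\<rho>(11 := k)) i = isp \<rho> i" "\<And>k. isp (\<rho>(11 := k)) off = isp \<rho> off"
    and r: "iv \<rho> i < length (msgs_of \<iota>)"
      "\<And>a. a < D \<Longrightarrow> iv \<rho> off + a < length (msgs_of \<iota> ! iv \<rho> i) \<and> msgs_of \<iota> ! iv \<rho> i ! (iv \<rho> off + a) = r ! a"
    and P: "\<And>\<rho>' \<mu>'. agree {11} \<rho> \<rho>' \<Longrightarrow> (\<And>q. q \<noteq> 10 \<Longrightarrow> \<mu>' q = \<mu> q) \<Longrightarrow>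
      (\<And>a. a < D \<Longrightarrow> \<mu>' 10 0 a = r ! a) \<Longrightarrow> P \<rho>' \<mu>'"
  shows "wp (RowC i off) P \<rho> \<mu>"
  unfolding RowC_def
proof (rule wp_For[where N = D and I = "\<lambda>k \<rho>' \<mu>'. \<rho>' = \<rho>(11 := k) \<and> (\<forall>q. q \<noteq> 10 \<longrightarrow> \<mu>' q = \<mu> q) \<and>
     (\<forall>a<k. \<mu>' 10 0 a = r ! a)"], goal_cases)
  case k: (5 k \<rho>1 \<mu>1)
  show ?case
  proof (rule wp_SetA)
    have v: "re \<rho>1 \<mu>1 (RMsg i (IAdd off (V 11))) = r ! k"
      using k r(1) r(2)[OF k(1)] cst[of k] by (simp add: Let_def)
    show "\<rho>1 11 = k \<and> \<rho>1(11 := Suc k) = \<rho>(11 := Suc k) \<and>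
       (\<forall>q. q \<noteq> 10 \<longrightarrow> upd3 \<mu>1 10 (iv \<rho>1 (INat 0)) (iv \<rho>1 (V 11)) (re \<rho>1 \<mu>1 (RMsg i (IAdd off (V 11)))) q = \<mu> q) \<and>
       (\<forall>a<Suc k. upd3 \<mu>1 10 (iv \<rho>1 (INat 0)) (iv \<rho>1 (V 11)) (re \<rho>1 \<mu>1 (RMsg i (IAdd off (V 11)))) 10 0 a = r ! a)"
      unfolding v using k by (auto simp: upd3_def fun_eq_iff less_Suc_eq)
  qed (use k sp cst[of k] R0 M64 in auto)
qed (use P D_W M64 in \<open>auto simp: agree_def\<close>)

lemma run_Upd:
  assumes m: "msgs_of \<iota> = [r]" "length r = D" and ok: "state_ok p D B L Rs (view s)"
    and len: "length Rs < rows_of \<iota>"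
  shows "run (UpdC p L) s (\<lambda>s'. state_ok p D B L (Rs @ [r]) (view s'))"
proof (rule wpD[where P = "\<lambda>_ \<mu>'. state_ok p D B L (Rs @ [r]) \<mu>'"])
  show "wp (UpdC p L) (\<lambda>_ \<mu>'. state_ok p D B L (Rs @ [r]) \<mu>') (fst s) (view s)"
    unfolding UpdC_def
  proof (rule wp_Seq, rule wp_Prm, rule wp_Seq, rule wp_Row[where r = r])
    fix \<rho>1 \<rho>2 \<mu>2
    assume 1: "\<rho>1 1 = B" "agree {11} \<rho>1 \<rho>2" and 2: "\<And>q. q \<noteq> 10 \<Longrightarrow> \<mu>2 q = view s q" "\<And>a. a < D \<Longrightarrow> \<mu>2 10 0 a = r ! a"
    show "wp (InsC p L) (\<lambda>_ \<mu>'. state_ok p D B L (Rs @ [r]) \<mu>') \<rho>2 \<mu>2"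
    proof (rule wp_Ins[where Rs = Rs and r = r])
      show "state_ok p D B L Rs \<mu>2" using ok 2(1) state_ok_cong[of \<mu>2 "view s"] by simp
    qed (use 1 2 len in \<open>auto simp: agree_def\<close>)
  qed (use m in auto)
qed

lemma sizeE_val: "\<rho> 2 = NS \<Longrightarrow> iv \<rho> sizeE = 16 * (R * D)"
  by (simp add: sizeE_def R_eq)

lemma sizeE_isp: "isp \<rho> sizeE \<le> M"
  using M64 by (simp add: sizeE_def)

definition msg0 :: "nat \<Rightarrow> real" where
  "msg0 k = (if 0 < length (msgs_of \<iota>) \<and> k < length (msgs_of \<iota> ! 0) then msgs_of \<iota> ! 0 ! k else 0)"

text \<open>The memory agrees with \<open>msg0\<close> only below \<open>16 * (R * D)\<close>, but
  these are all the cells that \<open>view\<close> reads.\<close>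

lemma wp_Load:
  assumes "\<rho> 2 = NS" and P: "\<And>\<rho>'. agree {14} \<rho> \<rho>' \<Longrightarrow> P \<rho>' (view (\<rho>', msg0))"
  shows "wp LoadC P \<rho> \<mu>"
  unfolding wp_def LoadC_def
proof (intro allI impI, rule run_For[where N = "16 * (R * D)" and
      I = "\<lambda>k s'. agree {14} \<rho> (fst s') \<and> (\<forall>i<k. snd s' i = msg0 i)"])
  fix k and s1 :: store
  assume k: "k < 16 * (R * D)" "agree {14} \<rho> (fst s1) \<and> (\<forall>i<k. snd s1 i = msg0 i)" "fst s1 14 = k"
  show "run (AssignR (V 14) (RMsg (INat 0) (V 14))) s1 (\<lambda>s'. fst s' 14 = k \<and> agree {14} \<rho> (fst ((fst s')(14 := Suc k), snd s')) \<and>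
      (\<forall>i<Suc k. snd ((fst s')(14 := Suc k), snd s') i = msg0 i))"
    using k M64 M_R by (intro run_AssignR) (auto simp: agree_upd msg0_def Let_def less_Suc_eq)
next
  fix s1 :: store
  assume 1: "agree {14} \<rho> (fst s1) \<and> (\<forall>i<16 * (R * D). snd s1 i = msg0 i)"
  have "view s1 = view (fst s1, msg0)"
  proof (intro ext)
    fix q i j
    show "view s1 q i j = view (fst s1, msg0) q i j"
    proof (cases "q < 16 \<and> i < R \<and> j < D")
      case True
      then have "16 * (i * D + j) + q < 16 * (R * D)" using cell_size by blast
      then show ?thesis using 1 True by (simp add: view_def)
    qed (simp add: view_range)
  qed
  then show "P (fst s1) (view s1)" using 1 P by simp
qed (use assms W4 sizeE_val sizeE_isp in \<open>auto simp: agree_def\<close>)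

lemma view_msg0_map:
  assumes "msgs_of \<iota> = map g [0..<16 * (R * D)] # ms"
  shows "view (\<rho>, msg0) = view (\<rho>', g)"
proof (intro ext)
  fix q i j
  show "view (\<rho>, msg0) q i j = view (\<rho>', g) q i j"
  proof (cases "q < 16 \<and> i < R \<and> j < D")
    case True
    then have "16 * (i * D + j) + q < 16 * (R * D)" using cell_size by blast
    then show ?thesis using assms True by (simp add: view_def msg0_def)
  qed (simp add: view_range)
qed

lemma view_msg0_Nil: "msgs_of \<iota> = [] \<Longrightarrow> view (\<rho>, msg0) = (\<lambda>_ _ _. 0)"
  by (auto simp: view_def msg0_def fun_eq_iff)

text \<open>\<open>Rs\<close> are the rows already summarised in message 0 and \<open>rs\<close>
  those of message 1; an absent message 1 counts as an empty block.\<close>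

lemma run_Mrg:
  assumes ok: "\<And>\<rho>. state_ok p D B L Rs (view (\<rho>, msg0))"
    and rs: "\<And>r. r \<in> set rs \<Longrightarrow> length r = D" "length Rs + length rs \<le> rows_of \<iota>" "length rs \<le> W"
    and m: "(if 1 < length (msgs_of \<iota>) then msgs_of \<iota> ! 1 else []) = concat rs"
  shows "run (MrgC p L) s (\<lambda>s'. fst s' 0 = 16 * (R * D) \<and> state_ok p D B L (Rs @ rs) (view s'))"
proof (rule wpD[where P = "\<lambda>\<rho>' \<mu>'. \<rho>' 0 = 16 * (R * D) \<and> state_ok p D B L (Rs @ rs) \<mu>'"])
  let ?P = "\<lambda>\<rho>' \<mu>'. \<rho>' 0 = 16 * (R * D) \<and> state_ok p D B L (Rs @ rs) \<mu>'"
  have ml: "iv \<rho>' (IMsgLen (INat 1)) = length rs * D" for \<rho>'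
    using m length_concat_uniform[of rs D] rs(1) by (auto simp: Let_def split: if_splits)
  show "wp (MrgC p L) ?P (fst s) (view s)"
    unfolding MrgC_def
  proof (rule wp_Seq, rule wp_Prm, rule wp_Seq, rule wp_Load, assumption, rule wp_Seq, rule wp_SetI)
    fix \<rho>1 \<rho>2
    assume 1: "\<rho>1 1 = B" "\<rho>1 2 = NS" "agree {14} \<rho>1 \<rho>2"
    show "wp (Seq (While (BLessI (V 13) (IMsgLen (INat 1)))
       (Seq (RowC (INat 1) (V 13)) (Seq (InsC p L) (SetI 13 (IAdd (V 13) De)))))
       (SetI 0 sizeE)) ?P (\<rho>2(13 := iv \<rho>2 (INat 0))) (view (\<rho>2, msg0))"
    proof (rule wp_Seq, rule wp_While[where N = "length rs" and I = "\<lambda>k \<rho>' \<mu>'. \<rho>' 1 = B \<and> \<rho>' 2 = NS \<and>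
         \<rho>' 13 = k * D \<and> state_ok p D B L (Rs @ take k rs) \<mu>'"])
      fix k and \<rho>3 :: "nat \<Rightarrow> nat" and \<mu>3
      assume k: "k < length rs" "\<rho>3 1 = B \<and> \<rho>3 2 = NS \<and> \<rho>3 13 = k * D \<and> state_ok p D B L (Rs @ take k rs) \<mu>3"
      have m1: "1 < length (msgs_of \<iota>)" "msgs_of \<iota> ! 1 = concat rs"
      proof -
        have "rs ! k \<in> set rs" using k by simp
        then have "concat rs \<noteq> []" using rs(1) D0 by fastforce
        then show "1 < length (msgs_of \<iota>)" using m by (auto split: if_splits)
        then show "msgs_of \<iota> ! 1 = concat rs" using m by simp
      qed
      have "wp (Seq (RowC (INat 1) (V 13)) (Seq (InsC p L) (SetI 13 (IAdd (V 13) De))))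
        (\<lambda>\<rho>' \<mu>'. \<rho>' 1 = B \<and> \<rho>' 2 = NS \<and> \<rho>' 13 = Suc k * D \<and> state_ok p D B L (Rs @ take (Suc k) rs) \<mu>') \<rho>3 \<mu>3"
      proof (rule wp_Seq, rule wp_Row[where r = "rs ! k"])
        fix \<rho>4 \<mu>4
        assume 4: "agree {11} \<rho>3 \<rho>4" "\<And>q. q \<noteq> 10 \<Longrightarrow> \<mu>4 q = \<mu>3 q" "\<And>a. a < D \<Longrightarrow> \<mu>4 10 0 a = rs ! k ! a"
        show "wp (Seq (InsC p L) (SetI 13 (IAdd (V 13) De)))
          (\<lambda>\<rho>' \<mu>'. \<rho>' 1 = B \<and> \<rho>' 2 = NS \<and> \<rho>' 13 = Suc k * D \<and> state_ok p D B L (Rs @ take (Suc k) rs) \<mu>') \<rho>4 \<mu>4"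
        proof (rule wp_Seq, rule wp_Ins[where Rs = "Rs @ take k rs" and r = "rs ! k"])
          show "state_ok p D B L (Rs @ take k rs) \<mu>4" using k 4(2) state_ok_cong[of \<mu>4 \<mu>3] by simp
          fix \<rho>5 \<mu>5
          assume 5: "agree {3, 4, 5, 6, 7, 8, 9, 10, 11, 12} \<rho>4 \<rho>5" "state_ok p D B L ((Rs @ take k rs) @ [rs ! k]) \<mu>5"
          then show "wp (SetI 13 (IAdd (V 13) De)) (\<lambda>\<rho>' \<mu>'. \<rho>' 1 = B \<and> \<rho>' 2 = NS \<and> \<rho>' 13 = Suc k * D \<and>
              state_ok p D B L (Rs @ take (Suc k) rs) \<mu>') \<rho>5 \<mu>5"
            using k 4(1) M64 by (intro wp_SetI) (auto simp: agree_def take_Suc_conv_app_nth)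
        qed (use k 4 rs in \<open>auto simp: agree_def\<close>)
      next
        fix a assume "a < D"
        then show "iv \<rho>3 (V 13) + a < length (msgs_of \<iota> ! iv \<rho>3 (INat 1)) \<and>
          msgs_of \<iota> ! iv \<rho>3 (INat 1) ! (iv \<rho>3 (V 13) + a) = rs ! k ! a"
          using concat_nth_uniform[OF rs(1) k(1), of a] k m1 by simp
      qed (use k m1 M64 in auto)
      moreover have "k * D < length rs * D" using k D0 by simp
      ultimately show "bok \<rho>3 (BLessI (V 13) (IMsgLen (INat 1))) \<and> be \<rho>3 \<mu>3 (BLessI (V 13) (IMsgLen (INat 1))) \<and>
        wp (Seq (RowC (INat 1) (V 13)) (Seq (InsC p L) (SetI 13 (IAdd (V 13) De))))
        (\<lambda>\<rho>' \<mu>'. \<rho>' 1 = B \<and> \<rho>' 2 = NS \<and> \<rho>' 13 = Suc k * D \<and> state_ok p D B L (Rs @ take (Suc k) rs) \<mu>') \<rho>3 \<mu>3"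
        using k ml M64 by (simp del: iv_IMsgLen)
    next
      fix \<rho>3 :: "nat \<Rightarrow> nat" and \<mu>3
      assume k: "\<rho>3 1 = B \<and> \<rho>3 2 = NS \<and> \<rho>3 13 = length rs * D \<and> state_ok p D B L (Rs @ take (length rs) rs) \<mu>3"
      then have "wp (SetI 0 sizeE) ?P \<rho>3 \<mu>3"
        using sizeE_val[of \<rho>3] sizeE_isp by (intro wp_SetI) auto
      then show "bok \<rho>3 (BLessI (V 13) (IMsgLen (INat 1))) \<and> \<not> be \<rho>3 \<mu>3 (BLessI (V 13) (IMsgLen (INat 1))) \<and>
        wp (SetI 0 sizeE) ?P \<rho>3 \<mu>3"
        using k ml M64 by (simp del: iv_IMsgLen)
    qed (use 1 ok[of \<rho>2] rs(3) in \<open>auto simp: agree_def\<close>)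
  qed (use M64 in auto)
qed

lemma run_Leaf:
  assumes m: "msgs_of \<iota> = rs" "\<And>r. r \<in> set rs \<Longrightarrow> length r = D" "length rs * D \<le> M" "length rs \<le> W"
  shows "run LeafC s (\<lambda>s'. summary_of s' = concat rs)"
  unfolding LeafC_def
proof (rule run_Seq, rule run_For[where N = "length rs" and I = "\<lambda>k s'. \<forall>i<k. \<forall>a<D. snd s' (i * D + a) = rs ! i ! a"], goal_cases)
  case k: (5 k s1)
  show ?case
  proof (rule run_For[where N = D and I = "\<lambda>j s'. fst s' 13 = k \<and> (\<forall>i<k. \<forall>a<D. snd s' (i * D + a) = rs ! i ! a) \<and>
       (\<forall>a<j. snd s' (k * D + a) = rs ! k ! a)"], goal_cases)
    case j: (5 j s2)
    have kj: "k * D + j < length rs * D" using cell_less[OF k(1) j(1)] .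
    have v: "re (fst s2) (view s2) (RMsg (V 13) (V 14)) = rs ! k ! j"
      using j k m by (simp add: Let_def)
    have ne: "i * D + a \<noteq> k * D + j" if "i < k" "a < D" for i a
      using cell_less[OF that] by simp
    show ?case
    proof (rule run_AssignR, goal_cases)
      case 4
      then show ?case unfolding v using j ne by (auto simp: less_Suc_eq)
    qed (use j kj m M64 in auto)
  qed (use k D_W M64 in \<open>auto simp: less_Suc_eq\<close>)
next
  fix s1 :: store
  assume 1: "\<forall>i<length rs. \<forall>a<D. snd s1 (i * D + a) = rs ! i ! a"
  have "summary_of ((fst s1)(0 := length rs * D), snd s1) = concat rs"
  proof (rule nth_equalityI)
    show "length (summary_of ((fst s1)(0 := length rs * D), snd s1)) = length (concat rs)"
      using length_concat_uniform[of rs D] m(2) by (simp add: summary_of_def)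
    fix c assume "c < length (summary_of ((fst s1)(0 := length rs * D), snd s1))"
    then have c: "c < length rs * D" by (simp add: summary_of_def)
    then have cd: "c div D < length rs" "c mod D < D" using D0 by (auto simp: less_mult_imp_div_less)
    then have "snd s1 (c div D * D + c mod D) = rs ! (c div D) ! (c mod D)" using 1 by blast
    with cd have "snd s1 (c div D * D + c mod D) = concat rs ! (c div D * D + c mod D)"
      using concat_nth_uniform[where rs = rs and D = D and k = "c div D" and a = "c mod D"] m(2) by simp
    then show "summary_of ((fst s1)(0 := length rs * D), snd s1) ! c = concat rs ! c"
      using c by (simp add: summary_of_def)
  qed
  then show "run (SetI 0 (IMul IMsgs De)) s1 (\<lambda>s'. summary_of s' = concat rs)"
    using m M64 by (intro run_AssignI) auto
qed (use m M64 in auto)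

lemma run_Fin:
  assumes ok: "state_ok p D B L Rs (view s)" and r: "fst s 2 = NS"
  shows "run (FinC p) s (\<lambda>s'. \<exists>Q. psd D Q \<and> (\<forall>a<D - 1. snd s' a = - gsG D Q (D - 1) a) \<and>
     (\<forall>x. approx (lam p D) (qf D Q x powr (p / 2)) (\<Sum>i<NS. qf D (slot D (view s) i) x powr (p / 2))))"
proof -
  define \<mu> where "\<mu> = view s"
  define Q where "Q = wavg p D NS (slot D \<mu>)"
  have psdF: "psd D (slot D \<mu> j)" if "j < NS" for j
    using state_psd[OF ok, of j] that NS by (simp add: \<mu>_def)
  have NS0: "0 < NS" using NS L0 B0 by simp
  have mF: "merging p D NS (slot D \<mu>)" using p1 D0 NS0 psdF by unfold_locales
  let ?\<rho> = "(fst s)(6 := 0, 7 := NS)"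
  have sF: "(\<lambda>j a b. \<mu> 0 ((?\<rho> 6 + j) * D + a) b) = slot D \<mu>" by (simp add: slot_def fun_eq_iff)
  have a: "approx (lam p D) (qf D Q x powr (p / 2)) (\<Sum>i<NS. qf D (slot D \<mu> i) x powr (p / 2))" for x
    unfolding Q_def by (rule wavg_approx[OF mF p2])
  have psdQ: "psd D Q" unfolding Q_def by (rule merging.psd_wavg[OF mF])
  let ?L = "For 11 ICols (AssignR (V 11) (RSub (RReal 0) (Cell 3 ICols (V 11))))"
  let ?post = "\<lambda>s'. \<forall>a<D - 1. snd s' a = - gsG D Q (D - 1) a"
  let ?pre = "\<lambda>(\<rho>' :: nat \<Rightarrow> nat) \<mu>'. \<forall>a<D - 1. \<mu>' 3 (D - 1) a = gsG D Q (D - 1) a"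
  have d: "cols_of \<iota> = D - 1" unfolding D_eq by (simp only: diff_Suc_1)
  have last: "run ?L s1 ?post" if s1: "?pre (fst s1) (view s1)" for s1
  proof (rule run_For[where N = "D - 1" and I = "\<lambda>k s'. (\<forall>a<k. snd s' a = - gsG D Q (D - 1) a) \<and> ?pre (fst s') (view s')"])
    fix k and s2 :: store
    assume k: "k < D - 1" "(\<forall>a<k. snd s2 a = - gsG D Q (D - 1) a) \<and> ?pre (fst s2) (view s2)" "fst s2 11 = k"
    have DR: "D - 1 < R" "k < D" using D_R D0 k by auto
    have kM: "k < M" using cell_M[of 0 k 0] DR by simp
    have v: "re (fst s2) (view s2) (RSub (RReal 0) (Cell 3 ICols (V 11))) = - gsG D Q (D - 1) k"
      using k d DR by (simp add: re_Cell)
    \<comment> \<open>The output overwrites raw cells of the interleaved matrices, but only cells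
      below \<open>d\<close>; the row of \<open>gsG\<close> still to be read lies at higher
      addresses.\<close>
    have keep: "view (\<rho>', (snd s2)(k := x)) 3 (D - 1) a = view s2 3 (D - 1) a" if "a < D - 1" for \<rho>' x a
    proof -
      have "k < (D - 1) * D" using k(1) D0 by (cases "D - 1") auto
      then have "k \<noteq> 16 * ((D - 1) * D + a) + 3" by (rule less_cell)
      then show ?thesis by (simp add: view_def)
    qed
    show "run (AssignR (V 11) (RSub (RReal 0) (Cell 3 ICols (V 11)))) s2 (\<lambda>s'. fst s' 11 = k \<and>
       (\<forall>a<Suc k. snd ((fst s')(11 := Suc k), snd s') a = - gsG D Q (D - 1) a) \<and>
       ?pre (fst ((fst s')(11 := Suc k), snd s')) (view ((fst s')(11 := Suc k), snd s')))"
    proof (rule run_AssignR, goal_cases)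
      case 4
      then show ?case unfolding v using k keep by (auto simp: less_Suc_eq)
    qed (use k kM M64 DR d in auto)
  qed (use s1 d D_W M64 in \<open>auto simp: view_fst\<close>)
  have "wp (Red p) (\<lambda>\<rho>' \<mu>'. wp (Seq (Fill 2 (INat 0) (Cell 1 (V 11) (V 12))) GSc) ?pre \<rho>' \<mu>') ?\<rho> \<mu>"
  proof (rule wp_Red[where m = NS and \<rho> = ?\<rho> and \<mu> = \<mu>, unfolded sF])
    fix \<rho>1 and \<mu>1 :: mats
    assume X: "\<And>a b. a < D \<Longrightarrow> b < D \<Longrightarrow> \<mu>1 1 a b = wavg p D NS (slot D \<mu>) a b"
    show "wp (Seq (Fill 2 (INat 0) (Cell 1 (V 11) (V 12))) GSc) ?pre \<rho>1 \<mu>1"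
    proof (rule wp_Seq, rule wp_Fill[where b = 0 and g = Q])
      fix n k and \<rho>2 :: "nat \<Rightarrow> nat" assume "n < D" "k < D" "\<rho>2 11 = n" "\<rho>2 12 = k"
      then show "rok \<rho>2 (Cell 1 (V 11) (V 12)) \<and> re \<rho>2 (fillmem \<mu>1 2 0 Q n k) (Cell 1 (V 11) (V 12)) = Q n k"
        using X D_R M64 by (simp add: re_Cell fillmem_def Q_def)
    next
      fix \<rho>2
      show "wp GSc ?pre \<rho>2 (fillmem \<mu>1 2 0 Q D 0)"
      proof (rule wp_GS[where Q = Q])
        show "?pre \<rho>3 (gsmem (fillmem \<mu>1 2 0 Q D 0) Q D 0 0)" for \<rho>3
          using D0 by (auto simp: gsmem_def)
      qed (simp add: fillmem_def)
    qed (use D_R in auto)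
  qed (use p1 p2 NS0 psdF[unfolded slot_def] W1 R_eq in auto)
  then have "wp (Seq (SetI 6 (INat 0)) (Seq (SetI 7 (V 2)) (Seq (Red p) (Seq (Fill 2 (INat 0) (Cell 1 (V 11) (V 12))) GSc)))) ?pre (fst s) \<mu>"
    using r M64 by (intro wp_Seq wp_SetI) auto
  then have "run (Seq (SetI 6 (INat 0)) (Seq (SetI 7 (V 2)) (Seq (Red p) (Seq (Fill 2 (INat 0) (Cell 1 (V 11) (V 12))) GSc)))) s
     (\<lambda>s'. ?pre (fst s') (view s'))"
    unfolding \<mu>_def by (rule wpD)
  then have "run (FinC p) s ?post"
    unfolding FinC_def by - (rule run_Seq, rule run_weaken, assumption, rule last)
  then show ?thesis
    by (rule run_weaken) (use psdQ a in \<open>auto simp: \<mu>_def\<close>)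
qed

end

section \<open>Error analysis\<close>

text \<open>The guarantee is in powers of \<open>D = d + 1\<close>, while \<open>lam\<close> is a
  power of \<open>D + 1\<close>; the conversion \<open>D + 1 \<le> D * D\<close> needs
  \<open>2 \<le> D\<close>.\<close>

lemma lam_powr:
  assumes "1 \<le> p" "2 \<le> D"
  shows "lam p D ^ k \<le> real D powr (2 * (5 + p) * real k)"
proof -
  have "2 * D \<le> D * D" using assms(2) by (intro mult_le_mono1)
  then have "D + 1 \<le> D * D" using assms(2) by linarith
  then have "real (D + 1) \<le> real D * real D" by (metis of_nat_le_iff of_nat_mult)
  also have "\<dots> = real D powr 2" using assms(2) by (simp add: power2_eq_square)
  finally have "lam p D \<le> (real D powr 2) powr (5 + p)"
    unfolding lam_def using assms(1) by (intro powr_mono2) auto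
  then have "lam p D \<le> real D powr (2 * (5 + p))" by (simp only: powr_powr)
  then have "lam p D ^ k \<le> (real D powr (2 * (5 + p))) ^ k"
    using lam_ge1[OF assms(1), of D] by (intro power_mono) auto
  also have "\<dots> = real D powr (2 * (5 + p) * real k)"
    using assms(2) by (simp add: powr_realpow[symmetric] powr_powr)
  finally show ?thesis .
qed

text \<open>Every single term is bounded by the whole of the other sum. The loss is polynomial in
  the number of terms, which is affordable only because it is used with fewer than
  \<open>D ^ L\<close> rows.\<close>

lemma l2_lp_approx:
  fixes ts :: "real list"
  assumes "1 \<le> p" "ts \<noteq> []"
  shows "approx (real (length ts) powr p) ((\<Sum>t\<leftarrow>ts. t\<^sup>2) powr (p / 2)) (\<Sum>t\<leftarrow>ts. \<bar>t\<bar> powr p)"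
proof -
  let ?n = "real (length ts)" and ?S = "\<Sum>t\<leftarrow>ts. t\<^sup>2" and ?P = "\<Sum>t\<leftarrow>ts. \<bar>t\<bar> powr p"
  have n: "1 \<le> ?n" using assms(2) by (cases ts) auto
  have S0: "0 \<le> ?S" and P0: "0 \<le> ?P" by (auto intro!: sum_list_nonneg)
  have sq: "t\<^sup>2 = \<bar>t\<bar> powr 2" for t :: real by (cases "t = 0") simp_all
  have "?P \<le> (\<Sum>t\<leftarrow>ts. ?S powr (p / 2))"
  proof (intro sum_list_mono)
    fix t assume "t \<in> set ts"
    then have "t\<^sup>2 \<le> ?S" by (intro member_le_sum_list) auto
    then have "(t\<^sup>2) powr (p / 2) \<le> ?S powr (p / 2)" using assms(1) by (intro powr_mono2) auto
    then show "\<bar>t\<bar> powr p \<le> ?S powr (p / 2)" unfolding sq by (simp only: powr_powr) simp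
  qed
  also have "\<dots> = ?n * ?S powr (p / 2)" by (simp add: sum_list_triv)
  also have "\<dots> \<le> ?n powr p * ?S powr (p / 2)"
    using powr_mono[OF assms(1) n] n by (intro mult_right_mono) auto
  finally have 1: "?P \<le> ?n powr p * ?S powr (p / 2)" .
  have "?S \<le> (\<Sum>t\<leftarrow>ts. ?P powr (2 / p))"
  proof (intro sum_list_mono)
    fix t assume "t \<in> set ts"
    then have "\<bar>t\<bar> powr p \<le> ?P" by (intro member_le_sum_list) auto
    then have "(\<bar>t\<bar> powr p) powr (2 / p) \<le> ?P powr (2 / p)" using assms(1) by (intro powr_mono2) auto
    then show "t\<^sup>2 \<le> ?P powr (2 / p)" unfolding sq using assms(1) by (simp add: powr_powr)
  qed
  also have "\<dots> = ?n * ?P powr (2 / p)" by (simp add: sum_list_triv)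
  finally have "?S powr (p / 2) \<le> (?n * ?P powr (2 / p)) powr (p / 2)"
    using S0 assms(1) by (intro powr_mono2) auto
  also have "\<dots> = ?n powr (p / 2) * ?P" using assms(1) n P0 by (simp add: powr_mult powr_powr)
  also have "\<dots> \<le> ?n powr p * ?P"
    using powr_mono[of "p / 2" p ?n] n P0 assms(1) by (intro mult_right_mono) auto
  finally show ?thesis using 1 by (simp add: approx_def)
qed

lemma Phi_nonneg: "0 \<le> Phi p D Rs x"
  unfolding Phi_def by (auto intro!: sum_list_nonneg)

lemma approx_sum:
  assumes "\<And>i. i \<in> I \<Longrightarrow> approx K (u i) (v i)"
  shows "approx K (\<Sum>i\<in>I. u i) (\<Sum>i\<in>I. v i)"
  using assms unfolding approx_def sum_distrib_left by (auto intro: sum_mono)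

lemma state_approx:
  assumes p: "1 \<le> p" and ok: "state_ok p D B L Rs \<mu>" and D: "2 \<le> D"
    and len: "length Rs < B ^ L" "Rs \<noteq> []"
  shows "approx (real D powr (2 * (5 + p) * real L))
     (\<Sum>i<(if B < D then 1 else L * B). qf D (slot D \<mu> i) x powr (p / 2)) (Phi p D Rs x)"
proof (cases "B < D")
  case True
  let ?ts = "map (\<lambda>r. dotp D r x) Rs"
  have "qf D (slot D \<mu> 0) x = (\<Sum>t\<leftarrow>?ts. t\<^sup>2)" using ok True by (simp add: state_ok_def comp_def)
  moreover have "Phi p D Rs x = (\<Sum>t\<leftarrow>?ts. \<bar>t\<bar> powr p)" by (simp add: Phi_def comp_def)
  ultimately have a: "approx (real (length ?ts) powr p) (qf D (slot D \<mu> 0) x powr (p / 2)) (Phi p D Rs x)"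
    using l2_lp_approx[OF p, of ?ts] len(2) by simp
  \<comment> \<open>This is where \<open>B < D\<close> enters: the number of rows itself is
    polynomial in \<open>D\<close>.\<close>
  have "length Rs \<le> D ^ L" using len(1) power_mono[of B D L] True by linarith
  then have "real (length Rs) \<le> real D ^ L" by (metis of_nat_le_iff of_nat_power)
  also have "\<dots> = real D powr real L" using D by (simp add: powr_realpow)
  finally have "real (length Rs) powr p \<le> (real D powr real L) powr p" using p by (intro powr_mono2) auto
  also have "\<dots> = real D powr (real L * p)" by (simp only: powr_powr)
  also have "\<dots> \<le> real D powr (2 * (5 + p) * real L)"
  proof (intro powr_mono)
    have "real L * p \<le> real L * (2 * (5 + p))" using p by (intro mult_left_mono) auto
    then show "real L * p \<le> 2 * (5 + p) * real L" by (simp add: mult_ac)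
  qed (use D in auto)
  finally have "real (length ?ts) powr p \<le> real D powr (2 * (5 + p) * real L)" by simp
  with a show ?thesis using True by (auto intro: approx_mono Phi_nonneg)
next
  case False
  obtain cnt \<psi> where g: "\<And>l. l < L \<Longrightarrow> good_level p D B \<mu> l (cnt l) (\<psi> l)"
    and s: "\<And>x. (\<Sum>l<L. \<psi> l x) = Phi p D Rs x"
    using ok False unfolding state_ok_def levels_ok_def by auto
  let ?f = "\<lambda>i. qf D (slot D \<mu> i) x powr (p / 2)"
  have l1: "1 \<le> lam p D" by (rule lam_ge1[OF p])
  have "(\<Sum>i<L * B. ?f i) = (\<Sum>l<L. sum ?f {l * B..<l * B + B})"
    by (rule sum.nat_group[symmetric])
  also have "\<dots> = (\<Sum>l<L. \<Sum>i<B. ?f (l * B + i))"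
  proof (rule sum.cong[OF refl])
    fix l
    show "sum ?f {l * B..<l * B + B} = (\<Sum>i<B. ?f (l * B + i))"
      using sum.shift_bounds_nat_ivl[of ?f 0 "l * B" B] by (simp add: add.commute lessThan_atLeast0)
  qed
  finally have e: "(\<Sum>i<L * B. ?f i) = (\<Sum>l<L. \<Sum>i<B. ?f (l * B + i))" .
  have "approx (lam p D ^ L) (\<Sum>l<L. \<Sum>i<B. ?f (l * B + i)) (\<Sum>l<L. \<psi> l x)"
  proof (intro approx_sum)
    fix l assume "l \<in> {..<L}"
    then have l: "l < L" by simp
    have a: "approx (lam p D ^ l) (\<Sum>i<B. ?f (l * B + i)) (\<psi> l x)" using g[OF l] by (simp add: good_level_def)
    have u: "0 \<le> (\<Sum>i<B. ?f (l * B + i))" by (intro sum_nonneg) simp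
    have l0: "0 < lam p D ^ l" using l1 by simp
    \<comment> \<open>Nonnegativity of \<open>\<psi>\<close> is not part of the invariant; it
      follows from the approximation, as the forms contribute nonnegative amounts.\<close>
    have "0 \<le> lam p D ^ l * \<psi> l x" using a u unfolding approx_def by linarith
    then have "0 \<le> \<psi> l x" using l0 by (simp only: zero_le_mult_iff) linarith
    then show "approx (lam p D ^ L) (\<Sum>i<B. ?f (l * B + i)) (\<psi> l x)"
      using a u l1 l by (intro approx_mono[OF a]) (auto intro: power_increasing)
  qed
  then have a: "approx (lam p D ^ L) (\<Sum>i<L * B. ?f i) (Phi p D Rs x)" using e s by simp
  have "approx (real D powr (2 * (5 + p) * real L)) (\<Sum>i<L * B. ?f i) (Phi p D Rs x)"
    by (rule approx_mono[OF a lam_powr[OF p D] _ Phi_nonneg]) (simp add: sum_nonneg)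
  then show ?thesis using False by simp
qed

text \<open>The objective is compared with the final form at \<open>x\<close> and at
  \<open>y\<close>, between which the form is minimised exactly. Each comparison costs
  \<open>E\<close>, hence the doubled exponent.\<close>

lemma solution_error:
  assumes p: "1 \<le> p" and ok: "state_ok p D B L Rs \<mu>" and D: "2 \<le> D"
    and len: "length Rs < B ^ L" "Rs \<noteq> []"
    and Q: "psd D Q" "\<And>x. approx (lam p D) (qf D Q x powr (p / 2))
        (\<Sum>i<(if B < D then 1 else L * B). qf D (slot D \<mu> i) x powr (p / 2))"
    and x: "\<And>a. a < D - 1 \<Longrightarrow> x a = - gsG D Q (D - 1) a" "x (D - 1) = - 1"
    and y: "y (D - 1) = - 1"
  shows "Phi p D Rs x \<le> real D powr (4 * (5 + p) * real (L + 1)) * Phi p D Rs y"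
proof -
  define E where "E = real D powr (2 * (5 + p) * real (L + 1))"
  have D0: "0 < D" using D by simp
  have a: "approx E (qf D Q z powr (p / 2)) (Phi p D Rs z)" for z
  proof -
    have "approx (lam p D * real D powr (2 * (5 + p) * real L)) (qf D Q z powr (p / 2)) (Phi p D Rs z)"
      using lam_ge1[OF p, of D] by (intro approx_trans[OF Q(2) state_approx[OF p ok D len]]) auto
    moreover have "lam p D * real D powr (2 * (5 + p) * real L)
        \<le> real D powr (2 * (5 + p)) * real D powr (2 * (5 + p) * real L)"
      using lam_powr[OF p D, of 1] by (intro mult_right_mono) auto
    moreover have "real D powr (2 * (5 + p)) * real D powr (2 * (5 + p) * real L) = E"
      unfolding E_def powr_add[symmetric] by (simp add: algebra_simps)
    ultimately show ?thesis by (intro approx_mono[of _ _ _ E]) (auto intro: Phi_nonneg)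
  qed
  have neg: "qf D Q (\<lambda>a. - z a) = qf D Q z" for z by (simp add: qf_def bf_def)
  have "qf D Q x = qf D Q (\<lambda>a. - gsG D Q (D - 1) a)"
  proof (rule qf_cong)
    fix a assume "a < D"
    then show "x a = - gsG D Q (D - 1) a"
      using x by (cases "a = D - 1") (auto simp: gsG_diag)
  qed simp
  also have "\<dots> = qf D Q (gsG D Q (D - 1))" by (rule neg)
  also have "\<dots> \<le> qf D Q (\<lambda>a. - y a)" using y by (intro gs_minimal[OF Q(1) D0]) simp
  also have "\<dots> = qf D Q y" by (rule neg)
  finally have q: "qf D Q x powr (p / 2) \<le> qf D Q y powr (p / 2)"
    using psd_nonneg[OF Q(1)] p by (intro powr_mono2) auto
  have E0: "0 \<le> E" by (simp add: E_def)
  have "Phi p D Rs x \<le> E * qf D Q x powr (p / 2)" using a[of x] by (simp add: approx_def)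
  also have "\<dots> \<le> E * qf D Q y powr (p / 2)" using q E0 by (rule mult_left_mono)
  also have "\<dots> \<le> E * (E * Phi p D Rs y)" using a[of y] E0 by (intro mult_left_mono) (auto simp: approx_def)
  also have "\<dots> = (E * E) * Phi p D Rs y" by simp
  also have "E * E = real D powr (4 * (5 + p) * real (L + 1))"
    unfolding E_def powr_add[symmetric] by (simp add: algebra_simps)
  finally show ?thesis .
qed

lemma dotp_aug_row:
  assumes A: "A \<in> carrier_mat n d" and b: "b \<in> carrier_vec n" and x: "x \<in> carrier_vec d" and i: "i < n"
  shows "dotp (d + 1) (aug_row A b i) (\<lambda>a. if a < d then x $ a else - 1) = (A *\<^sub>v x - b) $ i"
proof -
  have l: "aug_row A b i ! a = (if a < d then A $$ (i, a) else b $ i)" if "a < Suc d" for a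
    using that A b i by (auto simp: aug_row_def nth_append list_of_vec_index)
  have "dotp (d + 1) (aug_row A b i) (\<lambda>a. if a < d then x $ a else - 1)
      = (\<Sum>a<d. A $$ (i, a) * x $ a) - b $ i"
    unfolding dotp_def using l by simp
  also have "(\<Sum>a<d. A $$ (i, a) * x $ a) = (A *\<^sub>v x) $ i"
    using A x i by (simp add: scalar_prod_def lessThan_atLeast0)
  finally show ?thesis using A b x i by simp
qed

text \<open>Only the multiset of rows matters, so the rows may arrive in the order of an arbitrary
  partition into blocks.\<close>

lemma lp_norm_Phi:
  assumes A: "A \<in> carrier_mat n d" and b: "b \<in> carrier_vec n" and x: "x \<in> carrier_vec d"
    and "mset js = mset [0..<n]"
  shows "lp_norm p (A *\<^sub>v x - b)
    = Phi p (d + 1) (map (aug_row A b) js) (\<lambda>a. if a < d then x $ a else - 1) powr (1 / p)"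
proof -
  let ?f = "\<lambda>i. \<bar>dotp (d + 1) (aug_row A b i) (\<lambda>a. if a < d then x $ a else - 1)\<bar> powr p"
  have "Phi p (d + 1) (map (aug_row A b) js) (\<lambda>a. if a < d then x $ a else - 1) = sum_list (map ?f js)"
    by (simp add: Phi_def comp_def)
  also have "\<dots> = sum_list (map ?f [0..<n])"
  proof -
    have "mset (map ?f js) = mset (map ?f [0..<n])" by (simp only: mset_map assms(4))
    then have "sum_mset (mset (map ?f js)) = sum_mset (mset (map ?f [0..<n]))" by (rule arg_cong)
    then show ?thesis by (simp only: sum_mset_sum_list)
  qed
  also have "\<dots> = (\<Sum>i<n. ?f i)" by (simp add: interv_sum_list_conv_sum_set_nat lessThan_atLeast0)
  also have "\<dots> = (\<Sum>i<n. \<bar>(A *\<^sub>v x - b) $ i\<bar> powr p)"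
    using dotp_aug_row[OF A b x] by (intro sum.cong) auto
  finally show ?thesis using b by (simp add: lp_norm_def)
qed

lemma lp_approx_solutionI:
  assumes "A \<in> carrier_mat n d" "x \<in> carrier_vec d" "0 < \<alpha>"
    and "\<And>y. y \<in> carrier_vec d \<Longrightarrow> lp_norm p (A *\<^sub>v x - b) \<le> \<alpha> * lp_norm p (A *\<^sub>v y - b)"
  shows "lp_approx_solution p \<alpha> A b x"
proof -
  have "lp_norm p (A *\<^sub>v x - b) / \<alpha> \<le> lp_opt p A b"
    unfolding lp_opt_def
  proof (rule cINF_greatest)
    show "carrier_vec (dim_col A) \<noteq> ({} :: real vec set)" using zero_carrier_vec by blast
    fix y :: "real vec" assume "y \<in> carrier_vec (dim_col A)"
    then have "lp_norm p (A *\<^sub>v x - b) \<le> \<alpha> * lp_norm p (A *\<^sub>v y - b)" using assms by auto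
    then show "lp_norm p (A *\<^sub>v x - b) / \<alpha> \<le> lp_norm p (A *\<^sub>v y - b)"
      using assms(3) by (simp add: field_simps)
  qed
  then show ?thesis using assms by (simp add: lp_approx_solution_def field_simps)
qed

text \<open>For \<open>d = 0\<close> the admissible factor is \<open>1\<close> and no approximation
  would do, but there is only one vector. Otherwise the \<open>p\<close>-th root turns the exponent
  \<open>c\<close> into \<open>c / p\<close>, which is at most \<open>c\<close>.\<close>

lemma solution_approx:
  assumes p: "1 \<le> p" and n: "1 \<le> n" and A: "A \<in> carrier_mat n d" and b: "b \<in> carrier_vec n"
    and js: "mset js = mset [0..<n]"
    and ok: "state_ok p (d + 1) B L (map (aug_row A b) js) \<mu>" and len: "n < B ^ L"
    and Q: "psd (d + 1) Q" "\<And>x. approx (lam p (d + 1)) (qf (d + 1) Q x powr (p / 2))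
        (\<Sum>i<(if B < d + 1 then 1 else L * B). qf (d + 1) (slot (d + 1) \<mu> i) x powr (p / 2))"
    and x: "\<And>a. a < d \<Longrightarrow> x $ a = - gsG (d + 1) Q d a" "x \<in> carrier_vec d"
    and \<alpha>: "4 * (5 + p) * real (L + 1) \<le> c"
  shows "lp_approx_solution p (real (d + 1) powr c) A b x"
proof (rule lp_approx_solutionI[OF A x(2)])
  show "0 < real (d + 1) powr c" by simp
  fix y :: "real vec" assume y: "y \<in> carrier_vec d"
  show "lp_norm p (A *\<^sub>v x - b) \<le> real (d + 1) powr c * lp_norm p (A *\<^sub>v y - b)"
  proof (cases "d = 0")
    case True
    then have "x = y" using x(2) y by auto
    then show ?thesis using True by simp
  next
    case False
    let ?Rs = "map (aug_row A b) js" and ?D = "d + 1"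
    let ?x = "\<lambda>a. if a < d then x $ a else - 1" and ?y = "\<lambda>a. if a < d then y $ a else - 1"
    have "length js = n" using js by (metis length_upt size_mset diff_zero)
    then have "Phi p ?D ?Rs ?x \<le> real ?D powr (4 * (5 + p) * real (L + 1)) * Phi p ?D ?Rs ?y"
      using False x(1) n len by (intro solution_error[OF p ok _ _ _ Q]) auto
    also have "\<dots> \<le> real ?D powr c * Phi p ?D ?Rs ?y"
      using \<alpha> by (intro mult_right_mono powr_mono Phi_nonneg) auto
    finally have "Phi p ?D ?Rs ?x powr (1 / p) \<le> (real ?D powr c * Phi p ?D ?Rs ?y) powr (1 / p)"
      using p by (intro powr_mono2) (auto intro: Phi_nonneg)
    also have "\<dots> = real ?D powr (c / p) * Phi p ?D ?Rs ?y powr (1 / p)"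
      by (simp add: powr_mult powr_powr Phi_nonneg)
    also have "\<dots> \<le> real ?D powr c * Phi p ?D ?Rs ?y powr (1 / p)"
    proof (intro mult_right_mono powr_mono)
      have "0 \<le> 4 * (5 + p) * real (L + 1)" using p by simp
      then have "0 \<le> c" using \<alpha> by linarith
      then have "c * 1 \<le> c * p" using p by (intro mult_left_mono) auto
      then show "c / p \<le> c" using p by (simp add: field_simps)
    qed auto
    finally show ?thesis
      unfolding lp_norm_Phi[OF A b x(2) js] lp_norm_Phi[OF A b y js] .
  qed
qed

section \<open>Resource bounds\<close>

definition numlev :: "real \<Rightarrow> nat" where
  "numlev \<gamma> = nat \<lceil>2 / \<gamma>\<rceil>"

text \<open>Coefficient of the loop bound: \<open>W + 1\<close> is at most
  \<open>timec \<gamma>\<close> times the square of \<open>n powr \<gamma> * D\<close>.\<close>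

definition timec :: "real \<Rightarrow> real" where
  "timec \<gamma> = 64 * real (numlev \<gamma>) ^ 2 + real (numlev \<gamma>) + 6"

lemma numlev_ge:
  assumes "0 < \<gamma>"
  shows "0 < numlev \<gamma>" "2 / \<gamma> \<le> real (numlev \<gamma>)" "real (numlev \<gamma>) \<le> 3 * levels \<gamma>"
proof -
  have "0 < 2 / \<gamma>" using assms by simp
  then show "0 < numlev \<gamma>" by (simp add: numlev_def)
  show "2 / \<gamma> \<le> real (numlev \<gamma>)" unfolding numlev_def by (rule real_nat_ceiling_ge)
  have "real (numlev \<gamma>) \<le> 2 / \<gamma> + 1" using \<open>0 < 2 / \<gamma>\<close> unfolding numlev_def by linarith
  moreover have "1 \<le> levels \<gamma>" "1 / \<gamma> \<le> levels \<gamma>" by (simp_all add: levels_def)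
  ultimately show "real (numlev \<gamma>) \<le> 3 * levels \<gamma>" by simp
qed

locale setting =
  fixes p \<gamma> :: real and n d :: nat
  assumes p1: "1 \<le> p" and p2: "p \<noteq> 2" and \<gamma>0: "0 < \<gamma>" and n1: "1 \<le> n"
begin

definition L where "L = numlev \<gamma>"
definition D where "D = d + 1"
definition B where "B = (LEAST B. n < B ^ L)"
definition NS where "NS = (if B < D then 1 else L * B)"
definition R where "R = NS * D"
definition nb where "nb = nat \<lfloor>real n powr \<gamma>\<rfloor>"
definition W where "W = 16 * (NS * NS * D * D) + B + L + nb + D"
definition M where "M = 16 * (R * D) + 64 + nb * D"
text \<open>The messages, at most \<open>16 * (R * D) + nb * D + D\<close> words, plus twice
  \<open>M\<close> for the two memories; this explains the factors \<open>3 = 1 + 2\<close> and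
  \<open>128 = 2 * 64\<close>.\<close>

definition S where "S = 3 * (16 * (R * D)) + 3 * (nb * D) + D + 128"
abbreviation X where "X \<equiv> real n powr \<gamma>"

lemma L0: "0 < L" unfolding L_def using numlev_ge(1)[OF \<gamma>0] .

lemma n_less: "n < B ^ L"
proof -
  have "Suc n ^ 1 \<le> Suc n ^ L" using L0 by (intro power_increasing) auto
  then have "n < Suc n ^ L" by simp
  then show ?thesis unfolding B_def by (rule LeastI)
qed

lemma B0: "0 < B"
  using n_less L0 by (cases B) (auto simp: zero_power)

lemma NS0: "0 < NS"
  using B0 L0 by (simp add: NS_def)

lemma D0: "0 < D" by (simp add: D_def)

lemma X1: "1 \<le> X"
  using n1 \<gamma>0 by (intro ge_one_powr_ge_zero) auto

lemma nb_le: "real nb \<le> X"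
  unfolding nb_def using X1 by linarith

text \<open>Minimality of \<open>B\<close> gives \<open>(B - 1) ^ L \<le> n\<close>, so
  \<open>B - 1\<close> is at most \<open>n powr (1 / L)\<close>, and
  \<open>1 / L \<le> \<gamma> / 2\<close>. The factor \<open>2\<close> absorbs the
  \<open>- 1\<close>.\<close>

lemma B_le: "real B \<le> 2 * real n powr (\<gamma> / 2)"
proof -
  let ?Y = "real n powr (\<gamma> / 2)"
  have Y: "1 \<le> ?Y" using n1 \<gamma>0 by (intro ge_one_powr_ge_zero) auto
  have "\<not> n < (B - 1) ^ L" unfolding B_def by (rule not_less_Least) (use B0 B_def in simp)
  then have "real (B - 1) ^ L \<le> real n" by (metis not_less of_nat_le_iff of_nat_power)
  then have "(real (B - 1) ^ L) powr (1 / real L) \<le> real n powr (1 / real L)"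
    by (intro powr_mono2) auto
  moreover have "(real (B - 1) ^ L) powr (1 / real L) = real (B - 1)"
  proof (cases "B - 1 = 0")
    case False
    then have "0 < real (B - 1)" by simp
    then show ?thesis using L0 by (simp add: powr_realpow[symmetric] powr_powr)
  qed (use L0 in \<open>simp add: zero_power\<close>)
  moreover have "real n powr (1 / real L) \<le> ?Y"
  proof (intro powr_mono)
    have "2 / \<gamma> \<le> real L" unfolding L_def by (rule numlev_ge(2)[OF \<gamma>0])
    then show "1 / real L \<le> \<gamma> / 2" using \<gamma>0 L0 by (simp add: field_simps)
  qed (use n1 in auto)
  ultimately have "real (B - 1) \<le> ?Y" by linarith
  then show ?thesis using Y B0 by (simp add: of_nat_diff)
qed

lemma B_sq: "real B * real B \<le> 4 * X"
proof -
  have "real B * real B \<le> (2 * real n powr (\<gamma> / 2)) * (2 * real n powr (\<gamma> / 2))"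
    using B_le by (intro mult_mono) auto
  also have "\<dots> = 4 * X" by (simp add: powr_add[symmetric])
  finally show ?thesis .
qed

lemma one_le_XD: "1 \<le> X * real D"
  using X1 D0 mult_mono[of 1 X 1 "real D"] by simp

text \<open>The leading term is \<open>16 * NS^2 * D^2\<close>; with \<open>NS \<le> L * B\<close>
  and \<open>B * B \<le> 4 X\<close> it is at most \<open>64 * L^2 * X * D^2\<close>.\<close>

lemma W_bound: "real (W + 1) \<le> timec \<gamma> * (X * real D) ^ 2"
proof -
  let ?Z = "X * real D"
  have D1: "1 \<le> real D" using D0 by simp
  have Z1: "1 \<le> ?Z ^ 2" using one_le_XD by simp
  have "?Z * 1 \<le> ?Z * ?Z" using one_le_XD by (intro mult_left_mono) auto
  then have Z2: "?Z \<le> ?Z ^ 2" by (simp only: power2_eq_square mult_1_right)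
  have XZ: "X \<le> ?Z" using X1 D1 mult_left_mono[OF D1, of X] by simp
  have DZ: "real D \<le> ?Z" using mult_right_mono[OF X1, of "real D"] by simp
  have NS: "real NS \<le> real L * real B"
  proof (cases "B < D")
    case True
    have "1 * 1 \<le> real L * real B" using L0 B0 by (intro mult_mono) auto
    then show ?thesis using True by (simp add: NS_def)
  qed (simp add: NS_def)
  have "real NS * real NS \<le> (real L * real B) * (real L * real B)" using NS by (intro mult_mono) auto
  also have "\<dots> = real L ^ 2 * (real B * real B)" by (simp add: power2_eq_square mult_ac)
  also have "\<dots> \<le> real L ^ 2 * (4 * X)" using B_sq by (intro mult_left_mono) auto
  finally have "real NS * real NS \<le> real L ^ 2 * (4 * X)" .
  then have "16 * (real NS * real NS) * (real D * real D) \<le> 16 * (real L ^ 2 * (4 * X)) * (real D * real D)"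
    by (intro mult_right_mono mult_left_mono) auto
  also have "\<dots> = 64 * real L ^ 2 * (X * (real D * real D))" by simp
  also have "\<dots> \<le> 64 * real L ^ 2 * ?Z ^ 2"
  proof (intro mult_left_mono)
    have "X * (real D * real D) * 1 \<le> X * (real D * real D) * X" using X1 by (intro mult_left_mono) auto
    then show "X * (real D * real D) \<le> ?Z ^ 2" by (simp add: power2_eq_square mult_ac)
  qed auto
  finally have 1: "16 * (real NS * real NS) * (real D * real D) \<le> 64 * real L ^ 2 * ?Z ^ 2" .
  have 2: "real B \<le> 2 * ?Z ^ 2"
  proof -
    have "real n powr (\<gamma> / 2) \<le> X" using n1 \<gamma>0 by (intro powr_mono) auto
    then show ?thesis using B_le XZ Z2 by linarith
  qed
  have 3: "real L \<le> real L * ?Z ^ 2" using Z1 mult_left_mono[OF Z1, of "real L"] by simp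
  have 4: "real nb \<le> ?Z ^ 2" using nb_le XZ Z2 by linarith
  have 5: "real D \<le> ?Z ^ 2" using DZ Z2 by linarith
  have "real (W + 1) = 16 * (real NS * real NS) * (real D * real D) + real B + real L + real nb + real D + 1"
    by (simp add: W_def mult_ac)
  also have "\<dots> \<le> 64 * real L ^ 2 * ?Z ^ 2 + 2 * ?Z ^ 2 + real L * ?Z ^ 2 + ?Z ^ 2 + ?Z ^ 2 + ?Z ^ 2"
    using 1 2 3 4 5 Z1 by linarith
  also have "\<dots> \<le> timec \<gamma> * ?Z ^ 2"
  proof -
    have "64 * real L ^ 2 * ?Z ^ 2 + 2 * ?Z ^ 2 + real L * ?Z ^ 2 + ?Z ^ 2 + ?Z ^ 2 + ?Z ^ 2 = (64 * real L ^ 2 + real L + 5) * ?Z ^ 2"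
      by (simp add: distrib_right)
    also have "\<dots> \<le> timec \<gamma> * ?Z ^ 2" by (intro mult_right_mono) (auto simp: timec_def L_def)
    finally show ?thesis .
  qed
  finally show ?thesis .
qed

text \<open>\<open>10\<close> is a common bound on the nesting depth of all programs; as
  \<open>W + 1\<close> is quadratic in \<open>X * D\<close>, the exponent becomes
  \<open>20\<close>.\<close>

lemma tb_bound:
  assumes "depth c \<le> 10"
  shows "real (tb W c) \<le> real (csize c) * timec \<gamma> ^ 10 * (X * real D) ^ 20"
proof -
  have "real (tb W c) \<le> real (csize c * (W + 1) ^ 10)"
    using tb_le[OF assms, of W] by (simp only: of_nat_le_iff)
  also have "\<dots> = real (csize c) * real (W + 1) ^ 10" by simp
  also have "\<dots> \<le> real (csize c) * (timec \<gamma> * (X * real D) ^ 2) ^ 10"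
    using W_bound by (intro mult_left_mono power_mono) auto
  also have "\<dots> = real (csize c) * timec \<gamma> ^ 10 * (X * real D) ^ 20"
    by (simp add: power_mult_distrib power_mult[symmetric])
  finally show ?thesis .
qed

text \<open>If \<open>D \<le> B\<close>, one factor \<open>D\<close> of \<open>L * B * D * D\<close>
  is traded for \<open>B\<close>, and \<open>B * B \<le> 4 X\<close>. If \<open>B < D\<close>, the
  single slot is bounded by the assumption \<open>D \<le> X\<close>. The constant is
  \<open>708 = 3 * 192 + 132\<close>, with \<open>L \<le> 3 * levels \<gamma>\<close>.\<close>

lemma S_bound:
  assumes "real D \<le> X"
  shows "real S \<le> 708 * levels \<gamma> * X * real D"
proof -
  let ?Z = "X * real D"
  have l1: "1 \<le> levels \<gamma>" by (simp add: levels_def)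
  have L1: "1 \<le> real L" using L0 by simp
  have "real NS * real D \<le> real L * (4 * X)"
  proof (cases "B < D")
    case True
    have "1 * X \<le> real L * (4 * X)" using L1 X1 by (intro mult_mono) auto
    then show ?thesis using assms True by (simp add: NS_def)
  next
    case False
    then have "real L * (real B * real D) \<le> real L * (real B * real B)" by (intro mult_left_mono) auto
    also have "\<dots> \<le> real L * (4 * X)" using B_sq by (intro mult_left_mono) auto
    finally show ?thesis using False by (simp add: NS_def mult_ac)
  qed
  then have "real NS * real D * real D \<le> real L * (4 * X) * real D" by (intro mult_right_mono) auto
  then have 1: "real (16 * (R * D)) \<le> 64 * real L * ?Z" by (simp add: R_def mult_ac)
  have 2: "real (nb * D) \<le> ?Z" using nb_le by (simp add: mult_right_mono)
  have 3: "real D \<le> ?Z" using mult_right_mono[OF X1, of "real D"] by simp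
  have "real S = 3 * real (16 * (R * D)) + 3 * real (nb * D) + real D + 128" by (simp add: S_def)
  also have "\<dots> \<le> 192 * (real L * ?Z) + 132 * ?Z" using 1 2 3 one_le_XD by linarith
  also have "\<dots> \<le> 192 * ((3 * levels \<gamma>) * ?Z) + 132 * (levels \<gamma> * ?Z)"
  proof (intro add_mono mult_left_mono mult_right_mono)
    show "real L \<le> 3 * levels \<gamma>" unfolding L_def by (rule numlev_ge(3)[OF \<gamma>0])
    show "?Z \<le> levels \<gamma> * ?Z" using mult_right_mono[OF l1, of ?Z] by simp
  qed auto
  also have "\<dots> = 708 * levels \<gamma> * X * real D" by simp
  finally show ?thesis .
qed

text \<open>For the query \<open>D \<le> X\<close> turns \<open>(X * D) ^ 20\<close> into
  \<open>X powr 40\<close>; the update bound uses no relation between \<open>D\<close> and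
  \<open>X\<close>.\<close>

lemma resources:
  assumes C: "1000 \<le> C" and K: "k * timec \<gamma> ^ 10 \<le> K"
    and Tu: "real Tu \<le> k * timec \<gamma> ^ 10 * (X * real D) ^ 20"
    and Tq: "real Tq \<le> k * timec \<gamma> ^ 10 * (X * real D) ^ 20"
    and k0: "0 \<le> k"
  shows "resource_bounds C K \<gamma> n d Tu S Tq"
proof -
  have t0: "0 \<le> timec \<gamma>" by (simp add: timec_def)
  have K0: "0 \<le> K" using K k0 t0 by (meson order_trans mult_nonneg_nonneg zero_le_power)
  have Dd: "real D = real (d + 1)" by (simp add: D_def)
  have pw: "z ^ 20 \<le> z powr C" if "1 \<le> z" for z
  proof -
    have "z ^ 20 = z powr 20" using that powr_realpow[of z 20] by simp
    also have "\<dots> \<le> z powr C" using that C by (intro powr_mono) auto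
    finally show ?thesis .
  qed
  have Tu': "real Tu \<le> K * (X * real (d + 1)) powr C"
  proof -
    have "real Tu \<le> K * (X * real D) ^ 20"
      using Tu mult_right_mono[OF K, of "(X * real D) ^ 20"] by simp
    also have "\<dots> \<le> K * (X * real D) powr C" using pw[OF one_le_XD] K0 by (intro mult_left_mono) auto
    finally show ?thesis unfolding Dd .
  qed
  have Sq: "real S \<le> C * levels \<gamma> * X * real (d + 1) \<and> real Tq \<le> K * X powr C" if D: "real (d + 1) \<le> X"
  proof
    have l1: "1 \<le> levels \<gamma>" by (simp add: levels_def)
    have "real S \<le> 708 * levels \<gamma> * X * real D" using D unfolding Dd[symmetric] by (rule S_bound)
    also have "\<dots> \<le> C * levels \<gamma> * X * real D" using C l1 by (intro mult_right_mono) auto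
    finally show "real S \<le> C * levels \<gamma> * X * real (d + 1)" unfolding Dd .
    have "real Tq \<le> K * (X * real D) ^ 20"
      using Tq mult_right_mono[OF K, of "(X * real D) ^ 20"] by simp
    also have "\<dots> \<le> K * (X * X) ^ 20"
      using D X1 K0 unfolding Dd[symmetric] by (intro mult_left_mono power_mono) auto
    also have "(X * X) ^ 20 = X powr 40"
      using X1 powr_realpow[of X 40] by (simp add: power2_eq_square[symmetric] power_mult[symmetric])
    also have "K * X powr 40 \<le> K * X powr C" using C X1 K0 by (intro mult_left_mono powr_mono) auto
    finally show "real Tq \<le> K * X powr C" .
  qed
  show ?thesis unfolding resource_bounds_def using Tu' Sq by blast
qed

section \<open>Correctness of the two algorithms\<close>

lemma summary_inst:
  assumes "rows_of \<iota> = n" "cols_of \<iota> = d"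
  shows "summary \<iota> D M W R p B L NS"
proof
  have DR: "D \<le> R" using NS0 by (simp add: R_def)
  have NN: "NS \<le> NS * NS" "D \<le> D * D" by simp_all
  have nd: "1 \<le> D * D" "1 \<le> NS * NS" using D0 NS0 by (simp_all add: Suc_le_eq)
  show "D = Suc (cols_of \<iota>)" using assms by (simp add: D_def)
  show "64 \<le> M" "16 * (R * D) \<le> M" "D \<le> R" "D \<le> W" using DR by (simp_all add: M_def W_def)
  show "2 * NS * NS \<le> W"
  proof -
    define a where "a = NS * NS"
    have "a * 1 \<le> a * (D * D)" using nd by (intro mult_le_mono2)
    moreover have "2 * NS * NS = 2 * a" "16 * (a * (D * D)) \<le> W" by (simp_all add: a_def W_def mult.assoc)
    ultimately show ?thesis by linarith
  qed
  show "16 * (R * D) \<le> W"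
  proof -
    have "NS * (D * D) \<le> (NS * NS) * (D * D)" using NN by (intro mult_le_mono1)
    moreover have "16 * (R * D) = 16 * (NS * (D * D))" "16 * ((NS * NS) * (D * D)) \<le> W"
      by (simp_all add: R_def W_def mult.assoc)
    ultimately show ?thesis by linarith
  qed
  show "B \<le> W" "L \<le> W" by (simp_all add: W_def)
qed (use p1 p2 L0 assms in \<open>simp_all add: B_def NS_def R_def\<close>)

abbreviation vw where "vw \<equiv> ram.view D R"
abbreviation ok where "ok Rs s \<equiv> state_ok p D B L Rs (vw s)"

definition fin_post where
  "fin_post s s' \<longleftrightarrow> (\<exists>Q. psd D Q \<and> (\<forall>a<d. snd s' a = - gsG D Q d a) \<and>
     (\<forall>x. approx (lam p D) (qf D Q x powr (p / 2)) (\<Sum>i<NS. qf D (slot D (vw s) i) x powr (p / 2))))"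

lemma upd_exec:
  assumes "ok Rs s" "length r = D" "length Rs < n"
  obtains t m s' where "exec (Input n d [r]) (UpdC p L) s t m s'" "t \<le> tb W (UpdC p L)" "m \<le> M" "ok (Rs @ [r]) s'"
proof -
  interpret summary "Input n d [r]" D M W R p B L NS by (rule summary_inst) simp_all
  show thesis using run_Upd[of r Rs s] assms that unfolding run_def by auto
qed

lemma qryS_exec:
  assumes "ok Rs s"
  obtains t m s' where "exec (Input n d []) (QrySC p L) s t m s'" "t \<le> tb W (QrySC p L)" "m \<le> M" "fin_post s s'"
proof -
  interpret summary "Input n d []" D M W R p B L NS by (rule summary_inst) simp_all
  have Dd: "D - 1 = d" by (simp add: D_def)
  have "run (PrmC L) s (\<lambda>s'. fst s' 2 = NS \<and> view s' = view s)"
    by (rule wpD[where P = "\<lambda>\<rho>' \<mu>'. \<rho>' 2 = NS \<and> \<mu>' = view s"], rule wp_Prm) simp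
  then have "run (QrySC p L) s (fin_post s)"
    unfolding QrySC_def
  proof (rule run_Seq[OF run_weaken])
    fix s1 assume s1: "fst s1 2 = NS \<and> view s1 = view s"
    show "run (FinC p) s1 (fin_post s)"
      using run_Fin[of Rs s1] s1 assms unfolding fin_post_def Dd by simp
  qed
  then show thesis using that unfolding run_def by auto
qed

lemma qryD_exec:
  assumes "ok Rs (\<rho>, g)"
  obtains t m s' where "exec (Input n d [map g [0..<16 * (R * D)]]) (QryDC p L) store0 t m s'"
    "t \<le> tb W (QryDC p L)" "m \<le> M" "fin_post (\<rho>, g) s'"
proof -
  let ?\<iota> = "Input n d [map g [0..<16 * (R * D)]]"
  interpret summary ?\<iota> D M W R p B L NS by (rule summary_inst) simp_all
  have Dd: "D - 1 = d" by (simp add: D_def)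
  have v: "view (\<rho>', msg0) = view (\<rho>, g)" for \<rho>' by (rule view_msg0_map) simp
  have "wp (Seq (PrmC L) LoadC) (\<lambda>\<rho>' \<mu>'. \<rho>' 2 = NS \<and> \<mu>' = view (\<rho>, g)) (fst store0) (view store0)"
    by (rule wp_Seq, rule wp_Prm, rule wp_Load, assumption) (simp add: v agree_def)
  then have "run (Seq (PrmC L) LoadC) store0 (\<lambda>s'. fst s' 2 = NS \<and> view s' = view (\<rho>, g))" by (rule wpD)
  then have "run (Seq (Seq (PrmC L) LoadC) (FinC p)) store0 (fin_post (\<rho>, g))"
  proof (rule run_Seq[OF run_weaken])
    fix s1 assume s1: "fst s1 2 = NS \<and> view s1 = view (\<rho>, g)"
    show "run (FinC p) s1 (fin_post (\<rho>, g))"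
      using run_Fin[of Rs s1] s1 assms unfolding fin_post_def Dd by simp
  qed
  then show thesis using that unfolding run_def QryDC_def by auto
qed

text \<open>The two alternatives for \<open>ms\<close> are the nodes of a path tree: an inner node
  with a state and a block, and the childless node at the end, which starts from the zero
  memory.\<close>

lemma mrg_exec:
  assumes "\<And>\<rho>. state_ok p D B L Rs (vw (\<rho>, g))" "\<And>r. r \<in> set rs \<Longrightarrow> length r = D" "length Rs + length rs \<le> n" "length rs \<le> nb"
    and "ms = [map g [0..<16 * (R * D)], concat rs] \<or> ms = [] \<and> g = (\<lambda>_. 0) \<and> rs = []"
  obtains t m s' where "exec (Input n d ms) (MrgC p L) store0 t m s'" "t \<le> tb W (MrgC p L)" "m \<le> M"
    "fst s' 0 = 16 * (R * D)" "ok (Rs @ rs) s'"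
proof -
  interpret summary "Input n d ms" D M W R p B L NS by (rule summary_inst) simp_all
  have v: "view (\<rho>, msg0) = view (\<rho>, g)" for \<rho>
    using assms(5)
  proof
    assume "ms = [map g [0..<16 * (R * D)], concat rs]"
    then have "msgs_of (Input n d ms) = map g [0..<16 * (R * D)] # [concat rs]" by simp
    then show ?thesis by (rule view_msg0_map)
  next
    assume 1: "ms = [] \<and> g = (\<lambda>_. 0) \<and> rs = []"
    then have "view (\<rho>, msg0) = (\<lambda>_ _ _. 0)" by (intro view_msg0_Nil) simp
    also have "\<dots> = view (\<rho>, g)" using 1 by (simp add: view_def fun_eq_iff)
    finally show ?thesis .
  qed
  have "run (MrgC p L) store0 (\<lambda>s'. fst s' 0 = 16 * (R * D) \<and> state_ok p D B L (Rs @ rs) (view s'))"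
  proof (rule run_Mrg)
    show "state_ok p D B L Rs (view (\<rho>, msg0))" for \<rho> unfolding v by (rule assms(1))
    show "length rs \<le> W" using assms(4) by (simp add: W_def)
    show "(if 1 < length (msgs_of (Input n d ms)) then msgs_of (Input n d ms) ! 1 else []) = concat rs"
      using assms(5) by auto
  qed (use assms in auto)
  then show thesis using that unfolding run_def by auto
qed

lemma leaf_exec:
  assumes "\<And>r. r \<in> set rs \<Longrightarrow> length r = D" "length rs \<le> nb"
  obtains t m s' where "exec (Input n d rs) LeafC store0 t m s'" "t \<le> tb W LeafC" "m \<le> M" "summary_of s' = concat rs"
proof -
  interpret summary "Input n d rs" D M W R p B L NS by (rule summary_inst) simp_all
  have "length rs * D \<le> nb * D" using assms(2) by (rule mult_le_mono1)
  also have "\<dots> \<le> M" by (simp add: M_def)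
  finally have "length rs * D \<le> M" .
  then have "run LeafC store0 (\<lambda>s'. summary_of s' = concat rs)"
    using assms by (intro run_Leaf) (auto simp: W_def)
  then show thesis using that unfolding run_def by auto
qed

lemma words_S:
  assumes "m \<le> M" "sum_list (map length ms) \<le> 16 * (R * D) + nb * D + D"
  shows "words (Input n d ms) m \<le> S"
proof -
  have "2 * m \<le> 2 * (16 * (R * D)) + 128 + 2 * (nb * D)" using assms(1) unfolding M_def by linarith
  then show ?thesis unfolding words_def S_def input.sel using assms(2) by linarith
qed

lemma stream_exec:
  assumes "ok Rs s" "\<And>r. r \<in> set rs \<Longrightarrow> length r = D" "length Rs + length rs \<le> n"
  shows "\<exists>s'. stream (UpdC p L) n d (tb W (UpdC p L)) S rs s s' \<and> ok (Rs @ rs) s'"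
  using assms
proof (induction rs arbitrary: Rs s)
  case Nil
  then show ?case by (intro exI[of _ s]) (simp add: stream.Nil)
next
  case (Cons r rs)
  obtain t m s1 where e: "exec (Input n d [r]) (UpdC p L) s t m s1" "t \<le> tb W (UpdC p L)" "m \<le> M" "ok (Rs @ [r]) s1"
    by (rule upd_exec[OF Cons.prems(1), of r]) (use Cons.prems(2,3) in auto)
  obtain s' where s': "stream (UpdC p L) n d (tb W (UpdC p L)) S rs s1 s'" "ok ((Rs @ [r]) @ rs) s'"
    using Cons.IH[OF e(4)] Cons.prems by auto
  have "words (Input n d [r]) m \<le> S"
    using e(3) Cons.prems(2)[of r] by (intro words_S) auto
  then have "stream (UpdC p L) n d (tb W (UpdC p L)) S (r # rs) s s'"
    by (rule stream.Cons[OF e(1,2) _ s'(1)])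
  then show ?case using s'(2) by (intro exI[of _ s'] conjI) simp_all
qed

lemma vw_zero: "vw (\<rho>, \<lambda>_. 0) = (\<lambda>_ _ _. 0)"
proof -
  interpret summary "Input n d []" D M W R p B L NS by (rule summary_inst) simp_all
  show ?thesis by (simp add: view_def fun_eq_iff)
qed

lemma ok_Nil: "ok [] (\<rho>, \<lambda>_. 0)"
  unfolding vw_zero using B0 by (rule state_ok_Nil)

lemma vw_fst: "vw (\<rho>, snd s) = vw s"
proof -
  interpret summary "Input n d []" D M W R p B L NS by (rule summary_inst) simp_all
  show ?thesis by (rule view_fst)
qed

lemma solution_ok:
  assumes A: "A \<in> carrier_mat n d" and b: "b \<in> carrier_vec n" and js: "mset js = mset [0..<n]"
    and s: "ok (map (aug_row A b) js) s" "fin_post s s'" and C: "1000 + 16 * p \<le> C"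
  shows "lp_approx_solution p (real (d + 1) powr (C * levels \<gamma>)) A b (solution_of d s')"
proof -
  obtain Q where Q: "psd D Q" "\<And>a. a < d \<Longrightarrow> snd s' a = - gsG D Q d a"
    "\<And>x. approx (lam p D) (qf D Q x powr (p / 2)) (\<Sum>i<NS. qf D (slot D (vw s) i) x powr (p / 2))"
    using s(2) unfolding fin_post_def by blast
  have l1: "1 \<le> levels \<gamma>" by (simp add: levels_def)
  have "real (L + 1) \<le> 4 * levels \<gamma>"
    using numlev_ge(3)[OF \<gamma>0] l1 by (simp add: L_def)
  then have "4 * (5 + p) * real (L + 1) \<le> 4 * (5 + p) * (4 * levels \<gamma>)"
    using p1 by (intro mult_left_mono) auto
  also have "\<dots> = (80 + 16 * p) * levels \<gamma>" by (simp add: algebra_simps)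
  also have "\<dots> \<le> C * levels \<gamma>" using C l1 by (intro mult_right_mono) auto
  finally have c: "4 * (5 + p) * real (L + 1) \<le> C * levels \<gamma>" .
  show ?thesis
  proof (rule solution_approx[OF p1 n1 A b js _ n_less _ _ _ _ c])
    show "state_ok p (d + 1) B L (map (aug_row A b) js) (vw s)" using s(1) unfolding D_def .
    show "psd (d + 1) Q" using Q(1) unfolding D_def .
    show "approx (lam p (d + 1)) (qf (d + 1) Q x powr (p / 2))
        (\<Sum>i<(if B < d + 1 then 1 else L * B). qf (d + 1) (slot (d + 1) (vw s) i) x powr (p / 2))" for x
      using Q(3)[of x] unfolding NS_def D_def .
    show "solution_of d s' $ a = - gsG (d + 1) Q d a" if "a < d" for a
      using that Q(2) by (simp add: solution_of_def D_def)
  qed (simp add: solution_of_def)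
qed

lemma aug_row_length: "A \<in> carrier_mat n d \<Longrightarrow> length (aug_row A b i) = D"
  by (simp add: aug_row_def D_def)

lemma streaming:
  assumes A: "A \<in> carrier_mat n d" and b: "b \<in> carrier_vec n" and C: "1000 + 16 * p \<le> C"
  shows "\<exists>x. streaming_computes (UpdC p L) (QrySC p L) A b (tb W (UpdC p L)) S (tb W (QrySC p L)) x \<and>
     lp_approx_solution p (real (d + 1) powr (C * levels \<gamma>)) A b x"
proof -
  let ?rows = "map (aug_row A b) [0..<n]"
  have dims: "dim_row A = n" "dim_col A = d" using A by auto
  have "ok [] store0" unfolding store0_def by (rule ok_Nil)
  then obtain s where s: "stream (UpdC p L) n d (tb W (UpdC p L)) S ?rows store0 s" "ok ?rows s"
    using stream_exec[of "[]" store0 ?rows] aug_row_length[OF A] by auto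
  obtain t m s' where q: "exec (Input n d []) (QrySC p L) s t m s'" "t \<le> tb W (QrySC p L)" "m \<le> M" "fin_post s s'"
    using qryS_exec[OF s(2)] by blast
  have "words (Input n d []) m \<le> S" using q(3) by (rule words_S) simp
  then have "streaming_computes (UpdC p L) (QrySC p L) A b (tb W (UpdC p L)) S (tb W (QrySC p L)) (solution_of d s')"
    unfolding streaming_computes_def Let_def dims using s(1) q by blast
  moreover have "lp_approx_solution p (real (d + 1) powr (C * levels \<gamma>)) A b (solution_of d s')"
    by (rule solution_ok[OF A b _ s(2) q(4) C]) simp
  ultimately show ?thesis by blast
qed

end

text \<open>The computation tree is a path: each inner node passes on the state of the streaming
  algorithm, to which it adds the rows of one block.\<close>

fun path_tree :: "nat \<Rightarrow> nat ctree" where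
  "path_tree 0 = Node []"
| "path_tree (Suc l) = Node [path_tree l, Leaf l]"

lemma leaves_path_tree: "leaves (path_tree l) = [0..<l]"
  by (induction l) auto

context setting
begin

abbreviation tree_sums where
  "tree_sums A b \<equiv> summarises LeafC (MrgC p L) A b (tb W LeafC + tb W (MrgC p L)) S"

text \<open>The length of the path does not harm the accuracy: after \<open>l\<close> blocks the
  state is that of the counter after all their rows, and no form has been merged more often than its
  level says.\<close>

lemma summarises_path:
  assumes A: "A \<in> carrier_mat n d" and Bs: "row_partition n X Bs" and l: "l \<le> length Bs"
  shows "\<exists>g. tree_sums A b (map_ctree ((!) Bs) (path_tree l))
      (map g [0..<16 * (R * D)]) \<and> (\<forall>\<rho>. ok (map (aug_row A b) (concat (take l Bs))) (\<rho>, g))"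
  using l
proof (induction l)
  have dims: "dim_row A = n" "dim_col A = d" using A by auto
  {
    case 0
    \<comment> \<open>The innermost node has no children; its run on no messages produces the empty
      state.\<close>
    obtain t m s' where e: "exec (Input n d []) (MrgC p L) store0 t m s'" "t \<le> tb W (MrgC p L)" "m \<le> M"
      "fst s' 0 = 16 * (R * D)" "ok ([] @ []) s'"
      by (rule mrg_exec[of "[]" "\<lambda>_. 0" "[]" "[]"]) (use ok_Nil in auto)
    have "tree_sums A b (Node []) (summary_of s')"
    proof (rule summarises.Node)
      show "words (Input n d []) m \<le> S" using e(3) by (rule words_S) simp
      show "t \<le> tb W LeafC + tb W (MrgC p L)" using e(2) by (rule trans_le_add2)
    qed (use e dims in simp_all)
    then show ?case using e(4,5) vw_fst[of _ s'] by (intro exI[of _ "snd s'"]) (simp add: summary_of_def)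
  next
    case (Suc l)
    then obtain g where g: "tree_sums A b (map_ctree ((!) Bs) (path_tree l))
      (map g [0..<16 * (R * D)])" "\<And>\<rho>. ok (map (aug_row A b) (concat (take l Bs))) (\<rho>, g)" by auto
    let ?rs = "map (aug_row A b) (Bs ! l)"
    have Bl: "Bs ! l \<in> set Bs" using Suc.prems by simp
    have rsD: "\<And>r. r \<in> set ?rs \<Longrightarrow> length r = D" using aug_row_length[OF A] by auto
    have "real (length (Bs ! l)) \<le> X" using Bs Bl by (auto simp: row_partition_def)
    then have nb: "length ?rs \<le> nb" unfolding nb_def by (simp add: le_nat_floor)
    have tk: "take (Suc l) Bs = take l Bs @ [Bs ! l]" using Suc.prems by (simp add: take_Suc_conv_app_nth)
    have "length (concat Bs) = n" using Bs by (metis row_partition_def length_upt size_mset diff_zero)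
    moreover have "length (concat (take (Suc l) Bs)) \<le> length (concat Bs)"
      by (metis append_take_drop_id concat_append length_append le_add1)
    ultimately have len: "length (map (aug_row A b) (concat (take l Bs))) + length ?rs \<le> n" unfolding tk by simp
    have "length (concat ?rs) = length ?rs * D" by (rule length_concat_uniform[OF rsD])
    also have "\<dots> \<le> nb * D" using nb by (rule mult_le_mono1)
    finally have wd': "length (concat ?rs) \<le> nb * D" .
    then have wd: "sum_list (map length ?rs) \<le> nb * D" by (simp only: length_concat)
    obtain t m s where e1: "exec (Input n d ?rs) LeafC store0 t m s" "t \<le> tb W LeafC" "m \<le> M" "summary_of s = concat ?rs"
      using leaf_exec[OF rsD nb] by blast
    have leaf: "tree_sums A b (Leaf (Bs ! l)) (concat ?rs)"
      unfolding e1(4)[symmetric]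
    proof (rule summarises.Leaf)
      show "words (Input n d ?rs) m \<le> S" using e1(3) by (rule words_S) (use wd in linarith)
      show "t \<le> tb W LeafC + tb W (MrgC p L)" using e1(2) by (rule trans_le_add1)
    qed (use e1 dims in simp_all)
    obtain t m s' where e: "exec (Input n d [map g [0..<16 * (R * D)], concat ?rs]) (MrgC p L) store0 t m s'"
      "t \<le> tb W (MrgC p L)" "m \<le> M" "fst s' 0 = 16 * (R * D)" "ok (map (aug_row A b) (concat (take l Bs)) @ ?rs) s'"
      using mrg_exec[OF g(2) rsD len nb] by blast
    have wdms: "sum_list (map length [map g [0..<16 * (R * D)], concat ?rs]) \<le> 16 * (R * D) + nb * D + D"
      using wd' by simp
    have "tree_sums A b
        (Node [map_ctree ((!) Bs) (path_tree l), Leaf (Bs ! l)]) (summary_of s')"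
    proof (intro summarises.Node)
      show "words (Input n d [map g [0..<16 * (R * D)], concat ?rs]) m \<le> S"
        using e(3) wdms by (rule words_S)
      show "list_all2 (tree_sums A b)
          [map_ctree ((!) Bs) (path_tree l), Leaf (Bs ! l)] [map g [0..<16 * (R * D)], concat ?rs]"
        using g(1) leaf by simp
      show "t \<le> tb W LeafC + tb W (MrgC p L)" using e(2) by (rule trans_le_add2)
    qed (use e dims in simp_all)
    then show ?case using e(4,5) vw_fst[of _ s'] unfolding tk
      by (intro exI[of _ "snd s'"]) (simp add: summary_of_def)
  }
qed

lemma distributed:
  assumes A: "A \<in> carrier_mat n d" and b: "b \<in> carrier_vec n" and Bs: "row_partition n X Bs" and C: "1000 + 16 * p \<le> C"
  shows "\<exists>x. distributed_computes (\<lambda>_ _ l. path_tree l) LeafC (MrgC p L) (QryDC p L) A b Bs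
      (tb W LeafC + tb W (MrgC p L)) S (tb W (QryDC p L)) x \<and>
     lp_approx_solution p (real (d + 1) powr (C * levels \<gamma>)) A b x"
proof -
  have dims: "dim_row A = n" "dim_col A = d" using A by auto
  obtain g where g: "tree_sums A b (map_ctree ((!) Bs) (path_tree (length Bs)))
      (map g [0..<16 * (R * D)])" "\<And>\<rho>. ok (map (aug_row A b) (concat Bs)) (\<rho>, g)"
    using summarises_path[OF A Bs, of "length Bs"] by auto
  obtain t m s' where q: "exec (Input n d [map g [0..<16 * (R * D)]]) (QryDC p L) store0 t m s'"
    "t \<le> tb W (QryDC p L)" "m \<le> M" "fin_post (\<lambda>_. 0, g) s'"
    using qryD_exec[OF g(2)] by blast
  have "words (Input n d [map g [0..<16 * (R * D)]]) m \<le> S" using q(3) by (rule words_S) simp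
  then have "distributed_computes (\<lambda>_ _ l. path_tree l) LeafC (MrgC p L) (QryDC p L) A b Bs
      (tb W LeafC + tb W (MrgC p L)) S (tb W (QryDC p L)) (solution_of d s')"
    unfolding distributed_computes_def Let_def dims using g(1) q by blast
  moreover have "lp_approx_solution p (real (d + 1) powr (C * levels \<gamma>)) A b (solution_of d s')"
    by (rule solution_ok[OF A b _ g(2) q(4) C]) (use Bs in \<open>simp add: row_partition_def\<close>)
  ultimately show ?thesis by blast
qed

end

text \<open>The deepest nesting comes from computing a score inside the merging loop, inside the
  loop over the levels.\<close>

lemma depth_programs:
  "depth (UpdC p L) \<le> 10" "depth (QrySC p L) \<le> 10" "depth LeafC \<le> 10" "depth (MrgC p L) \<le> 10" "depth (QryDC p L) \<le> 10"
  by (simp_all add: UpdC_def QrySC_def LeafC_def MrgC_def QryDC_def PrmC_def RowC_def InsC_def FinC_def LoadC_def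
      LevelC_def CountC_def ClearC_def Red_def Qc_def GSc_def TauC_def UpdW_def Fill_def SumTo_def For_def SetA_def)

theorem theorem4:
  fixes p :: real
  assumes "1 \<le> p" and "p \<noteq> 2"
  shows "\<exists>C>0. \<forall>\<gamma>>0. \<exists>K>0.
    (\<exists>upd qry. \<forall>n\<ge>1. \<forall>d. \<forall>A\<in>carrier_mat n d. \<forall>b\<in>carrier_vec n.
       \<exists>Tu S Tq x.
         streaming_computes upd qry A b Tu S Tq x \<and>
         lp_approx_solution p (real (d + 1) powr (C * levels \<gamma>)) A b x \<and>
         resource_bounds C K \<gamma> n d Tu S Tq) \<and>
    (\<exists>plan lf mrg qry. tree_plan plan \<and>
       (\<forall>n\<ge>1. \<forall>d. \<forall>A\<in>carrier_mat n d. \<forall>b\<in>carrier_vec n.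
        \<forall>Bs. row_partition n (real n powr \<gamma>) Bs \<longrightarrow>
          (\<exists>Tu S Tq x.
             distributed_computes plan lf mrg qry A b Bs Tu S Tq x \<and>
             lp_approx_solution p (real (d + 1) powr (C * levels \<gamma>)) A b x \<and>
             resource_bounds C K \<gamma> n d Tu S Tq)))"
proof -
  \<comment> \<open>\<open>80 + 16 * p\<close> is needed for the exponent
    \<open>4 * (5 + p) * (L + 1)\<close>, as \<open>L + 1 \<le> 4 * levels \<gamma>\<close>; the
    rest exceeds the storage constant \<open>708\<close> and the exponents \<open>20\<close> and
    \<open>40\<close> of the time bounds.\<close>
  define C where "C = 1000 + 16 * p"
  have C: "0 < C" "1000 \<le> C" "1000 + 16 * p \<le> C" using assms by (auto simp: C_def)
  show ?thesis
  proof (rule exI[of _ C], intro conjI allI impI, goal_cases)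
    case (2 \<gamma>)
    define N where "N = numlev \<gamma>"
    \<comment> \<open>The sizes of all programs together. They depend on \<open>\<gamma>\<close>
      through \<open>N\<close>, which is why \<open>K\<close> is chosen after
      \<open>\<gamma>\<close> and \<open>C\<close> before it.\<close>
    define k where "k = real (csize (UpdC p N) + csize (QrySC p N) + csize LeafC + csize (MrgC p N) + csize (QryDC p N) + 1)"
    define K where "K = k * timec \<gamma> ^ 10"
    have k0: "0 < k" unfolding k_def of_nat_0_less_iff by simp
    have t0: "0 < timec \<gamma>" unfolding timec_def by (intro add_nonneg_pos) auto
    have "0 < K" using k0 t0 by (simp add: K_def)
    have time: "real T \<le> k * timec \<gamma> ^ 10 * Z"
      if "real T \<le> c * timec \<gamma> ^ 10 * Z" "c \<le> k" "0 \<le> Z" for T c Z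
    proof -
      have "c * timec \<gamma> ^ 10 * Z \<le> k * timec \<gamma> ^ 10 * Z"
        using that t0 by (intro mult_right_mono) auto
      with that(1) show ?thesis by linarith
    qed
    have s: "\<exists>Tu S Tq x. streaming_computes (UpdC p N) (QrySC p N) A b Tu S Tq x \<and>
         lp_approx_solution p (real (d + 1) powr (C * levels \<gamma>)) A b x \<and> resource_bounds C K \<gamma> n d Tu S Tq"
      if n: "1 \<le> n" and A: "A \<in> carrier_mat n d" and b: "b \<in> carrier_vec n" for n d A b
    proof -
      interpret setting p \<gamma> n d using assms 2 n by unfold_locales auto
      have L: "L = N" by (simp add: L_def N_def)
      have Z: "0 \<le> (X * real D) ^ 20" by simp
      have "resource_bounds C K \<gamma> n d (tb W (UpdC p N)) S (tb W (QrySC p N))"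
      proof (rule resources[OF C(2), of k])
        show "real (tb W (UpdC p N)) \<le> k * timec \<gamma> ^ 10 * (X * real D) ^ 20"
          by (rule time[OF tb_bound[OF depth_programs(1)] _ Z]) (simp add: k_def)
        show "real (tb W (QrySC p N)) \<le> k * timec \<gamma> ^ 10 * (X * real D) ^ 20"
          by (rule time[OF tb_bound[OF depth_programs(2)] _ Z]) (simp add: k_def)
      qed (use k0 in \<open>auto simp: K_def\<close>)
      then show ?thesis using streaming[OF A b C(3)] unfolding L by blast
    qed
    have t: "\<exists>Tu S Tq x. distributed_computes (\<lambda>_ _ l. path_tree l) LeafC (MrgC p N) (QryDC p N) A b Bs Tu S Tq x \<and>
         lp_approx_solution p (real (d + 1) powr (C * levels \<gamma>)) A b x \<and> resource_bounds C K \<gamma> n d Tu S Tq"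
      if n: "1 \<le> n" and A: "A \<in> carrier_mat n d" and b: "b \<in> carrier_vec n"
        and Bs: "row_partition n (real n powr \<gamma>) Bs" for n d A b Bs
    proof -
      interpret setting p \<gamma> n d using assms 2 n by unfold_locales auto
      have L: "L = N" by (simp add: L_def N_def)
      have Z: "0 \<le> (X * real D) ^ 20" by simp
      have "resource_bounds C K \<gamma> n d (tb W LeafC + tb W (MrgC p N)) S (tb W (QryDC p N))"
      proof (rule resources[OF C(2), of k])
        have "real (tb W LeafC + tb W (MrgC p N))
            \<le> real (csize LeafC + csize (MrgC p N)) * timec \<gamma> ^ 10 * (X * real D) ^ 20"
          using tb_bound[OF depth_programs(3)] tb_bound[OF depth_programs(4), of p N]
          by (simp add: distrib_right)
        then show "real (tb W LeafC + tb W (MrgC p N)) \<le> k * timec \<gamma> ^ 10 * (X * real D) ^ 20"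
          by (rule time[OF _ _ Z]) (simp add: k_def)
        show "real (tb W (QryDC p N)) \<le> k * timec \<gamma> ^ 10 * (X * real D) ^ 20"
          by (rule time[OF tb_bound[OF depth_programs(5)] _ Z]) (simp add: k_def)
      qed (use k0 in \<open>auto simp: K_def\<close>)
      then show ?thesis using distributed[OF A b Bs C(3)] unfolding L by blast
    qed
    have plan: "tree_plan (\<lambda>_ _ l. path_tree l)" by (simp add: tree_plan_def leaves_path_tree)
    show ?case using s t plan \<open>0 < K\<close> by (intro exI[of _ K] conjI) blast+
  qed (rule C(1))
qed

end
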